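(* Let $M=S^1\times(H_3(\mathbb{Z})\backslash H_3(\mathbb{R}))$ be the Kodaira-Thurston manifold, with local coordinates $t,x,y,z$. For $b\in\mathbb{R}\setminus\{0\}$ consider the almost complex structure $J_b$ on $M$ whose $(1,0)$-forms are spanned at every point $p\in M$ (i.e. $(T^{1,0}_pM)^*$ is spanned) by $$\phi^1=dt+i\,dx,\qquad \phi^2=dy-ib(dz-x\,dy).$$ Endow $(M,J_b)$ with the almost Kähler metric given by the compatible symplectic form $$\omega_b=i(\phi^1\wedge\bar\phi^1+\phi^2\wedge\bar\phi^2)=2\,dt\wedge dx+2b\,dz\wedge dy,$$ and with the volume form $\mathrm{Vol}$ such that $2\mathrm{Vol}=\omega_b^2$. Then, for all $b\in\mathbb{R}\setminus\{0\}$ and all $(p,q)\in\{(0,0),(1,0),(1,1),(2,0),(0,2),(2,2)\}$, $$\mathcal{H}^{p,q}_{BC}=\mathcal{H}^{p,q}_{\bar\partial},$$ while for every $(p,q)\in\{(0,1),(2,1),(1,2)\}$ there exists $b\in\mathbb{R}\setminus\{0\}$ such that $$\mathcal{H}^{p,q}_{BC}\neq\mathcal{H}^{p,q}_{\bar\partial}.$$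
   Context: $H_3(\mathbb{R})$ is the Heisenberg group of matrices $\begin{pmatrix}1&x&z\\0&1&y\\0&0&1\end{pmatrix}\in \mathrm{GL}(3,\mathbb{R})$, and $H_3(\mathbb{Z})=H_3(\mathbb{R})\cap\mathrm{GL}(3,\mathbb{Z})$ acts on it by left multiplication; $t$ is the coordinate on $S^1=\mathbb{R}/\mathbb{Z}$. Equivalently, $M$ is the quotient of $\mathbb{R}^4$ by $(t,x,y,z)\sim(t+t_0,x+x_0,y+y_0,z+z_0+x_0y)$ for all $t_0,x_0,y_0,z_0\in\mathbb{Z}$, and $dt,dx,dy,dz-x\,dy$ descend to $M$. For an almost complex structure $J$ on a $2n$-manifold with compatible metric $g$, the fundamental form is $\omega(u,v)=g(Ju,v)$ (so $J$ and $\omega$ determine $g$); the structure is almost Kähler if $d\omega=0$. $A^{p,q}$ is the space of smooth complex $(p,q)$-forms with respect to $J$. The exterior differential decomposes on $A^{p,q}$ as $d=\mu+\partial+\bar\partial+\bar\mu$, with components of bidegree $(2,-1),(1,0),(0,1),(-1,2)$ respectively. $*:A^{p,q}\to A^{n-q,n-p}$ is the $\mathbb{C}$-linear Hodge star with respect to $\mathrm{Vol}=\omega^n/n!$, $\alpha\wedge *\bar\beta=\langle\alpha,\beta\rangle\mathrm{Vol}$, where $\langle\cdot,\cdot\rangle$ is the Hermitian inner product on forms induced by $g$. Set $\partial^*=-*\bar\partial*$ and $\bar\partial^*=-*\partial*$. The Dolbeault Laplacian is $\Delta_{\bar\partial}=\bar\partial\bar\partial^*+\bar\partial^*\bar\partial$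 and the Bott-Chern Laplacian is $$\tilde\Delta_{BC}=\partial\bar\partial\bar\partial^*\partial^*+\bar\partial^*\partial^*\partial\bar\partial+\partial^*\bar\partial\bar\partial^*\partial+\bar\partial^*\partial\partial^*\bar\partial+\partial^*\partial+\bar\partial^*\bar\partial .$$ $\mathcal{H}^{p,q}_{\bar\partial}$ and $\mathcal{H}^{p,q}_{BC}$ are the kernels of $\Delta_{\bar\partial}$ and $\tilde\Delta_{BC}$ on $A^{p,q}$ (they depend on $b$). *)

theory Defs
  imports "HOL-Analysis.Analysis" "HOL-Library.Function_Algebras"
begin

section \<open>Differential forms on four-dimensional space\<close>

text \<open>
  A complex multilinear form at a point is a function of the list of its arguments; a form of
  degree k is zero on lists of length other than k. So forms of all degrees, and their sums, live
  in one type. The additive structure is the pointwise one.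
\<close>

type_synonym mform = "(real^4) list \<Rightarrow> complex"

type_synonym dform = "real^4 \<Rightarrow> mform"

definition alternating_form :: "nat \<Rightarrow> mform \<Rightarrow> bool" where
  "alternating_form k \<xi> \<longleftrightarrow>
     (\<forall>vs. length vs \<noteq> k \<longrightarrow> \<xi> vs = 0) \<and>
     (\<forall>vs i. length vs = k \<and> i < k \<longrightarrow> linear (\<lambda>v. \<xi> (vs[i := v]))) \<and>
     (\<forall>vs. length vs = k \<and> \<not> distinct vs \<longrightarrow> \<xi> vs = 0)"

definition covec :: "(real^4 \<Rightarrow> complex) \<Rightarrow> mform" where
  "covec a = (\<lambda>vs. case vs of [v] \<Rightarrow> a v | _ \<Rightarrow> 0)"

definition const_form :: "complex \<Rightarrow> mform" where
  "const_form c = (\<lambda>vs. if vs = [] then c else 0)"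

definition smult_form :: "complex \<Rightarrow> mform \<Rightarrow> mform" where
  "smult_form c \<xi> = (\<lambda>vs. c * \<xi> vs)"

definition cnj_form :: "mform \<Rightarrow> mform" where
  "cnj_form \<xi> = (\<lambda>vs. cnj (\<xi> vs))"

definition degree_part :: "nat \<Rightarrow> mform \<Rightarrow> mform" where
  "degree_part k \<xi> = (\<lambda>vs. if length vs = k then \<xi> vs else 0)"

text \<open>
  The wedge product as the signed sum over shuffles (no factorials):
  \<open>(\<alpha> \<and> \<beta>)(u, v) = \<alpha> u * \<beta> v - \<alpha> v * \<beta> u\<close> for covectors. A shuffle is given by
  the set of positions whose vectors go to the first factor.
\<close>

definition shuffle_sign :: "nat \<Rightarrow> nat set \<Rightarrow> complex" where
  "shuffle_sign n I = (-1) ^ card {(i, j). i \<in> I \<and> j \<in> {..<n} - I \<and> j < i}"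

definition wedge :: "mform \<Rightarrow> mform \<Rightarrow> mform" where
  "wedge \<xi> \<eta> = (\<lambda>vs. \<Sum>I\<in>Pow {..<length vs}.
     shuffle_sign (length vs) I * \<xi> (nths vs I) * \<eta> (nths vs (- I)))"

text \<open>
  The exterior derivative. The arguments are constant vector fields, which commute, so the bracket
  terms of the invariant formula vanish.
\<close>

definition ext_d :: "dform \<Rightarrow> dform" where
  "ext_d \<alpha> = (\<lambda>p vs. \<Sum>i<length vs.
     (-1) ^ i * frechet_derivative (\<lambda>q. \<alpha> q (take i vs @ drop (Suc i) vs)) (at p) (vs ! i))"

definition pullback :: "(real^4 \<Rightarrow> real^4) \<Rightarrow> dform \<Rightarrow> dform" where
  "pullback f \<alpha> = (\<lambda>p vs. \<alpha> (f p) (map (frechet_derivative f (at p)) vs))"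

primrec C_k :: "nat \<Rightarrow> (real^4 \<Rightarrow> complex) \<Rightarrow> bool" where
  "C_k 0 f \<longleftrightarrow> continuous_on UNIV f"
| "C_k (Suc k) f \<longleftrightarrow>
     (\<forall>p. f differentiable (at p)) \<and> (\<forall>v. C_k k (\<lambda>p. frechet_derivative f (at p) v))"

definition smooth_form :: "dform \<Rightarrow> bool" where
  "smooth_form \<alpha> \<longleftrightarrow> (\<forall>vs k. C_k k (\<lambda>p. \<alpha> p vs))"

section \<open>The bigrading of an almost complex structure\<close>

text \<open>
  \<open>bitype j p q\<close> describes the space of \<open>(p,q)\<close>-covectors of a complex structure j on the tangent space:
  the complex span of the wedge products of p covectors of type \<open>(1,0)\<close> and q of type \<open>(0,1)\<close>.
\<close>

inductive bitype :: "(real^4 \<Rightarrow> real^4) \<Rightarrow> nat \<Rightarrow> nat \<Rightarrow> mform \<Rightarrow> bool"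
  for j :: "real^4 \<Rightarrow> real^4" where
  const: "bitype j 0 0 (const_form c)"
| wedge_10: "bitype j p q \<xi> \<Longrightarrow> linear a \<Longrightarrow> (\<And>v. a (j v) = \<i> * a v) \<Longrightarrow>
    bitype j (Suc p) q (wedge (covec a) \<xi>)"
| wedge_01: "bitype j p q \<xi> \<Longrightarrow> linear a \<Longrightarrow> (\<And>v. a (j v) = - \<i> * a v) \<Longrightarrow>
    bitype j p (Suc q) (wedge (covec a) \<xi>)"
| add: "bitype j p q \<xi> \<Longrightarrow> bitype j p q \<eta> \<Longrightarrow> bitype j p q (\<xi> + \<eta>)"

text \<open>
  The \<open>(p,q)\<close>-component. It suffices to sum up to 2, because \<open>bitype j p q\<close> holds only for 0 if
  p or q exceeds the complex dimension 2.
\<close>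

definition bicomponent :: "(real^4 \<Rightarrow> real^4) \<Rightarrow> nat \<Rightarrow> nat \<Rightarrow> mform \<Rightarrow> mform" where
  "bicomponent j p q \<xi> =
     (THE c. (\<forall>r s. bitype j r s (c r s)) \<and> \<xi> = (\<Sum>r\<le>2. \<Sum>s\<le>2. c r s)) p q"

type_synonym acs = "real^4 \<Rightarrow> real^4 \<Rightarrow> real^4"

definition bipart :: "acs \<Rightarrow> nat \<Rightarrow> nat \<Rightarrow> dform \<Rightarrow> dform" where
  "bipart J p q \<alpha> = (\<lambda>x. bicomponent (J x) p q (\<alpha> x))"

text \<open>The components of d of bidegree \<open>(1,0)\<close> and \<open>(0,1)\<close>, as operators on forms of all degrees.\<close>

definition del :: "acs \<Rightarrow> dform \<Rightarrow> dform" where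
  "del J \<alpha> = (\<Sum>p\<le>2. \<Sum>q\<le>2. bipart J (Suc p) q (ext_d (bipart J p q \<alpha>)))"

definition delbar :: "acs \<Rightarrow> dform \<Rightarrow> dform" where
  "delbar J \<alpha> = (\<Sum>p\<le>2. \<Sum>q\<le>2. bipart J p (Suc q) (ext_d (bipart J p q \<alpha>)))"

section \<open>Hodge star and Laplacians\<close>

text \<open>
  In the pointwise definitions j is the complex structure and w the fundamental form at the point.
  The metric is obtained by solving for g from \<open>w(u,v) = g(j u, v)\<close> and \<open>j (j u) = - u\<close>.
\<close>

definition metric :: "(real^4 \<Rightarrow> real^4) \<Rightarrow> mform \<Rightarrow> real^4 \<Rightarrow> real^4 \<Rightarrow> real" where
  "metric j w u v = Re (w [- j u, v])"

definition inverse_metric :: "(real^4 \<Rightarrow> real^4) \<Rightarrow> mform \<Rightarrow> real^4^4" where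
  "inverse_metric j w = matrix_inv (\<chi> a c. metric j w (axis a 1) (axis c 1))"

text \<open>
  The induced Hermitian inner product on k-forms, in index notation
  \<open>1/k! g^{a1 c1} ... g^{ak ck} \<xi>_{a1 ... ak} cnj \<eta>_{c1 ... ck}\<close>; the wedge products of an
  orthonormal coframe are orthonormal.
\<close>

definition inner_form :: "(real^4 \<Rightarrow> real^4) \<Rightarrow> mform \<Rightarrow> nat \<Rightarrow> mform \<Rightarrow> mform \<Rightarrow> complex" where
  "inner_form j w k \<xi> \<eta> =
     (\<Sum>as | length as = k. \<Sum>cs | length cs = k.
        complex_of_real (\<Prod>m<k. inverse_metric j w $ (as ! m) $ (cs ! m)) *
        \<xi> (map (\<lambda>a. axis a 1) as) * cnj (\<eta> (map (\<lambda>c. axis c 1) cs))) / fact k"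

definition vol_form :: "mform \<Rightarrow> mform" where
  "vol_form w = smult_form (1 / 2) (wedge w w)"

text \<open>
  The complex-linear Hodge star on k-forms, from \<open>\<alpha> \<and> * cnj \<beta> = \<langle>\<alpha>,\<beta>\<rangle> Vol\<close>, with the
  conjugate moved to the other side.
\<close>

definition hodge_k :: "(real^4 \<Rightarrow> real^4) \<Rightarrow> mform \<Rightarrow> nat \<Rightarrow> mform \<Rightarrow> mform" where
  "hodge_k j w k \<beta> = (THE \<eta>. alternating_form (4 - k) \<eta> \<and>
     (\<forall>\<alpha>. alternating_form k \<alpha> \<longrightarrow>
        wedge \<alpha> \<eta> = smult_form (inner_form j w k \<alpha> (cnj_form \<beta>)) (vol_form w)))"

definition hodge :: "acs \<Rightarrow> dform \<Rightarrow> dform \<Rightarrow> dform" where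
  "hodge J \<omega> \<alpha> = (\<lambda>x. \<Sum>k\<le>4. hodge_k (J x) (\<omega> x) k (degree_part k (\<alpha> x)))"

definition del_adj :: "acs \<Rightarrow> dform \<Rightarrow> dform \<Rightarrow> dform" where
  "del_adj J \<omega> \<alpha> = - hodge J \<omega> (delbar J (hodge J \<omega> \<alpha>))"

definition delbar_adj :: "acs \<Rightarrow> dform \<Rightarrow> dform \<Rightarrow> dform" where
  "delbar_adj J \<omega> \<alpha> = - hodge J \<omega> (del J (hodge J \<omega> \<alpha>))"

definition laplacian_delbar :: "acs \<Rightarrow> dform \<Rightarrow> dform \<Rightarrow> dform" where
  "laplacian_delbar J \<omega> \<alpha> =
     delbar J (delbar_adj J \<omega> \<alpha>) + delbar_adj J \<omega> (delbar J \<alpha>)"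

definition laplacian_BC :: "acs \<Rightarrow> dform \<Rightarrow> dform \<Rightarrow> dform" where
  "laplacian_BC J \<omega> \<alpha> =
     del J (delbar J (delbar_adj J \<omega> (del_adj J \<omega> \<alpha>))) +
     delbar_adj J \<omega> (del_adj J \<omega> (del J (delbar J \<alpha>))) +
     del_adj J \<omega> (delbar J (delbar_adj J \<omega> (del J \<alpha>))) +
     delbar_adj J \<omega> (del J (del_adj J \<omega> (delbar J \<alpha>))) +
     del_adj J \<omega> (del J \<alpha>) +
     delbar_adj J \<omega> (delbar J \<alpha>)"

section \<open>The Kodaira-Thurston manifold\<close>

text \<open>
  Coordinates \<open>(t, x, y, z)\<close> are the components 1 to 4. The manifold is the quotient of
  \<open>real^4\<close> by the free and properly discontinuous action of the maps \<open>kt_deck\<close>, so forms on it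
  are the forms on \<open>real^4\<close> that are invariant under these maps.
\<close>

definition kt_deck :: "int \<Rightarrow> int \<Rightarrow> int \<Rightarrow> int \<Rightarrow> real^4 \<Rightarrow> real^4" where
  "kt_deck t0 x0 y0 z0 q = vector
     [q $ 1 + of_int t0, q $ 2 + of_int x0, q $ 3 + of_int y0,
      q $ 4 + of_int z0 + of_int x0 * q $ 3]"

definition kt_invariant :: "dform \<Rightarrow> bool" where
  "kt_invariant \<alpha> \<longleftrightarrow> (\<forall>t0 x0 y0 z0. pullback (kt_deck t0 x0 y0 z0) \<alpha> = \<alpha>)"

definition kt_forms :: "acs \<Rightarrow> nat \<Rightarrow> nat \<Rightarrow> dform set" where
  "kt_forms J p q = {\<alpha>. smooth_form \<alpha> \<and> kt_invariant \<alpha> \<and> (\<forall>x. bitype (J x) p q (\<alpha> x))}"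

definition harmonic_delbar :: "acs \<Rightarrow> dform \<Rightarrow> nat \<Rightarrow> nat \<Rightarrow> dform set" where
  "harmonic_delbar J \<omega> p q = {\<alpha> \<in> kt_forms J p q. laplacian_delbar J \<omega> \<alpha> = 0}"

definition harmonic_BC :: "acs \<Rightarrow> dform \<Rightarrow> nat \<Rightarrow> nat \<Rightarrow> dform set" where
  "harmonic_BC J \<omega> p q = {\<alpha> \<in> kt_forms J p q. laplacian_BC J \<omega> \<alpha> = 0}"

definition phi1 :: dform where
  "phi1 = (\<lambda>p. covec (\<lambda>v. of_real (v $ 1) + \<i> * of_real (v $ 2)))"

definition phi2 :: "real \<Rightarrow> dform" where
  "phi2 b = (\<lambda>p. covec (\<lambda>v. of_real (v $ 3) -
     \<i> * of_real b * (of_real (v $ 4) - of_real (p $ 2) * of_real (v $ 3))))"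

definition kt_J :: "real \<Rightarrow> acs" where
  "kt_J b = (\<lambda>p. THE j. linear j \<and> (\<forall>v. j (j v) = - v) \<and>
     {covec a | a. linear a \<and> (\<forall>v. a (j v) = \<i> * a v)} =
     {smult_form c1 (phi1 p) + smult_form c2 (phi2 b p) | c1 c2. True})"

definition kt_omega :: "real \<Rightarrow> dform" where
  "kt_omega b = (\<lambda>p. smult_form \<i>
     (wedge (phi1 p) (cnj_form (phi1 p)) + wedge (phi2 b p) (cnj_form (phi2 b p))))"

section \<open>The forms descend and the structure is almost Kaehler\<close>

lemma vector_4_nth: "vector [a1, a2, a3, a4] $ (1::4) = a1" "vector [a1, a2, a3, a4] $ (2::4) = a2"
    "vector [a1, a2, a3, a4] $ (3::4) = a3" "vector [a1, a2, a3, a4] $ (4::4) = a4"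
    for a1 a2 a3 a4 :: real
    by (simp_all add: vector_def)

lemma phi1_coeff_linear: "linear (\<lambda>v::real^4. of_real (v $ 1) + \<i> * of_real (v $ 2) :: complex)"
  by (rule linearI) (simp_all add: complex_eq_iff algebra_simps)

lemma phi2_coeff_linear: "linear (\<lambda>v::real^4. of_real (v $ 3) -
     \<i> * of_real b * (of_real (v $ 4) - of_real x * of_real (v $ 3)) :: complex)"
  by (rule linearI) (simp_all add: complex_eq_iff algebra_simps)

lemma covec_eq_iff: "covec a = covec c \<longleftrightarrow> a = c"
proof
  assume "covec a = covec c"
  then have "covec a [v] = covec c [v]" for v by simp
  then show "a = c" by (auto simp: covec_def)
qed simp

lemma covec_comb: "smult_form c1 (covec a) + smult_form c2 (covec d) = covec (\<lambda>v. c1 * a v + c2 * d v)"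
  by (auto simp: fun_eq_iff smult_form_def covec_def split: list.split)

lemma wedge_covec:
  "wedge (covec a) (covec c) = (\<lambda>vs. case vs of [u, v] \<Rightarrow> a u * c v - a v * c u | _ \<Rightarrow> 0)"
proof
  fix vs :: "(real^4) list"
  have len: "covec a (nths vs I) * covec c (nths vs (- I)) = 0"
    if "I \<subseteq> {..<length vs}" "length vs \<noteq> 2" for I
  proof (rule ccontr)
    assume nz: "covec a (nths vs I) * covec c (nths vs (- I)) \<noteq> 0"
    then have "length (nths vs I) = 1" "length (nths vs (- I)) = 1"
      by (auto simp: covec_def split: list.splits)
    then have "card {i. i < length vs \<and> i \<in> I} = 1" "card {i. i < length vs \<and> i \<in> - I} = 1"
      by (auto simp: length_nths)
    then have "card ({i. i < length vs \<and> i \<in> I} \<union> {i. i < length vs \<and> i \<in> - I}) = 1 + 1"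
      by (subst card_Un_disjoint) auto
    moreover have "{i. i < length vs \<and> i \<in> I} \<union> {i. i < length vs \<and> i \<in> - I} = {..<length vs}"
      by auto
    ultimately show False using that by simp
  qed
  show "wedge (covec a) (covec c) vs = (case vs of [u, v] \<Rightarrow> a u * c v - a v * c u | _ \<Rightarrow> 0)"
  proof (cases "length vs = 2")
    case False
    then have "wedge (covec a) (covec c) vs = 0"
      unfolding wedge_def using len by (intro sum.neutral) (auto simp: mult.assoc)
    with False show ?thesis by (auto split: list.split)
  next
    case True
    then obtain u v where vs: "vs = [u, v]"
      by (auto simp: numeral_2_eq_2 length_Suc_conv)
    have P: "Pow {..<length vs} = {{}, {0}, {1}, {0, 1}}"
      by (auto simp: vs lessThan_Suc Pow_insert numeral_2_eq_2)
    have "{(i, j). i \<in> {0::nat} \<and> j \<in> {..<2} - {0} \<and> j < i} = {}" by auto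
    then have s0: "shuffle_sign 2 {0} = 1"
      unfolding shuffle_sign_def by (simp only: card.empty power_0)
    have "{(i, j). i \<in> {1::nat} \<and> j \<in> {..<2} - {1} \<and> j < i} = {(1, 0)}" by auto
    then have s1: "shuffle_sign 2 {1} = -1"
      by (simp add: shuffle_sign_def)
    show ?thesis
      unfolding wedge_def P using s0 s1
      by (simp add: vs nths_Cons covec_def numeral_2_eq_2)
  qed
qed

lemma kt_omega_eq:
  "kt_omega b p = (\<lambda>vs. case vs of [u, v] \<Rightarrow>
     of_real (2 * (u $ 1 * v $ 2 - v $ 1 * u $ 2) + 2 * b * (u $ 4 * v $ 3 - v $ 4 * u $ 3)) | _ \<Rightarrow> 0)"
proof -
  have c: "cnj_form (covec a) = covec (\<lambda>v. cnj (a v))" for a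
    by (auto simp: cnj_form_def covec_def fun_eq_iff split: list.split)
  show ?thesis
    by (auto simp: kt_omega_def phi1_def phi2_def c wedge_covec smult_form_def fun_eq_iff
        complex_eq_iff algebra_simps split: list.split)
qed

lemma kt_omega_closed: "ext_d (kt_omega b) = 0"
  by (simp add: fun_eq_iff ext_d_def kt_omega_eq frechet_derivative_const)

lemma kt_J_eq:
  assumes b: "b \<noteq> 0"
  shows "kt_J b p = (\<lambda>v. vector [- v $ 2, v $ 1, b * (v $ 4 - p $ 2 * v $ 3),
           p $ 2 * b * (v $ 4 - p $ 2 * v $ 3) - v $ 3 / b])"
proof -
  define x where "x = p $ 2"
  define J0 :: "real^4 \<Rightarrow> real^4" where
    "J0 = (\<lambda>v. vector [- v $ 2, v $ 1, b * (v $ 4 - x * v $ 3), x * b * (v $ 4 - x * v $ 3) - v $ 3 / b])"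
  define f1 :: "real^4 \<Rightarrow> complex" where "f1 = (\<lambda>v. of_real (v $ 1) + \<i> * of_real (v $ 2))"
  define f2 :: "real^4 \<Rightarrow> complex" where "f2 = (\<lambda>v. of_real (v $ 3) -
     \<i> * of_real b * (of_real (v $ 4) - of_real x * of_real (v $ 3)))"
  have l1: "linear f1" and l2: "linear f2"
    unfolding f1_def f2_def by (rule phi1_coeff_linear, rule phi2_coeff_linear)
  have lJ: "linear J0"
    by (rule linearI) (simp_all add: J0_def vec_eq_iff forall_4 vector_4_nth algebra_simps add_divide_distrib)
  have JJ: "J0 (J0 v) = - v" for v
    using b by (simp add: J0_def vec_eq_iff forall_4 vector_4_nth field_simps)
  have J1: "f1 (J0 v) = \<i> * f1 v" for v
    by (simp add: f1_def J0_def vector_4_nth complex_eq_iff)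
  have J2: "f2 (J0 v) = \<i> * f2 v" for v
    using b by (simp add: f2_def J0_def vector_4_nth complex_eq_iff field_simps)
  have sep: "v = v'" if "f1 v = f1 v'" "f2 v = f2 v'" for v v'
    using that b by (auto simp add: f1_def f2_def vec_eq_iff forall_4 complex_eq_iff)
  have span: "{smult_form c1 (phi1 p) + smult_form c2 (phi2 b p) | c1 c2. True} =
    {covec (\<lambda>v. c1 * f1 v + c2 * f2 v) | c1 c2. True}"
    by (simp add: phi1_def phi2_def covec_comb f1_def f2_def x_def)
  have "kt_J b p = J0"
    unfolding kt_J_def span
  proof (rule the_equality, intro conjI)
    show "linear J0" by (rule lJ)
    show "\<forall>v. J0 (J0 v) = - v" using JJ by simp
    show "{covec a | a. linear a \<and> (\<forall>v. a (J0 v) = \<i> * a v)} =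
      {covec (\<lambda>v. c1 * f1 v + c2 * f2 v) | c1 c2. True}"
    proof (intro equalityI subsetI)
      fix \<xi> assume "\<xi> \<in> {covec a | a. linear a \<and> (\<forall>v. a (J0 v) = \<i> * a v)}"
      then obtain a where a: "\<xi> = covec a" "linear a" "\<And>v. a (J0 v) = \<i> * a v" by blast
      define e1 :: "real^4" where "e1 = vector [1, 0, 0, 0]"
      define e3 :: "real^4" where "e3 = vector [0, 0, 1, x]"
      have dec: "v = v $ 1 *\<^sub>R e1 + v $ 2 *\<^sub>R J0 e1 + v $ 3 *\<^sub>R e3
           + (- b * (v $ 4 - x * v $ 3)) *\<^sub>R J0 e3" for v
        using b by (simp add: vec_eq_iff forall_4 e1_def e3_def J0_def vector_4_nth algebra_simps)
      define k1 k2 where "k1 = a e1" and "k2 = a e3"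
      have "a v = k1 * f1 v + k2 * f2 v" for v
      proof -
        have "a v = a (v $ 1 *\<^sub>R e1 + v $ 2 *\<^sub>R J0 e1 + v $ 3 *\<^sub>R e3
           + (- b * (v $ 4 - x * v $ 3)) *\<^sub>R J0 e3)" using dec[of v] by simp
        also have "\<dots> = v $ 1 *\<^sub>R k1 + v $ 2 *\<^sub>R (\<i> * k1) + v $ 3 *\<^sub>R k2
           + (- b * (v $ 4 - x * v $ 3)) *\<^sub>R (\<i> * k2)"
          by (simp only: linear_add[OF a(2)] linear_scale[OF a(2)] a(3) k1_def k2_def)
        also have "\<dots> = k1 * f1 v + k2 * f2 v"
          by (simp add: f1_def f2_def complex_eq_iff algebra_simps)
        finally show ?thesis .
      qed
      then have "a = (\<lambda>v. k1 * f1 v + k2 * f2 v)" by (rule ext)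
      then have "\<xi> = covec (\<lambda>v. k1 * f1 v + k2 * f2 v)" by (simp only: a(1))
      then show "\<xi> \<in> {covec (\<lambda>v. c1 * f1 v + c2 * f2 v) | c1 c2. True}" by blast
    next
      fix \<xi> assume "\<xi> \<in> {covec (\<lambda>v. c1 * f1 v + c2 * f2 v) | c1 c2. True}"
      then obtain c1 c2 where \<xi>: "\<xi> = covec (\<lambda>v. c1 * f1 v + c2 * f2 v)" by blast
      have "linear (\<lambda>v. c1 * f1 v + c2 * f2 v)"
        by (rule linearI) (simp_all add: linear_add[OF l1] linear_add[OF l2]
            linear_scale[OF l1] linear_scale[OF l2] algebra_simps)
      moreover have "c1 * f1 (J0 v) + c2 * f2 (J0 v) = \<i> * (c1 * f1 v + c2 * f2 v)" for v
        by (simp add: J1 J2 algebra_simps)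
      ultimately show "\<xi> \<in> {covec a | a. linear a \<and> (\<forall>v. a (J0 v) = \<i> * a v)}"
        using \<xi> by blast
    qed
  next
    fix j assume j: "linear j \<and> (\<forall>v. j (j v) = - v) \<and>
       {covec a | a. linear a \<and> (\<forall>v. a (j v) = \<i> * a v)} =
       {covec (\<lambda>v. c1 * f1 v + c2 * f2 v) | c1 c2. True}"
    have h: "\<forall>v. c1 * f1 (j v) + c2 * f2 (j v) = \<i> * (c1 * f1 v + c2 * f2 v)" for c1 c2
    proof -
      have "covec (\<lambda>v. c1 * f1 v + c2 * f2 v) \<in> {covec a | a. linear a \<and> (\<forall>v. a (j v) = \<i> * a v)}"
        using j by blast
      then obtain a where a: "covec (\<lambda>v. c1 * f1 v + c2 * f2 v) = covec a"
        "\<forall>v. a (j v) = \<i> * a v" by blast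
      then have "a = (\<lambda>v. c1 * f1 v + c2 * f2 v)" by (simp add: covec_eq_iff)
      with a(2) show ?thesis by blast
    qed
    show "j = J0"
    proof
      fix v
      show "j v = J0 v"
        using h[of 1 0] h[of 0 1] by (intro sep) (simp_all add: J1 J2)
    qed
  qed
  then show ?thesis by (simp add: J0_def x_def)
qed

lemma kt_deck_derivative:
  "frechet_derivative (kt_deck t0 x0 y0 z0) (at p) =
     (\<lambda>v. vector [v $ 1, v $ 2, v $ 3, v $ 4 + of_int x0 * v $ 3])"
proof -
  define L :: "real^4 \<Rightarrow> real^4" where
    "L = (\<lambda>v. vector [v $ 1, v $ 2, v $ 3, v $ 4 + of_int x0 * v $ 3])"
  have "linear L"
    by (rule linearI) (simp_all add: L_def vec_eq_iff forall_4 vector_4_nth algebra_simps)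
  then have "(L has_derivative L) (at p)"
    by (simp add: linear_imp_has_derivative)
  then have "((\<lambda>q. L q + vector [of_int t0, of_int x0, of_int y0, of_int z0]) has_derivative L) (at p)"
    by (auto intro!: derivative_eq_intros)
  moreover have "(\<lambda>q. L q + vector [of_int t0, of_int x0, of_int y0, of_int z0]) = kt_deck t0 x0 y0 z0"
    by (simp add: fun_eq_iff L_def kt_deck_def vec_eq_iff forall_4 vector_4_nth)
  ultimately have "(kt_deck t0 x0 y0 z0 has_derivative L) (at p)" by simp
  then show ?thesis unfolding L_def by (rule frechet_derivative_at[symmetric])
qed

lemma phi_invariant: "kt_invariant phi1" "kt_invariant (phi2 b)"
  by (auto simp: kt_invariant_def pullback_def phi1_def phi2_def kt_deck_derivative kt_deck_def vector_4_nth
      covec_def fun_eq_iff algebra_simps split: list.split)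

lemma metric_eq:
  assumes b: "b \<noteq> 0"
  shows "metric (kt_J b p) (kt_omega b p) u v = 2 * (u $ 1 * v $ 1 + u $ 2 * v $ 2 + u $ 3 * v $ 3 +
     b^2 * (u $ 4 - p $ 2 * u $ 3) * (v $ 4 - p $ 2 * v $ 3))"
  using b by (simp add: metric_def kt_omega_eq kt_J_eq vector_4_nth field_simps power2_eq_square)

end

theory Submission
  imports Defs
begin

text \<open>
  \<^bold>\<open>Reduction to first-order equations.\<close> Let \<open>V1\<close>, \<open>V2\<close> be the vector fields of type \<open>(1,0)\<close> dual to \<open>\<phi>1\<close>, \<open>\<phi>2\<close>, and write
  \<open>V1'\<close>, \<open>V2'\<close> for their conjugates. They descend to the quotient and preserve the volume, so partial
  integration gives \<open>\<integral> (V f) cnj g = - \<integral> f cnj (V' g)\<close> (\<open>mean_by_parts\<close>). Since \<open>d \<phi>1 = 0\<close> and \<open>d \<phi>2 = - d (cnj \<phi>2)\<close> have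
  constant coefficients in the coframe, \<open>\<partial>\<close> and \<open>\<partial>bar\<close> act on the 16 coefficients of a form as first-order
  operators whose coefficients are constant in this frame, and \<open>- * \<partial>bar *\<close> and \<open>- * \<partial> *\<close> turn out to be their adjoints
  (\<open>star_conjugates\<close>, \<open>l2_prod_cdel\<close>). Pairing the Laplacians with the form itself writes them as sums of squared norms. Hence
  a form is harmonic for the Dolbeault Laplacian iff \<open>\<partial>bar \<alpha> = 0\<close> and \<open>\<partial>bar\<^sup>* \<alpha> = 0\<close>, and for the Bott-Chern Laplacian iff
  \<open>\<partial> \<alpha> = 0\<close>, \<open>\<partial>bar \<alpha> = 0\<close> and \<open>\<partial>bar\<^sup>* \<partial>\<^sup>* \<alpha> = 0\<close> (\<open>laplacian_delbar_eq_0_iff\<close>, \<open>laplacian_BC_eq_0_iff\<close>).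

  \<^bold>\<open>Equality.\<close> In bidegrees \<open>(2,0)\<close> and \<open>(0,2)\<close> the two systems coincide for reasons of bidegree and because the star is a
  multiple of the identity there. The others rest on one analytic fact: on the compact quotient, \<open>V1 V1' f + V2 V2' f = 0\<close>
  or its conjugate forces f to be constant (\<open>fderiv_fderiv_sum_eq_0\<close>, \<open>fderiv_eq_0_bar\<close>). This settles \<open>(0,0)\<close> and \<open>(2,2)\<close>. For
  \<open>f \<phi>1 + g \<phi>2\<close> the condition \<open>\<partial>bar \<alpha> = 0\<close> gives \<open>V2' f = (b/4) g\<close> and \<open>V2' g = 0\<close>, so \<open>V2 V2' f = 0\<close>, and g vanishes. For
  \<open>(1,1)\<close> one uses that \<open>\<alpha> + *\<alpha> = u \<omega>\<close> for a function u, because primitive \<open>(1,1)\<close>-forms are anti-self-dual.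
  Either system makes \<open>\<partial> \<partial>bar (u \<omega>)\<close> vanish; as \<open>\<omega>\<close> is closed, u is constant, and then \<open>\<alpha>\<close> and \<open>*\<alpha>\<close> satisfy the same equations.

  \<^bold>\<open>Difference.\<close> For \<open>b = 4 \<pi>\<close> the wave \<open>w = exp (2 \<pi> i x)\<close> solves \<open>V1' w = - (b/4) w\<close>, which is the equation
  \<open>\<partial>bar (w cnj \<phi>2) = 0\<close>. The forms \<open>w cnj \<phi>2\<close>, \<open>cnj w \<phi>1 \<and> \<phi>2 \<and> cnj \<phi>1\<close> and \<open>w \<phi>1 \<and> cnj \<phi>1 \<and> cnj \<phi>2\<close>
  lie in exactly one of the two harmonic spaces of their bidegree (\<open>wave_01\<close>, \<open>wave_21\<close>, \<open>wave_12\<close>).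

  \<^bold>\<open>Computation on coefficients.\<close> The components of a form and the Hodge star are characterised by unique existence.
  To compute them, \<open>form\<close> realises the exterior algebra on four generators as multilinear forms, by
  iterated contraction: \<open>\<xi>(v, v1, ..) = (\<iota>\<^sub>v \<xi>)(v1, ..)\<close>. The operations on multilinear forms satisfy recursions
  along the argument list that match those of contraction, so each of them is identified by induction on
  the list with an explicit operation on coefficients.
\<close>

section \<open>The exterior algebra on the coframe\<close>

text \<open>
  The indices of the coframe \<open>\<phi>1, \<phi>2, cnj \<phi>1, cnj \<phi>2\<close>, and of the dual complex vector fields.
\<close>

datatype frame = P1 | P2 | Q1 | Q2

lemma UNIV_frame: "UNIV = {P1, P2, Q1, Q2}"
  using frame.exhaust by auto

instance frame :: finite
  by standard (simp add: UNIV_frame)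

lemma sum_frame: "(\<Sum>j\<in>UNIV. f j) = f P1 + f P2 + f Q1 + f Q2"
  for f :: "frame \<Rightarrow> 'a::comm_monoid_add"
  by (simp add: UNIV_frame add.assoc)

text \<open>
  \<open>F a b c d\<close> is the coefficient of the product of those of \<open>\<phi>1, \<phi>2, cnj \<phi>1, cnj \<phi>2\<close>, in this order, whose flag is true.
\<close>

type_synonym ext = "bool \<Rightarrow> bool \<Rightarrow> bool \<Rightarrow> bool \<Rightarrow> complex"

lemma ext_eqI: "(\<And>a b c d. F a b c d = G a b c d) \<Longrightarrow> F = G" for F G :: ext
  by (intro HOL.ext)

definition scale :: "complex \<Rightarrow> ext \<Rightarrow> ext" where
  "scale k F = (\<lambda>a b c d. k * F a b c d)"

definition bsign :: "bool \<Rightarrow> complex" where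
  "bsign a = (if a then -1 else 1)"

lemma bsign_simps [simp]: "bsign True = -1" "bsign False = 1"
  by (simp_all add: bsign_def)

text \<open>
  Left multiplication by a generator, and below the contraction with the dual vector; the signs count the
  generators that the new one has to pass.
\<close>

primrec exterior :: "frame \<Rightarrow> ext \<Rightarrow> ext" where
  "exterior P1 F = (\<lambda>a b c d. if a then F False b c d else 0)"
| "exterior P2 F = (\<lambda>a b c d. if b then bsign a * F a False c d else 0)"
| "exterior Q1 F = (\<lambda>a b c d. if c then bsign a * bsign b * F a b False d else 0)"
| "exterior Q2 F = (\<lambda>a b c d. if d then bsign a * bsign b * bsign c * F a b c False else 0)"

primrec interior :: "frame \<Rightarrow> ext \<Rightarrow> ext" where
  "interior P1 F = (\<lambda>a b c d. if a then 0 else F True b c d)"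
| "interior P2 F = (\<lambda>a b c d. if b then 0 else bsign a * F a True c d)"
| "interior Q1 F = (\<lambda>a b c d. if c then 0 else bsign a * bsign b * F a b True d)"
| "interior Q2 F = (\<lambda>a b c d. if d then 0 else bsign a * bsign b * bsign c * F a b c True)"

lemma scale_apply [simp]: "scale k F a b c d = k * F a b c d"
  by (simp add: scale_def)

lemma scale_add: "scale k (F + G) = scale k F + scale k G"
  by (rule ext_eqI) (simp add: algebra_simps)

lemma scale_scale: "scale k (scale l F) = scale (k * l) F"
  by (rule ext_eqI) simp

lemma scale_one [simp]: "scale 1 F = F"
  by (rule ext_eqI) simp

lemma scale_zero [simp]: "scale 0 F = 0" "scale k 0 = 0"
  by (rule ext_eqI, simp)+

lemma scale_minus_one: "scale (-1) F = - F"
  by (rule ext_eqI) simp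

lemma exterior_add: "exterior j (F + G) = exterior j F + exterior j G"
  by (cases j) (rule ext_eqI, simp add: algebra_simps)+

lemma exterior_scale: "exterior j (scale k F) = scale k (exterior j F)"
  by (cases j) (rule ext_eqI, simp)+

lemma exterior_zero [simp]: "exterior j 0 = 0"
  by (cases j) (rule ext_eqI, simp)+

lemma interior_add: "interior j (F + G) = interior j F + interior j G"
  by (cases j) (rule ext_eqI, simp add: algebra_simps)+

lemma interior_scale: "interior j (scale k F) = scale k (interior j F)"
  by (cases j) (rule ext_eqI, simp)+

lemma interior_zero [simp]: "interior j 0 = 0"
  by (cases j) (rule ext_eqI, simp)+

text \<open>
  The anticommutation relations determine all computations with contractions below.
\<close>

lemma interior_exterior: "interior j (exterior k F) = (if j = k then F else 0) - exterior k (interior j F)"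
  by (cases j; cases k; rule ext_eqI; simp add: bsign_def)

lemma interior_interior: "interior j (interior k F) = - interior k (interior j F)"
  by (cases j; cases k; rule ext_eqI; simp add: bsign_def)

primrec coframe :: "real \<Rightarrow> real^4 \<Rightarrow> frame \<Rightarrow> real^4 \<Rightarrow> complex" where
  "coframe b p P1 = (\<lambda>v. of_real (v $ 1) + \<i> * of_real (v $ 2))"
| "coframe b p P2 = (\<lambda>v. of_real (v $ 3) -
     \<i> * of_real b * (of_real (v $ 4) - of_real (p $ 2) * of_real (v $ 3)))"
| "coframe b p Q1 = (\<lambda>v. of_real (v $ 1) - \<i> * of_real (v $ 2))"
| "coframe b p Q2 = (\<lambda>v. of_real (v $ 3) +
     \<i> * of_real b * (of_real (v $ 4) - of_real (p $ 2) * of_real (v $ 3)))"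

lemma linear_coframe: "linear (coframe b p j)"
  by (cases j) (rule linearI, simp_all add: complex_eq_iff algebra_simps)+

definition contract :: "real \<Rightarrow> real^4 \<Rightarrow> real^4 \<Rightarrow> ext \<Rightarrow> ext" where
  "contract b p v F = (\<Sum>j\<in>UNIV. scale (coframe b p j v) (interior j F))"

definition exterior_covec :: "(frame \<Rightarrow> complex) \<Rightarrow> ext \<Rightarrow> ext" where
  "exterior_covec k F = (\<Sum>j\<in>UNIV. scale (k j) (exterior j F))"

text \<open>
  The multilinear form with given coefficients. It depends on the point only through the coframe.
\<close>

primrec form :: "real \<Rightarrow> real^4 \<Rightarrow> ext \<Rightarrow> mform" where
  "form b p F [] = F False False False False"
| "form b p F (v # vs) = form b p (contract b p v F) vs"

lemma contract_add: "contract b p v (F + G) = contract b p v F + contract b p v G"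
  by (simp add: contract_def interior_add scale_add sum.distrib)

lemma contract_scale: "contract b p v (scale k F) = scale k (contract b p v F)"
  by (simp add: contract_def sum_frame interior_scale scale_add scale_scale mult.commute)

lemma form_add_apply: "form b p (F + G) vs = form b p F vs + form b p G vs"
  by (induction vs arbitrary: F G) (simp_all add: contract_add)

lemma form_scale_apply: "form b p (scale k F) vs = k * form b p F vs"
  by (induction vs arbitrary: F) (simp_all add: contract_scale)

lemma form_zero_apply: "form b p 0 vs = 0"
  using form_scale_apply[of b p 0 0 vs] by simp

lemma form_add: "form b p (F + G) = form b p F + form b p G"
  by (simp add: fun_eq_iff form_add_apply)

lemma form_scale: "form b p (scale k F) = smult_form k (form b p F)"
  by (simp add: fun_eq_iff form_scale_apply smult_form_def)

lemma form_zero [simp]: "form b p 0 = 0"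
  by (simp add: fun_eq_iff form_zero_apply)

lemma form_minus: "form b p (- F) = - form b p F"
  by (simp add: fun_eq_iff form_scale_apply flip: scale_minus_one)

lemma form_diff: "form b p (F - G) = form b p F - form b p G"
  using form_add[of b p F "- G"] by (simp add: form_minus)

lemma form_sum: "form b p (\<Sum>j\<in>A. F j) = (\<Sum>j\<in>A. form b p (F j))"
proof (induction A rule: infinite_finite_induct)
  case (insert x A)
  then have "(\<Sum>j\<in>insert x A. F j) = F x + (\<Sum>j\<in>A. F j)" by simp
  then have "form b p (\<Sum>j\<in>insert x A. F j) = form b p (F x) + form b p (\<Sum>j\<in>A. F j)"
    by (simp only: form_add)
  then show "form b p (sum F (insert x A)) = (\<Sum>j\<in>insert x A. form b p (F j))" using insert by simp
next
  case (infinite A)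
  then have "(\<Sum>j\<in>A. F j) = 0" by simp
  then have "form b p (\<Sum>j\<in>A. F j) = 0" by (simp only: form_zero)
  then show "form b p (sum F A) = (\<Sum>j\<in>A. form b p (F j))" using infinite by simp
next
  case empty
  have "(\<Sum>j\<in>{}. F j) = 0" by simp
  then have "form b p (\<Sum>j\<in>{}. F j) = 0" by (simp only: form_zero)
  then show "form b p (sum F {}) = (\<Sum>j\<in>{}. form b p (F j))" by simp
qed

lemma contract_exterior_covec: "contract b p v (exterior_covec k F) = scale (\<Sum>j\<in>UNIV. k j * coframe b p j v) F - exterior_covec k (contract b p v F)"
  by (rule ext_eqI) (simp add: contract_def exterior_covec_def sum_frame interior_add interior_scale interior_exterior scale_add scale_scale exterior_add exterior_scale
     algebra_simps)

section \<open>Wedge products with a covector\<close>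

lemma wedge_Nil: "wedge \<xi> \<eta> [] = \<xi> [] * \<eta> []"
  by (simp add: wedge_def shuffle_sign_def)

text \<open>
  A first argument that goes to the first factor is in no inversion; one that goes to the second factor
  (next lemma) is in one inversion with each argument of the first factor.
\<close>

lemma shuffle_sign_Suc_0:
  assumes "I \<subseteq> {..<n}"
  shows "shuffle_sign (Suc n) (insert 0 (Suc ` I)) = shuffle_sign n I"
proof -
  have "{(i, j). i \<in> insert 0 (Suc ` I) \<and> j \<in> {..<Suc n} - insert 0 (Suc ` I) \<and> j < i} =
     map_prod Suc Suc ` {(i, j). i \<in> I \<and> j \<in> {..<n} - I \<and> j < i}" (is "?L = _ ` ?R")
  proof (intro set_eqI iffI)
    fix x assume "x \<in> ?L"
    then obtain i j where x: "x = (i, j)" "i \<in> insert 0 (Suc ` I)"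
        "j \<in> {..<Suc n} - insert 0 (Suc ` I)" "j < i" by auto
    then obtain i' j' where "i = Suc i'" "j = Suc j'" by (cases i; cases j) auto
    with x show "x \<in> map_prod Suc Suc ` ?R" by (auto simp: image_iff)
  qed auto
  then have "card ?L = card ?R"
    by (simp add: card_image inj_on_def)
  then show ?thesis
    by (simp add: shuffle_sign_def)
qed

lemma shuffle_sign_Suc:
  assumes "I \<subseteq> {..<n}"
  shows "shuffle_sign (Suc n) (Suc ` I) = (-1) ^ card I * shuffle_sign n I"
proof -
  have fin: "finite I" using assms finite_subset by blast
  have "{(i, j). i \<in> Suc ` I \<and> j \<in> {..<Suc n} - Suc ` I \<and> j < i} =
     (\<lambda>i. (Suc i, 0)) ` I \<union>
     map_prod Suc Suc ` {(i, j). i \<in> I \<and> j \<in> {..<n} - I \<and> j < i}" (is "?L = ?A \<union> _ ` ?R")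
  proof (intro set_eqI iffI)
    fix x assume "x \<in> ?L"
    then obtain i j where x: "x = (i, j)" "i \<in> Suc ` I"
        "j \<in> {..<Suc n} - Suc ` I" "j < i" by auto
    then show "x \<in> ?A \<union> map_prod Suc Suc ` ?R" by (cases j) (auto simp: image_iff)
  qed auto
  moreover have "finite ?R"
    by (rule finite_subset[of _ "I \<times> {..<n}"]) (auto simp: fin)
  ultimately have "card ?L = card ?A + card (map_prod Suc Suc ` ?R)"
    using fin by (simp add: card_Un_disjoint disjoint_iff image_iff)
  also have "\<dots> = card I + card ?R"
    by (simp add: card_image inj_on_def)
  finally show ?thesis
    by (simp add: shuffle_sign_def power_add)
qed

text \<open>
  Contraction is an antiderivation of the wedge product. This recursion replaces the sum over shuffles.
\<close>

lemma wedge_Cons: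
  "wedge \<xi> \<eta> (v # vs) = wedge (\<lambda>us. \<xi> (v # us)) \<eta> vs +
     wedge (\<lambda>us. (-1) ^ length us * \<xi> us) (\<lambda>us. \<eta> (v # us)) vs"
proof -
  let ?n = "length vs"
  let ?t = "\<lambda>I. shuffle_sign (Suc ?n) I * \<xi> (nths (v # vs) I) * \<eta> (nths (v # vs) (- I))"
  have P: "Pow {..<Suc ?n} = (\<lambda>I. insert 0 (Suc ` I)) ` Pow {..<?n} \<union> (`) Suc ` Pow {..<?n}"
  proof -
    have "Pow {..<Suc ?n} = Pow (insert 0 (Suc ` {..<?n}))" by (simp add: lessThan_Suc_eq_insert_0)
    also have "\<dots> = Pow (Suc ` {..<?n}) \<union> insert 0 ` Pow (Suc ` {..<?n})" by (rule Pow_insert)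
    also have "Pow (Suc ` {..<?n}) = (`) Suc ` Pow {..<?n}" by (simp add: image_Pow_surj)
    finally show ?thesis by (simp add: image_image Un_commute)
  qed
  have disj: "(\<lambda>I. insert 0 (Suc ` I)) ` Pow {..<?n} \<inter> (`) Suc ` Pow {..<?n} = {}" by auto
  have inj: "inj_on (\<lambda>I. insert 0 (Suc ` I)) (Pow {..<?n})" "inj_on ((`) Suc) (Pow {..<?n})"
    by (auto simp: inj_on_def)
  have "wedge \<xi> \<eta> (v # vs) = (\<Sum>I\<in>Pow {..<Suc ?n}. ?t I)"
    by (simp add: wedge_def)
  also have "\<dots> = (\<Sum>I\<in>Pow {..<?n}. ?t (insert 0 (Suc ` I))) + (\<Sum>I\<in>Pow {..<?n}. ?t (Suc ` I))"
    unfolding P by (subst sum.union_disjoint) (auto simp: disj sum.reindex inj)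
  also have "(\<Sum>I\<in>Pow {..<?n}. ?t (insert 0 (Suc ` I))) = wedge (\<lambda>us. \<xi> (v # us)) \<eta> vs"
    unfolding wedge_def
  proof (rule sum.cong)
    fix I assume "I \<in> Pow {..<?n}"
    then have I: "I \<subseteq> {..<?n}" by simp
    have s: "{j. Suc j \<in> Suc ` I} = I" "{j. Suc j \<in> - insert 0 (Suc ` I)} = - I" "{j. Suc j \<in> insert 0 (Suc ` I)} = I" by auto
    show "?t (insert 0 (Suc ` I)) = shuffle_sign ?n I * \<xi> (v # nths vs I) * \<eta> (nths vs (- I))"
      by (simp add: shuffle_sign_Suc_0[OF I] nths_Cons s del: insert_iff Compl_iff) (simp add: s)
  qed simp
  also have "(\<Sum>I\<in>Pow {..<?n}. ?t (Suc ` I)) =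
      wedge (\<lambda>us. (-1) ^ length us * \<xi> us) (\<lambda>us. \<eta> (v # us)) vs"
    unfolding wedge_def
  proof (rule sum.cong)
    fix I assume "I \<in> Pow {..<?n}"
    then have I: "I \<subseteq> {..<?n}" by simp
    have s: "{j. Suc j \<in> Suc ` I} = I" "{j. Suc j \<in> - Suc ` I} = - I" by auto
    have l: "length (nths vs I) = card I"
      using I by (auto simp: length_nths intro!: arg_cong[of _ _ card])
    show "?t (Suc ` I) = shuffle_sign ?n I * ((-1) ^ length (nths vs I) * \<xi> (nths vs I)) * \<eta> (v # nths vs (- I))"
      by (simp add: shuffle_sign_Suc[OF I] nths_Cons l s del: Compl_iff) (simp add: s)
  qed simp
  finally show ?thesis .
qed

lemma wedge_smult_left: "wedge (smult_form k \<xi>) \<eta> = smult_form k (wedge \<xi> \<eta>)"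
  by (simp add: fun_eq_iff wedge_def smult_form_def sum_distrib_left mult_ac)

lemma wedge_smult_right: "wedge \<xi> (smult_form k \<eta>) = smult_form k (wedge \<xi> \<eta>)"
  by (simp add: fun_eq_iff wedge_def smult_form_def sum_distrib_left mult_ac)

lemma wedge_const_form: "wedge (const_form k) \<eta> vs = k * \<eta> vs"
proof (induction vs arbitrary: k \<eta>)
  case (Cons v vs)
  have "(\<lambda>us. const_form k (v # us)) = (\<lambda>us. 0)" "(\<lambda>us. (-1) ^ length us * const_form k us) = const_form k"
    by (auto simp: const_form_def)
  then show ?case
    by (simp add: wedge_Cons Cons.IH) (simp add: wedge_def)
qed (simp add: wedge_Nil const_form_def)

lemma wedge_covec_Cons:
  "wedge (covec a) \<eta> (v # vs) = a v * \<eta> vs - wedge (covec a) (\<lambda>us. \<eta> (v # us)) vs"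
proof -
  have *: "(\<lambda>us. covec a (v # us)) = const_form (a v)" "(\<lambda>us. (-1) ^ length us * covec a us) = smult_form (-1) (covec a)"
    by (auto simp: const_form_def covec_def smult_form_def fun_eq_iff split: list.split)
  show ?thesis
    unfolding wedge_Cons * wedge_smult_left wedge_const_form by (simp add: smult_form_def)
qed

lemma wedge_covec_Nil: "wedge (covec a) \<eta> [] = 0"
  by (simp add: wedge_Nil covec_def)

text \<open>
  The right-hand side has the shape of the exterior derivative, with \<open>a\<close> in place of the derivative.
\<close>

lemma wedge_covec_sum:
  "wedge (covec a) \<eta> vs = (\<Sum>i<length vs. (-1) ^ i * a (vs ! i) * \<eta> (take i vs @ drop (Suc i) vs))"
proof (induction vs arbitrary: \<eta>)
  case (Cons v vs)
  show ?case
    by (simp add: wedge_covec_Cons Cons.IH sum.lessThan_Suc_shift sum_negf del: sum.lessThan_Suc)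
qed (simp add: wedge_covec_Nil)

lemma wedge_covec_form:
  "wedge (covec (\<lambda>v. \<Sum>j\<in>UNIV. k j * coframe b p j v)) (form b p F) = form b p (exterior_covec k F)"
proof
  fix vs
  show "wedge (covec (\<lambda>v. \<Sum>j\<in>UNIV. k j * coframe b p j v)) (form b p F) vs = form b p (exterior_covec k F) vs"
  proof (induction vs arbitrary: F)
    case Nil
    show ?case by (simp add: wedge_covec_Nil exterior_covec_def sum_frame)
  next
    case (Cons v vs)
    show ?case
      by (simp add: wedge_covec_Cons contract_exterior_covec form_diff form_scale_apply Cons.IH)
  qed
qed

lemma wedge_coframe_form: "wedge (covec (coframe b p j)) (form b p F) = form b p (exterior j F)"
proof -
  have "coframe b p j = (\<lambda>v. \<Sum>l\<in>UNIV. (if l = j then 1 else 0) * coframe b p l v)"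
    by (cases j) (simp_all add: fun_eq_iff sum_frame)
  moreover have "exterior_covec (\<lambda>l. if l = j then 1 else 0) F = exterior j F"
    by (cases j) (simp_all add: exterior_covec_def sum_frame)
  ultimately show ?thesis using wedge_covec_form[of "\<lambda>l. if l = j then 1 else 0" b p F] by simp
qed

section \<open>A form determines its coefficients\<close>

declare exterior.simps [simp del] interior.simps [simp del] coframe.simps [simp del]

lemma scaleR_complex: "r *\<^sub>R (z::complex) = of_real r * z"
  by (rule scaleR_conv_of_real)

text \<open>
  The value of the complex-linear extension of f at the vector dual to a generator. These vectors are
  \<open>(\<partial>t - i \<partial>x) / 2\<close>, \<open>(\<partial>y + x \<partial>z + (i/b) \<partial>z) / 2\<close> and their conjugates; the value is also the coefficient of f in the coframe.
\<close>

primrec frame_value :: "real \<Rightarrow> real^4 \<Rightarrow> (real^4 \<Rightarrow> complex) \<Rightarrow> frame \<Rightarrow> complex" where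
  "frame_value b p f P1 = (f (axis 1 1) - \<i> * f (axis 2 1)) / 2"
| "frame_value b p f P2 = (f (axis 3 1) + of_real (p $ 2) * f (axis 4 1) + \<i> / of_real b * f (axis 4 1)) / 2"
| "frame_value b p f Q1 = (f (axis 1 1) + \<i> * f (axis 2 1)) / 2"
| "frame_value b p f Q2 = (f (axis 3 1) + of_real (p $ 2) * f (axis 4 1) - \<i> / of_real b * f (axis 4 1)) / 2"

lemma vec4_expand: "v = v $ 1 *\<^sub>R axis 1 1 + v $ 2 *\<^sub>R axis 2 1 + v $ 3 *\<^sub>R axis 3 1 + v $ 4 *\<^sub>R axis 4 1"
  for v :: "real^4"
  by (simp add: vec_eq_iff forall_4 axis_def)

lemma linear_vec4:
  fixes f :: "real^4 \<Rightarrow> complex"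
  assumes "linear f"
  shows "f v = v $ 1 * f (axis 1 1) + v $ 2 * f (axis 2 1) + v $ 3 * f (axis 3 1) + v $ 4 * f (axis 4 1)"
proof -
  have "f v = f (v $ 1 *\<^sub>R axis 1 1 + v $ 2 *\<^sub>R axis 2 1 + v $ 3 *\<^sub>R axis 3 1 + v $ 4 *\<^sub>R axis 4 1)"
    using vec4_expand[of v] by simp
  also have "\<dots> = v $ 1 * f (axis 1 1) + v $ 2 * f (axis 2 1) + v $ 3 * f (axis 3 1) + v $ 4 * f (axis 4 1)"
    by (simp only: linear_add[OF assms] linear_scale[OF assms] scaleR_complex)
  finally show ?thesis .
qed

lemma frame_value_expand:
  assumes "linear f" "b \<noteq> 0"
  shows "f v = (\<Sum>j\<in>UNIV. frame_value b p f j * coframe b p j v)"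
  unfolding linear_vec4[OF assms(1), of v] using assms(2)
  by (simp add: sum_frame coframe.simps field_simps)

lemma frame_value_unique:
  assumes "b \<noteq> 0"
  shows "frame_value b p (\<lambda>v. \<Sum>j\<in>UNIV. k j * coframe b p j v) l = k l"
  using assms by (cases l) (simp_all add: sum_frame coframe.simps axis_def field_simps)

lemma form_Cons_sum: "form b p F (v # vs) = (\<Sum>j\<in>UNIV. form b p (interior j F) vs * coframe b p j v)"
  by (simp add: contract_def sum_frame form_add_apply form_scale_apply mult.commute)

text \<open>
  Contraction with a complex frame vector only needs the values at real vectors. So the form, which has real
  arguments, determines all iterated contractions of its coefficients, hence the coefficients.
\<close>

lemma form_interior:
  assumes "b \<noteq> 0"
  shows "form b p (interior j F) vs = frame_value b p (\<lambda>v. form b p F (v # vs)) j"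
  using frame_value_unique[OF assms, of p "\<lambda>j. form b p (interior j F) vs" j] by (simp only: form_Cons_sum)

definition opt_interior :: "bool \<Rightarrow> frame \<Rightarrow> ext \<Rightarrow> ext" where
  "opt_interior t j F = (if t then interior j F else F)"

lemma coeff_eq_opt_interior:
  "F a b c d = opt_interior d Q2 (opt_interior c Q1 (opt_interior b P2 (opt_interior a P1 F))) False False False False"
  by (simp add: opt_interior_def interior.simps)

lemma form_eq_0_imp:
  assumes b: "b \<noteq> 0" and "form b p F = 0"
  shows "F = 0"
proof (rule ext_eqI)
  fix s t u v
  have an0: "form b p (interior j G) = 0" if "form b p G = 0" for j G
    by (rule ext, cases j) (simp_all add: form_interior[OF b] that)
  have opt0: "form b p (opt_interior t j G) = 0" if "form b p G = 0" for t j G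
    using that by (simp add: opt_interior_def an0)
  have "form b p (opt_interior v Q2 (opt_interior u Q1 (opt_interior t P2 (opt_interior s P1 F)))) [] = 0"
    by (simp only: opt0 assms(2) zero_fun_apply)
  then show "F s t u v = 0 s t u v"
    by (simp only: form.simps coeff_eq_opt_interior[of F s t u v, symmetric] zero_fun_apply)
qed

lemma form_inject:
  assumes b: "b \<noteq> 0"
  shows "form b p F = form b p G \<longleftrightarrow> F = G"
  using form_eq_0_imp[OF b, of p "F - G"] by (auto simp: form_diff)

section \<open>Degree\<close>

definition deg_part :: "nat \<Rightarrow> ext \<Rightarrow> ext" where
  "deg_part k F = (\<lambda>a b c d. if of_bool a + of_bool b + of_bool c + of_bool d = k then F a b c d else 0)"

lemma interior_deg_part_Suc: "interior j (deg_part (Suc k) F) = deg_part k (interior j F)"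
  by (cases j) (rule ext_eqI, simp add: deg_part_def interior.simps)+

lemma interior_deg_part_0: "interior j (deg_part 0 F) = 0"
  by (cases j) (rule ext_eqI, simp add: deg_part_def interior.simps)+

lemma deg_part_add: "deg_part k (F + G) = deg_part k F + deg_part k G"
  by (rule ext_eqI) (simp add: deg_part_def)

lemma deg_part_scale: "deg_part k (scale c F) = scale c (deg_part k F)"
  by (rule ext_eqI) (simp add: deg_part_def)

lemma deg_part_deg_part: "deg_part k (deg_part k F) = deg_part k F"
  by (rule ext_eqI) (simp add: deg_part_def)

lemma contract_deg_part_Suc: "contract b p v (deg_part (Suc k) F) = deg_part k (contract b p v F)"
  by (simp add: contract_def sum_frame interior_deg_part_Suc deg_part_add deg_part_scale)

lemma contract_deg_part_0: "contract b p v (deg_part 0 F) = 0"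
  by (simp add: contract_def sum_frame interior_deg_part_0)

lemma form_deg_part: "form b p (deg_part k F) vs = (if length vs = k then form b p F vs else 0)"
proof (induction vs arbitrary: k F)
  case (Cons v vs)
  then show ?case by (cases k) (simp_all add: contract_deg_part_0 contract_deg_part_Suc form_zero_apply)
qed (simp add: deg_part_def)

lemma degree_part_form: "degree_part k (form b p F) = form b p (deg_part k F)"
  by (simp add: fun_eq_iff degree_part_def form_deg_part)

section \<open>Alternating forms\<close>

lemma contract_add_vec: "contract b p (v + w) F = contract b p v F + contract b p w F"
  by (rule ext_eqI) (simp add: contract_def sum_frame linear_add[OF linear_coframe] distrib_right)

lemma contract_scale_vec: "contract b p (r *\<^sub>R v) F = scale (of_real r) (contract b p v F)"
  by (rule ext_eqI) (simp add: contract_def sum_frame linear_scale[OF linear_coframe] algebra_simps scaleR_complex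
)

lemma linear_form_slot:
  "i < length vs \<Longrightarrow> linear (\<lambda>v. form b p F (vs[i := v]))"
proof (induction vs arbitrary: i F)
  case (Cons w vs)
  show ?case
  proof (cases i)
    case 0
    then show ?thesis
      by (auto intro!: linearI simp: contract_add_vec contract_scale_vec form_add_apply form_scale_apply scaleR_complex)
  next
    case (Suc i')
    then show ?thesis using Cons by simp
  qed
qed simp

lemma contract_contract: "contract b p v (contract b p w F) = - contract b p w (contract b p v F)"
proof -
  have "interior j (contract b p w F) = - contract b p w (interior j F)" for j w
    by (rule ext_eqI) (simp add: contract_def sum_frame interior_add interior_scale interior_interior[of j] algebra_simps
        )
  then show ?thesis
    by (simp add: contract_def[of b p v] sum_frame contract_add contract_scale)
      (rule ext_eqI, simp add: algebra_simps )
qed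

lemma contract_contract_same: "contract b p v (contract b p v F) = 0"
proof (rule ext_eqI)
  fix s t u w
  have "contract b p v (contract b p v F) s t u w = (- contract b p v (contract b p v F)) s t u w"
    by (rule arg_cong[where f = "\<lambda>G. G s t u w"]) (rule contract_contract)
  then show "contract b p v (contract b p v F) s t u w = 0 s t u w" by simp
qed

lemma form_contract_mem: "v \<in> set vs \<Longrightarrow> form b p (contract b p v F) vs = 0"
proof (induction vs arbitrary: F)
  case (Cons w vs)
  show ?case
  proof (cases "w = v")
    case True
    then show ?thesis by (simp add: contract_contract_same form_zero_apply)
  next
    case False
    then have "v \<in> set vs" using Cons.prems by simp
    then show ?thesis using Cons.IH[of "contract b p w F"]
      by (simp add: contract_contract[of b p w v] form_minus)
  qed
qed simp

lemma form_not_distinct: "\<not> distinct vs \<Longrightarrow> form b p F vs = 0"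
  by (induction vs arbitrary: F) (auto simp: form_contract_mem)

lemma form_alternating: "alternating_form k (form b p (deg_part k F))"
  unfolding alternating_form_def
proof (intro conjI allI impI)
  fix vs :: "(real^4) list" and i assume "length vs = k \<and> i < k"
  then show "linear (\<lambda>v. form b p (deg_part k F) (vs[i := v]))" by (auto intro!: linear_form_slot)
qed (simp_all add: form_deg_part form_not_distinct)

lemma alternating_linear:
  "alternating_form k \<xi> \<Longrightarrow> length vs = k \<Longrightarrow> i < k \<Longrightarrow> linear (\<lambda>v. \<xi> (vs[i := v]))"
  unfolding alternating_form_def by blast

lemma alternating_swap:
  assumes alt: "alternating_form k \<xi>" and k: "length us + length vs + 2 = k"
  shows "\<xi> (us @ v # w # vs) = - \<xi> (us @ w # v # vs)"
proof -
  have lin1: "linear (\<lambda>x. \<xi> (us @ x # y # vs))" for y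
    using alternating_linear[OF alt, of "us @ 0 # y # vs" "length us"] k by simp
  have lin2: "linear (\<lambda>y. \<xi> (us @ x # y # vs))" for x
    using alternating_linear[OF alt, of "us @ x # 0 # vs" "Suc (length us)"] k
    by (simp add: list_update_append)
  have z: "\<xi> (us @ x # x # vs) = 0" for x
    using alt k unfolding alternating_form_def by auto
  have "0 = \<xi> (us @ (v + w) # (v + w) # vs)" by (simp add: z)
  also have "\<dots> = \<xi> (us @ v # v # vs) + \<xi> (us @ v # w # vs) + (\<xi> (us @ w # v # vs) + \<xi> (us @ w # w # vs))"
    by (simp only: linear_add[OF lin1] linear_add[OF lin2] add.assoc) (simp add: add_ac)
  finally show ?thesis by (simp add: z eq_neg_iff_add_eq_0)
qed

lemma alternating_move:
  assumes alt: "alternating_form k \<xi>"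
  shows "length us + length vs + 1 = k \<Longrightarrow> \<xi> (us @ v # vs) = (-1) ^ length us * \<xi> (v # us @ vs)"
proof (induction us arbitrary: vs rule: rev_induct)
  case (snoc w us)
  have "\<xi> ((us @ [w]) @ v # vs) = \<xi> (us @ w # v # vs)" by simp
  also have "\<dots> = - \<xi> (us @ v # w # vs)"
    using snoc.prems by (intro alternating_swap[OF alt]) simp
  also have "\<dots> = - ((-1) ^ length us * \<xi> (v # us @ w # vs))"
    using snoc.prems by (subst snoc.IH) auto
  finally show ?case by simp
qed simp

lemma alternating_contract:
  assumes "alternating_form (Suc k) \<xi>"
  shows "alternating_form k (\<lambda>vs. \<xi> (v # vs))"
  unfolding alternating_form_def
proof (intro conjI allI impI)
  fix vs :: "(real^4) list" and i assume h: "length vs = k \<and> i < k"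
  have "linear (\<lambda>w. \<xi> ((v # vs)[Suc i := w]))"
    using h by (intro alternating_linear[OF assms]) auto
  then show "linear (\<lambda>w. \<xi> (v # vs[i := w]))" by simp
qed (use assms in \<open>auto simp: alternating_form_def\<close>)

text \<open>
  The Euler identity for the exterior algebra: \<open>\<Sum>\<^sub>m dx\<^sub>m \<and> \<iota>\<^sub>m \<xi>\<close> is \<open>\<xi>\<close> times its degree. Each of the \<open>k + 1\<close> arguments
  contributes one copy of \<open>\<xi>\<close>, after it has been moved to the front.
\<close>

lemma alternating_euler:
  assumes alt: "alternating_form (Suc k) \<xi>"
  shows "(\<Sum>m\<in>(UNIV::4 set). wedge (covec (\<lambda>v. of_real (v $ m))) (\<lambda>vs. \<xi> (axis m 1 # vs))) =
     smult_form (of_nat (Suc k)) \<xi>"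
proof
  fix vs :: "(real^4) list"
  show "(\<Sum>m\<in>(UNIV::4 set). wedge (covec (\<lambda>v. of_real (v $ m))) (\<lambda>vs. \<xi> (axis m 1 # vs))) vs =
     smult_form (of_nat (Suc k)) \<xi> vs"
  proof (cases "length vs = Suc k")
    case False
    then have "length (axis m 1 # take i vs @ drop (Suc i) vs) \<noteq> Suc k" if "i < length vs" for i and m :: 4
      using that by simp
    then have "\<xi> (axis m 1 # take i vs @ drop (Suc i) vs) = 0" if "i < length vs" for i and m :: 4
      using alt that unfolding alternating_form_def by blast
    moreover have "\<xi> vs = 0" using alt False unfolding alternating_form_def by blast
    ultimately show ?thesis by (simp add: sum_4 wedge_covec_sum smult_form_def)
  next
    case True
    have lin: "linear (\<lambda>v. \<xi> (v # us))" if "length us = k" for us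
    proof -
      have "linear (\<lambda>v. \<xi> ((0 # us)[0 := v]))"
        using that by (intro alternating_linear[OF alt]) auto
      then show ?thesis by simp
    qed
    have slot: "(\<Sum>m\<in>(UNIV::4 set). of_real (vs ! i $ m) * \<xi> (axis m 1 # take i vs @ drop (Suc i) vs)) =
        (-1) ^ i * \<xi> vs" if i: "i < length vs" for i
    proof -
      have "(\<Sum>m\<in>(UNIV::4 set). of_real (vs ! i $ m) * \<xi> (axis m 1 # take i vs @ drop (Suc i) vs)) =
         \<xi> (vs ! i # take i vs @ drop (Suc i) vs)"
        using True i by (subst linear_vec4[OF lin, of _ "vs ! i"]) (auto simp: sum_4)
      moreover have "\<xi> (take i vs @ vs ! i # drop (Suc i) vs) = (-1) ^ length (take i vs) * \<xi> (vs ! i # take i vs @ drop (Suc i) vs)"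
        using True i by (intro alternating_move[OF alt]) auto
      ultimately show ?thesis using i by (simp add: id_take_nth_drop[symmetric] min_def flip: mult.assoc power_add)
    qed
    have "(\<Sum>m\<in>(UNIV::4 set). wedge (covec (\<lambda>v. of_real (v $ m))) (\<lambda>vs. \<xi> (axis m 1 # vs))) vs =
      (\<Sum>i<length vs. (-1) ^ i * (\<Sum>m\<in>(UNIV::4 set). of_real (vs ! i $ m) * \<xi> (axis m 1 # take i vs @ drop (Suc i) vs)))"
      by (simp add: sum_4 wedge_covec_sum sum.distrib[symmetric] algebra_simps)
    also have "\<dots> = (\<Sum>i<length vs. \<xi> vs)"
      by (rule sum.cong) (simp_all add: slot flip: mult.assoc power_add)
    also have "\<dots> = smult_form (of_nat (Suc k)) \<xi> vs" by (simp add: True smult_form_def)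
    finally show ?thesis .
  qed
qed

definition unit_ext :: ext where
  "unit_ext = (\<lambda>a b c d. if a \<or> b \<or> c \<or> d then 0 else 1)"

lemma const_form_eq_form: "const_form k = form b p (scale k unit_ext)"
proof
  fix vs
  have "contract b p v (scale k unit_ext) = 0" for v
    by (rule ext_eqI) (simp add: contract_def sum_frame unit_ext_def interior.simps)
  then show "const_form k vs = form b p (scale k unit_ext) vs"
    by (cases vs) (simp_all add: const_form_def unit_ext_def form_zero_apply)
qed

text \<open>
  By induction the contractions of an alternating form have coefficients, and the Euler identity recovers the form
  from its contractions.
\<close>

lemma alternating_is_form:
  assumes b: "b \<noteq> 0"
  shows "alternating_form k \<xi> \<Longrightarrow> \<exists>G. \<xi> = form b p (deg_part k G)"
proof (induction k arbitrary: \<xi>)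
  case 0
  then have "\<xi> = const_form (\<xi> [])"
    by (auto simp: fun_eq_iff const_form_def alternating_form_def)
  also have "\<dots> = form b p (deg_part 0 (scale (\<xi> []) unit_ext))"
  proof -
    have "deg_part 0 (scale (\<xi> []) unit_ext) = scale (\<xi> []) unit_ext"
      by (rule ext_eqI) (simp add: deg_part_def unit_ext_def)
    then show ?thesis by (simp only: const_form_eq_form[of _ b p])
  qed
  finally show ?case by blast
next
  case (Suc k)
  have "\<exists>G. (\<lambda>vs. \<xi> (axis m 1 # vs)) = form b p (deg_part k G)" for m :: 4
    by (rule Suc.IH) (rule alternating_contract[OF Suc.prems])
  then obtain G where G: "\<And>m::4. (\<lambda>vs. \<xi> (axis m 1 # vs)) = form b p (deg_part k (G m))" by metis
  have "linear (\<lambda>v::real^4. complex_of_real (v $ m))" for m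
    by (rule linearI) (simp_all add: scaleR_complex)
  from frame_value_expand[OF this b] have cv: "(\<lambda>v::real^4. complex_of_real (v $ m)) =
      (\<lambda>v. \<Sum>j\<in>UNIV. frame_value b p (\<lambda>v. of_real (v $ m)) j * coframe b p j v)" for m
    by (rule ext)
  define H where "H = (\<Sum>m\<in>(UNIV::4 set). exterior_covec (frame_value b p (\<lambda>v. of_real (v $ m))) (deg_part k (G m)))"
  have w: "wedge (covec (\<lambda>v. of_real (v $ m))) (form b p (deg_part k (G m))) =
      form b p (exterior_covec (frame_value b p (\<lambda>v. of_real (v $ m))) (deg_part k (G m)))" for m
    by (rule trans[OF arg_cong[where f = "\<lambda>c. wedge (covec c) (form b p (deg_part k (G m)))", OF cv] wedge_covec_form])
  have "smult_form (of_nat (Suc k)) \<xi> = form b p H"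
    unfolding alternating_euler[OF Suc.prems, symmetric] G H_def form_sum w ..
  moreover have "\<xi> = smult_form (1 / of_nat (Suc k)) (smult_form (of_nat (Suc k)) \<xi>)"
    by (simp add: smult_form_def fun_eq_iff del: of_nat_Suc)
  ultimately have "\<xi> = smult_form (1 / of_nat (Suc k)) (form b p H)" by (simp only:)
  also have "\<dots> = form b p (scale (1 / of_nat (Suc k)) H)" by (simp only: form_scale)
  finally have \<xi>: "\<xi> = form b p (scale (1 / of_nat (Suc k)) H)" .
  have "\<xi> = degree_part (Suc k) \<xi>"
    using Suc.prems by (auto simp: degree_part_def alternating_form_def fun_eq_iff)
  then have "\<xi> = form b p (deg_part (Suc k) (scale (1 / of_nat (Suc k)) H))"
    by (metis \<xi> degree_part_form)
  then show ?case by blast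
qed

section \<open>Bidegree\<close>

definition bideg :: "nat \<Rightarrow> nat \<Rightarrow> ext \<Rightarrow> ext" where
  "bideg r s F = (\<lambda>a b c d. if of_bool a + of_bool b = r \<and> of_bool c + of_bool d = s then F a b c d else 0)"

lemma bideg_bideg: "bideg r s (bideg r' s' F) = (if r = r' \<and> s = s' then bideg r s F else 0)"
  by (rule ext_eqI) (simp add: bideg_def)

lemma bideg_add: "bideg r s (F + G) = bideg r s F + bideg r s G"
  by (rule ext_eqI) (simp add: bideg_def)

lemma bideg_scale: "bideg r s (scale k F) = scale k (bideg r s F)"
  by (rule ext_eqI) (simp add: bideg_def)

lemma bideg_exterior:
  "bideg (Suc r) s (exterior P1 F) = exterior P1 (bideg r s F)"
    "bideg (Suc r) s (exterior P2 F) = exterior P2 (bideg r s F)"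
  "bideg r (Suc s) (exterior Q1 F) = exterior Q1 (bideg r s F)"
    "bideg r (Suc s) (exterior Q2 F) = exterior Q2 (bideg r s F)"
  by (rule ext_eqI, simp add: bideg_def exterior.simps)+

lemma bideg_too_large: "r > 2 \<or> s > 2 \<Longrightarrow> bideg r s F = 0"
  by (rule ext_eqI) (auto simp: bideg_def)

lemma sum_bideg: "(\<Sum>r\<le>2. \<Sum>s\<le>2. bideg r s F) = F"
  by (rule ext_eqI) (simp add: bideg_def numeral_2_eq_2)

lemma coframe_J:
  assumes "b \<noteq> 0"
  shows "coframe b p P1 (kt_J b p v) = \<i> * coframe b p P1 v"
    "coframe b p P2 (kt_J b p v) = \<i> * coframe b p P2 v"
    "coframe b p Q1 (kt_J b p v) = - \<i> * coframe b p Q1 v"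
    "coframe b p Q2 (kt_J b p v) = - \<i> * coframe b p Q2 v"
  using assms by (simp_all add: kt_J_eq coframe.simps vector_4_nth complex_eq_iff field_simps)

text \<open>
  A covector with \<open>a \<circ> J = e a\<close> has components only along the generators on which J acts by e.
\<close>

lemma frame_value_type:
  assumes b: "b \<noteq> 0" and a: "linear a" "\<And>v. a (kt_J b p v) = e * a v"
  shows "e * frame_value b p a P1 = \<i> * frame_value b p a P1"
    "e * frame_value b p a P2 = \<i> * frame_value b p a P2"
    "e * frame_value b p a Q1 = - \<i> * frame_value b p a Q1"
    "e * frame_value b p a Q2 = - \<i> * frame_value b p a Q2"
proof -
  let ?k = "frame_value b p a"
  define e' where "e' j = (case j of P1 \<Rightarrow> \<i> | P2 \<Rightarrow> \<i> | Q1 \<Rightarrow> - \<i> | Q2 \<Rightarrow> - \<i>)" for j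
  have "(\<lambda>v. \<Sum>j\<in>UNIV. (e * ?k j) * coframe b p j v) = (\<lambda>v. \<Sum>j\<in>UNIV. (e' j * ?k j) * coframe b p j v)"
  proof
    fix v
    have "(\<Sum>j\<in>UNIV. (e * ?k j) * coframe b p j v) = e * a v"
      unfolding frame_value_expand[OF a(1) b, of v p] by (simp add: sum_distrib_left mult.assoc)
    also have "\<dots> = (\<Sum>j\<in>UNIV. ?k j * coframe b p j (kt_J b p v))"
      unfolding a(2)[symmetric] by (rule frame_value_expand[OF a(1) b])
    also have "\<dots> = (\<Sum>j\<in>UNIV. (e' j * ?k j) * coframe b p j v)"
      by (simp add: sum_frame coframe_J[OF b] e'_def del: frame_value.simps)
    finally show "(\<Sum>j\<in>UNIV. (e * ?k j) * coframe b p j v) = (\<Sum>j\<in>UNIV. (e' j * ?k j) * coframe b p j v)" .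
  qed
  note eq = this
  have "e * ?k j = e' j * ?k j" for j
    using arg_cong[OF eq, of "\<lambda>f. frame_value b p f j"] by (simp only: frame_value_unique[OF b])
  from this[of P1] this[of P2] this[of Q1] this[of Q2]
  show "e * ?k P1 = \<i> * ?k P1" "e * ?k P2 = \<i> * ?k P2"
    "e * ?k Q1 = - \<i> * ?k Q1" "e * ?k Q2 = - \<i> * ?k Q2"
    by (simp_all add: e'_def del: frame_value.simps)
qed

lemma wedge_linear_form:
  assumes b: "b \<noteq> 0" and a: "linear a"
  shows "wedge (covec a) (form b p F) = form b p (exterior_covec (frame_value b p a) F)"
proof -
  have "a = (\<lambda>v. \<Sum>j\<in>UNIV. frame_value b p a j * coframe b p j v)"
    by (rule ext) (rule frame_value_expand[OF a b])
  then show ?thesis using wedge_covec_form[of "frame_value b p a" b p F] by metis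
qed

lemma bitype_imp_form:
  assumes b: "b \<noteq> 0"
  shows "bitype (kt_J b p) r s \<xi> \<Longrightarrow> \<exists>F. \<xi> = form b p (bideg r s F)"
proof (induction rule: bitype.induct)
  case (const c)
  have "bideg 0 0 (scale c unit_ext) = scale c unit_ext"
    by (rule ext_eqI) (simp add: bideg_def unit_ext_def)
  then show ?case using const_form_eq_form[of c b p] by metis
next
  case (wedge_10 r s \<xi> a)
  then obtain F where F: "\<xi> = form b p (bideg r s F)" by blast
  have z: "frame_value b p a Q1 = 0" "frame_value b p a Q2 = 0"
    using frame_value_type(3,4)[OF b wedge_10(2) wedge_10(3)] by (simp_all del: frame_value.simps)
  have "exterior_covec (frame_value b p a) (bideg r s F) = bideg (Suc r) s (exterior_covec (frame_value b p a) F)"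
    by (simp add: exterior_covec_def sum_frame z bideg_add bideg_scale bideg_exterior del: frame_value.simps)
  then show ?case using wedge_linear_form[OF b wedge_10(2)] F by metis
next
  case (wedge_01 r s \<xi> a)
  then obtain F where F: "\<xi> = form b p (bideg r s F)" by blast
  have z: "frame_value b p a P1 = 0" "frame_value b p a P2 = 0"
    using frame_value_type(1,2)[OF b wedge_01(2) wedge_01(3)] by (simp_all del: frame_value.simps)
  have "exterior_covec (frame_value b p a) (bideg r s F) = bideg r (Suc s) (exterior_covec (frame_value b p a) F)"
    by (simp add: exterior_covec_def sum_frame z bideg_add bideg_scale bideg_exterior del: frame_value.simps)
  then show ?case using wedge_linear_form[OF b wedge_01(2)] F by metis
next
  case (add r s \<xi> \<eta>)
  then show ?case by (metis bideg_add form_add)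
qed

lemma bitype_smult: "bitype j r s \<xi> \<Longrightarrow> bitype j r s (smult_form k \<xi>)"
proof (induction rule: bitype.induct)
  case (const c)
  have "smult_form k (const_form c) = const_form (k * c)"
    by (auto simp: smult_form_def const_form_def)
  then show ?case by (simp add: bitype.const)
next
  case (wedge_10 r s \<xi> a)
  then show ?case by (simp flip: wedge_smult_right add: bitype.wedge_10)
next
  case (wedge_01 r s \<xi> a)
  then show ?case by (simp flip: wedge_smult_right add: bitype.wedge_01)
next
  case (add r s \<xi> \<eta>)
  have "smult_form k (\<xi> + \<eta>) = smult_form k \<xi> + smult_form k \<eta>"
    by (simp add: smult_form_def fun_eq_iff algebra_simps)
  then show "bitype j r s (smult_form k (\<xi> + \<eta>))" using bitype.add[OF add(3,4)] by simp
qed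

text \<open>
  The components are indexed by all pairs of numbers; beyond the dimension they take the value zero.
\<close>

lemma bitype_zero: "bitype j r s 0"
proof -
  have "linear (\<lambda>v::real^4. 0 :: complex)" by (simp add: linear_zero)
  have w: "wedge (covec (\<lambda>v. 0)) 0 = 0" by (simp add: fun_eq_iff wedge_def)
  have c: "const_form 0 = 0" by (auto simp: const_form_def)
  have l: "linear (\<lambda>v::real^4. 0 :: complex)" by (simp add: linear_zero)
  have 1: "bitype j 0 s 0" for s
  proof (induction s)
    case 0 show "bitype j 0 0 0" using bitype.const[of j 0] by (simp only: c)
  next
    case (Suc s)
    have "bitype j 0 (Suc s) (wedge (covec (\<lambda>v. 0)) 0)" by (rule bitype.wedge_01[OF Suc l]) simp
    then show "bitype j 0 (Suc s) 0" by (simp only: w)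
  qed
  show ?thesis
  proof (induction r)
    case 0 show "bitype j 0 s 0" by (rule 1)
  next
    case (Suc r)
    have "bitype j (Suc r) s (wedge (covec (\<lambda>v. 0)) 0)" by (rule bitype.wedge_10[OF Suc l]) simp
    then show "bitype j (Suc r) s 0" by (simp only: w)
  qed
qed

lemma bitype_sum: "(\<And>x. x \<in> A \<Longrightarrow> bitype j r s (f x)) \<Longrightarrow> bitype j r s (\<Sum>x\<in>A. f x)"
proof (induction A rule: infinite_finite_induct)
  case (insert x A)
  then have "bitype j r s (f x + sum f A)" by (intro bitype.add) auto
  then show "bitype j r s (sum f (insert x A))" using insert by simp
next
  case (infinite A)
  then show "bitype j r s (sum f A)" using bitype_zero by simp
next
  case empty
  show "bitype j r s (sum f {})" using bitype_zero by simp
qed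

definition opt_exterior :: "bool \<Rightarrow> frame \<Rightarrow> ext \<Rightarrow> ext" where
  "opt_exterior t j F = (if t then exterior j F else F)"

definition basis_ext :: "bool \<Rightarrow> bool \<Rightarrow> bool \<Rightarrow> bool \<Rightarrow> ext" where
  "basis_ext a b c d = opt_exterior a P1 (opt_exterior b P2 (opt_exterior c Q1 (opt_exterior d Q2 unit_ext)))"

lemma basis_ext_apply: "basis_ext a b c d a' b' c' d' = of_bool (a = a' \<and> b = b' \<and> c = c' \<and> d = d')"
  by (cases a; cases b; cases c; cases d; simp add: basis_ext_def opt_exterior_def exterior.simps unit_ext_def)

lemma ext_expand: "F = (\<Sum>a\<in>UNIV. \<Sum>b\<in>UNIV. \<Sum>c\<in>UNIV. \<Sum>d\<in>UNIV. scale (F a b c d) (basis_ext a b c d))"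
proof (rule ext_eqI)
  fix s t u v
  show "F s t u v = (\<Sum>a\<in>UNIV. \<Sum>b\<in>UNIV. \<Sum>c\<in>UNIV. \<Sum>d\<in>UNIV. scale (F a b c d) (basis_ext a b c d)) s t u v"
    by (cases s; cases t; cases u; cases v; simp add: UNIV_bool basis_ext_apply)
qed

lemma bitype_basis:
  assumes b: "b \<noteq> 0"
  shows "bitype (kt_J b p) (of_bool s + of_bool t) (of_bool u + of_bool v) (form b p (basis_ext s t u v))"
proof -
  have 1: "bitype (kt_J b p) 0 0 (form b p unit_ext)"
    using bitype.const[of "kt_J b p" 1] by (simp add: const_form_eq_form[of 1 b p])
  have P: "bitype (kt_J b p) (of_bool t + r) s (form b p (opt_exterior t j F))"
    if "bitype (kt_J b p) r s (form b p F)" "j = P1 \<or> j = P2" for r s F j t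
    using that bitype.wedge_10[OF that(1) linear_coframe[of b p j]]
    by (auto simp: opt_exterior_def coframe_J[OF b] wedge_coframe_form)
  have Q: "bitype (kt_J b p) r (of_bool t + s) (form b p (opt_exterior t j F))"
    if "bitype (kt_J b p) r s (form b p F)" "j = Q1 \<or> j = Q2" for r s F j t
    using that bitype.wedge_01[OF that(1) linear_coframe[of b p j]]
    by (auto simp: opt_exterior_def coframe_J[OF b] wedge_coframe_form)
  have "bitype (kt_J b p) (of_bool s + (of_bool t + 0)) (of_bool u + (of_bool v + 0)) (form b p (basis_ext s t u v))"
    unfolding basis_ext_def by (intro P Q 1) auto
  then show ?thesis by simp
qed

lemma bitype_form:
  assumes b: "b \<noteq> 0"
  shows "bitype (kt_J b p) r s (form b p (bideg r s F))"
proof -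
  have "bitype (kt_J b p) r s (form b p (scale (bideg r s F t u v w) (basis_ext t u v w)))" for t u v w
  proof (cases "of_bool t + of_bool u = r \<and> of_bool v + of_bool w = s")
    case True
    then show ?thesis using bitype_smult[OF bitype_basis[OF b, of p t u v w]] by (auto simp: form_scale)
  next
    case False
    then show ?thesis by (auto simp: bideg_def bitype_zero)
  qed
  then show ?thesis
    by (subst ext_expand[of "bideg r s F"]) (simp only: form_sum, intro bitype_sum)
qed

lemma bitype_iff_form:
  assumes b: "b \<noteq> 0"
  shows "bitype (kt_J b p) r s (form b p F) \<longleftrightarrow> bideg r s F = F"
  using bitype_imp_form[OF b] bitype_form[OF b] form_inject[OF b] by (metis bideg_bideg)

text \<open>
  The coefficients are unique, so the decomposition into components is forced to be the one on coefficients.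
\<close>

lemma bicomponent_form:
  assumes b: "b \<noteq> 0"
  shows "bicomponent (kt_J b p) r s (form b p F) = form b p (bideg r s F)"
proof -
  have "(THE c. (\<forall>r s. bitype (kt_J b p) r s (c r s)) \<and> form b p F = (\<Sum>r\<le>2. \<Sum>s\<le>2. c r s)) =
      (\<lambda>r s. form b p (bideg r s F))"
  proof (rule the_equality, intro conjI allI)
    show "form b p F = (\<Sum>r\<le>2. \<Sum>s\<le>2. form b p (bideg r s F))"
      by (simp only: form_sum[symmetric] sum_bideg)
  next
    fix c assume c: "(\<forall>r s. bitype (kt_J b p) r s (c r s)) \<and> form b p F = (\<Sum>r\<le>2. \<Sum>s\<le>2. c r s)"
    then have "\<forall>r s. \<exists>G. c r s = form b p (bideg r s G)" using bitype_imp_form[OF b] by blast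
    then obtain G where G: "\<And>r s. c r s = form b p (bideg r s (G r s))" by metis
    then have "form b p F = form b p (\<Sum>r\<le>2. \<Sum>s\<le>2. bideg r s (G r s))" using c by (simp add: form_sum)
    then have F: "F = (\<Sum>r\<le>2. \<Sum>s\<le>2. bideg r s (G r s))" by (simp only: form_inject[OF b])
    have "bideg r s F = bideg r s (G r s)" for r s
    proof (cases "r \<le> 2 \<and> s \<le> 2")
      case True
      then have "r = 0 \<or> r = 1 \<or> r = 2" "s = 0 \<or> s = 1 \<or> s = 2" by auto
      then show ?thesis
        unfolding F by (auto simp: numeral_2_eq_2 bideg_add bideg_bideg)
    qed (auto simp: bideg_too_large)
    then show "c = (\<lambda>r s. form b p (bideg r s F))" by (intro ext) (simp add: G)
  qed (rule bitype_form[OF b])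
  then show ?thesis by (simp add: bicomponent_def)
qed

section \<open>Conjugation\<close>

definition conj_ext :: "ext \<Rightarrow> ext" where
  "conj_ext F = (\<lambda>a b c d. bsign (a \<noteq> b \<and> c \<noteq> d) * cnj (F c d a b))"

lemma conj_ext_contract: "conj_ext (contract b p v F) = contract b p v (conj_ext F)"
  by (rule ext_eqI) (simp add: conj_ext_def contract_def sum_frame interior.simps coframe.simps bsign_def algebra_simps)

lemma cnj_form_eq_form: "cnj_form (form b p F) = form b p (conj_ext F)"
proof
  fix vs
  show "cnj_form (form b p F) vs = form b p (conj_ext F) vs"
    by (induction vs arbitrary: F) (simp_all add: cnj_form_def conj_ext_contract[symmetric], simp add: conj_ext_def)
qed

lemma conj_ext_deg_part: "conj_ext (deg_part k F) = deg_part k (conj_ext F)"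
  by (rule ext_eqI) (simp add: conj_ext_def deg_part_def add.commute add.left_commute)

section \<open>The wedge product on coefficients\<close>

definition sum_below :: "bool \<Rightarrow> (bool \<Rightarrow> complex) \<Rightarrow> complex" where
  "sum_below t f = (if t then f False + f True else f False)"

text \<open>
  The sum runs over the ways to split the given generators into a left factor (primed flags) and a right factor;
  the sign counts the pairs in which a left generator comes after a right one.
\<close>

definition wedge_ext :: "ext \<Rightarrow> ext \<Rightarrow> ext" where
  "wedge_ext G H = (\<lambda>a b c d. sum_below a (\<lambda>a'. sum_below b (\<lambda>b'. sum_below c (\<lambda>c'. sum_below d (\<lambda>d'.
     bsign (b' \<and> a \<and> \<not> a') * bsign (c' \<and> a \<and> \<not> a') * bsign (d' \<and> a \<and> \<not> a') * bsign (c' \<and> b \<and> \<not> b') *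
     bsign (d' \<and> b \<and> \<not> b') * bsign (d' \<and> c \<and> \<not> c') *
     G a' b' c' d' * H (a \<and> \<not> a') (b \<and> \<not> b') (c \<and> \<not> c') (d \<and> \<not> d'))))))"

text \<open>
  The grading automorphism, which is the sign in the antiderivation rule.
\<close>

definition parity_ext :: "ext \<Rightarrow> ext" where
  "parity_ext G = (\<lambda>a b c d. bsign a * bsign b * bsign c * bsign d * G a b c d)"

lemma parity_ext_contract: "contract b p v (parity_ext G) = - parity_ext (contract b p v G)"
  by (rule ext_eqI) (simp add: parity_ext_def contract_def sum_frame interior.simps bsign_def algebra_simps)

lemma form_parity_ext: "form b p (parity_ext G) vs = (-1) ^ length vs * form b p G vs"
  by (induction vs arbitrary: G) (simp_all add: parity_ext_contract form_minus, simp add: parity_ext_def)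

lemma interior_wedge_ext: "interior j (wedge_ext G H) = wedge_ext (interior j G) H + wedge_ext (parity_ext G) (interior j H)"
proof (rule ext_eqI)
  fix a b c d
  show "interior j (wedge_ext G H) a b c d = (wedge_ext (interior j G) H + wedge_ext (parity_ext G) (interior j H)) a b c d"
    by (cases j; cases a; cases b; cases c; cases d;
      simp add: interior.simps wedge_ext_def sum_below_def parity_ext_def)
qed

lemma wedge_ext_add_left: "wedge_ext (G + G') H = wedge_ext G H + wedge_ext G' H"
  by (rule ext_eqI) (simp add: wedge_ext_def sum_below_def algebra_simps)

lemma wedge_ext_add_right: "wedge_ext G (H + H') = wedge_ext G H + wedge_ext G H'"
  by (rule ext_eqI) (simp add: wedge_ext_def sum_below_def algebra_simps)

lemma wedge_ext_scale_left: "wedge_ext (scale k G) H = scale k (wedge_ext G H)"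
  by (rule ext_eqI) (simp add: wedge_ext_def sum_below_def algebra_simps)

lemma wedge_ext_scale_right: "wedge_ext G (scale k H) = scale k (wedge_ext G H)"
  by (rule ext_eqI) (simp add: wedge_ext_def sum_below_def algebra_simps)

lemma contract_wedge_ext: "contract b p v (wedge_ext G H) = wedge_ext (contract b p v G) H + wedge_ext (parity_ext G) (contract b p v H)"
  by (simp add: contract_def sum_frame interior_wedge_ext scale_add wedge_ext_add_left wedge_ext_add_right wedge_ext_scale_left wedge_ext_scale_right add_ac)

lemma wedge_form: "wedge (form b p G) (form b p H) = form b p (wedge_ext G H)"
proof
  fix vs
  show "wedge (form b p G) (form b p H) vs = form b p (wedge_ext G H) vs"
  proof (induction vs arbitrary: G H)
    case Nil
    show ?case by (simp add: wedge_Nil wedge_ext_def sum_below_def)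
  next
    case (Cons v vs)
    have *: "(\<lambda>us. (-1) ^ length us * form b p G us) = form b p (parity_ext G)"
      by (rule ext) (simp add: form_parity_ext)
    show ?case
      unfolding wedge_Cons * by (simp add: Cons.IH contract_wedge_ext form_add_apply)
  qed
qed

section \<open>The induced Hermitian inner product\<close>

definition herm :: "ext \<Rightarrow> ext \<Rightarrow> complex" where
  "herm F G = (\<Sum>a\<in>UNIV. \<Sum>b\<in>UNIV. \<Sum>c\<in>UNIV. \<Sum>d\<in>UNIV. F a b c d * cnj (G a b c d))"

lemma herm_add_left: "herm (F + F') G = herm F G + herm F' G"
  by (simp add: herm_def distrib_right sum.distrib)

lemma herm_add_right: "herm F (G + G') = herm F G + herm F G'"
  by (simp add: herm_def distrib_left sum.distrib)

lemma herm_scale_left: "herm (scale k F) G = k * herm F G"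
  by (simp add: herm_def sum_distrib_left mult.assoc)

lemma herm_scale_right: "herm F (scale k G) = cnj k * herm F G"
  by (simp add: herm_def sum_distrib_left mult_ac)

lemma herm_zero_left [simp]: "herm 0 G = 0"
  by (simp add: herm_def)

text \<open>
  \<open>\<Sum>\<^sub>j e\<^sub>j \<and> \<iota>\<^sub>j\<close> is multiplication by the degree, and \<open>\<iota>\<^sub>j\<close> is adjoint to \<open>e\<^sub>j \<and>\<close>. This accounts for the factor
  \<open>1 / k!\<close> in the index formula of the inner product.
\<close>

lemma herm_number:
  "(\<Sum>j\<in>UNIV. herm (deg_part k (interior j F)) (deg_part k (interior j G))) = of_nat (Suc k) * herm (deg_part (Suc k) F) (deg_part (Suc k) G)"
proof -
  consider "k = 0" | "k = 1" | "k = 2" | "k = 3" | "k \<ge> 4" by linarith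
  then show ?thesis
    by cases (simp_all add: herm_def sum_frame UNIV_bool deg_part_def interior.simps algebra_simps)
qed

lemma inverse_metric_eq:
  assumes b: "b \<noteq> 0"
  shows "inverse_metric (kt_J b p) (kt_omega b p) =
    vector [vector [1/2, 0, 0, 0], vector [0, 1/2, 0, 0], vector [0, 0, 1/2, p $ 2 / 2],
      vector [0, 0, p $ 2 / 2, ((p $ 2)\<^sup>2 + 1 / b\<^sup>2) / 2]]" (is "_ = ?B")
proof -
  let ?A = "\<chi> a c. metric (kt_J b p) (kt_omega b p) (axis a 1) (axis c 1)"
  have "?A ** ?B = mat 1"
    using b by (simp add: matrix_matrix_mult_def mat_def vec_eq_iff forall_4 sum_4 metric_eq
      axis_def vector_4_nth vector_def field_simps power2_eq_square)
  moreover have BA: "?B ** ?A = mat 1"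
    using b by (simp add: matrix_matrix_mult_def mat_def vec_eq_iff forall_4 sum_4 metric_eq
      axis_def vector_4_nth vector_def field_simps power2_eq_square)
  ultimately have "\<exists>B. ?A ** B = mat 1 \<and> B ** ?A = mat 1" by blast
  then have "?A ** matrix_inv ?A = mat 1 \<and> matrix_inv ?A ** ?A = mat 1"
    unfolding matrix_inv_def by (rule someI_ex)
  then have "?B = ?B ** (?A ** matrix_inv ?A)" by simp
  also have "\<dots> = matrix_inv ?A" by (simp only: matrix_mul_assoc BA matrix_mul_lid)
  finally show ?thesis unfolding inverse_metric_def by (rule sym)
qed

lemma inverse_metric_sum:
  assumes b: "b \<noteq> 0"
  shows "(\<Sum>m\<in>UNIV. \<Sum>n\<in>UNIV. of_real (inverse_metric (kt_J b p) (kt_omega b p) $ m $ n) * f m * h n) =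
    (f 1 * h 1 + f 2 * h 2 + f 3 * h 3 + of_real (p $ 2) * (f 3 * h 4 + f 4 * h 3) +
      of_real ((p $ 2)\<^sup>2 + 1 / b\<^sup>2) * (f 4 * h 4)) / (2::complex)"
  unfolding inverse_metric_eq[OF b] by (simp add: sum_4 vector_def algebra_simps add_divide_distrib)

text \<open>
  The coframe is unitary, as \<open>\<omega> = i (\<phi>1 \<and> cnj \<phi>1 + \<phi>2 \<and> cnj \<phi>2)\<close>. So the inner product of forms is the standard one of their
  coefficients.
\<close>

lemma coframe_unitary:
  assumes b: "b \<noteq> 0"
  shows "(\<Sum>m\<in>UNIV. \<Sum>n\<in>UNIV. of_real (inverse_metric (kt_J b p) (kt_omega b p) $ m $ n) *
     coframe b p j (axis m 1) * cnj (coframe b p l (axis n 1))) = of_bool (j = l)"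
  unfolding inverse_metric_sum[OF b] using b
  by (cases j; cases l; simp add: coframe.simps axis_def)
    (simp_all add: complex_eq_iff field_simps power2_eq_square)

lemma sum_lists_Suc:
  "(\<Sum>as | length as = Suc k. f as) = (\<Sum>a\<in>UNIV. \<Sum>as | length as = k. f (a # as))"
  for f :: "'a::finite list \<Rightarrow> 'b::comm_monoid_add"
proof -
  have "{as::'a list. length as = Suc k} = (\<lambda>(a, as). a # as) ` (UNIV \<times> {as. length as = k})"
    by (force simp: length_Suc_conv)
  then have "(\<Sum>as | length as = Suc k. f as) = (\<Sum>(a, as)\<in>UNIV \<times> {as. length as = k}. f (a # as))"
    by (simp add: sum.reindex inj_on_def split_def)
  also have "\<dots> = (\<Sum>a\<in>UNIV. \<Sum>as | length as = k. f (a # as))"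
    using finite_lists_length_eq[of "UNIV :: 'a set" k] by (subst sum.cartesian_product) auto
  finally show ?thesis .
qed

text \<open>
  The index sum of the inner product for an arbitrary matrix and without the factor \<open>1 / k!\<close>, so that it
  satisfies a recursion in k.
\<close>

definition pre_inner :: "real^4^4 \<Rightarrow> nat \<Rightarrow> mform \<Rightarrow> mform \<Rightarrow> complex" where
  "pre_inner g k \<xi> \<eta> = (\<Sum>as | length as = k. \<Sum>cs | length cs = k.
        complex_of_real (\<Prod>m<k. g $ (as ! m) $ (cs ! m)) *
        \<xi> (map (\<lambda>a. axis a 1) as) * cnj (\<eta> (map (\<lambda>c. axis c 1) cs)))"

lemma pre_inner_Suc:
  "pre_inner g (Suc k) \<xi> \<eta> = (\<Sum>m\<in>UNIV. \<Sum>n\<in>UNIV. of_real (g $ m $ n) *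
     pre_inner g k (\<lambda>us. \<xi> (axis m 1 # us)) (\<lambda>us. \<eta> (axis n 1 # us)))"
proof -
  have "pre_inner g (Suc k) \<xi> \<eta> = (\<Sum>m\<in>UNIV. \<Sum>as | length as = k. \<Sum>n\<in>UNIV. \<Sum>cs | length cs = k.
        of_real (g $ m $ n) * (complex_of_real (\<Prod>m<k. g $ (as ! m) $ (cs ! m)) *
        \<xi> (axis m 1 # map (\<lambda>a. axis a 1) as) * cnj (\<eta> (axis n 1 # map (\<lambda>c. axis c 1) cs))))"
    unfolding pre_inner_def sum_lists_Suc
    by (simp add: prod.lessThan_Suc_shift mult.assoc del: prod.lessThan_Suc)
  also have "\<dots> = (\<Sum>m\<in>UNIV. \<Sum>n\<in>UNIV. \<Sum>as | length as = k. \<Sum>cs | length cs = k.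
        of_real (g $ m $ n) * (complex_of_real (\<Prod>m<k. g $ (as ! m) $ (cs ! m)) *
        \<xi> (axis m 1 # map (\<lambda>a. axis a 1) as) * cnj (\<eta> (axis n 1 # map (\<lambda>c. axis c 1) cs))))"
    by (intro sum.cong refl sum.swap)
  finally show ?thesis
    by (simp add: pre_inner_def sum_distrib_left)
qed

lemma pre_inner_form:
  assumes b: "b \<noteq> 0"
  shows "pre_inner (inverse_metric (kt_J b p) (kt_omega b p)) k (form b p F) (form b p G) =
    fact k * herm (deg_part k F) (deg_part k G)"
proof (induction k arbitrary: F G)
  case 0
  show ?case
    by (simp add: pre_inner_def herm_def deg_part_def UNIV_bool)
next
  case (Suc k)
  let ?g = "inverse_metric (kt_J b p) (kt_omega b p)"
  have *: "(\<lambda>us. form b p F (v # us)) = form b p (contract b p v F)" for v F by (rule ext) simp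
  let ?i = "\<lambda>j l. herm (deg_part k (interior j F)) (deg_part k (interior l G))"
  have "pre_inner ?g (Suc k) (form b p F) (form b p G) = (\<Sum>m\<in>UNIV. \<Sum>n\<in>UNIV. of_real (?g $ m $ n) *
     (fact k * herm (deg_part k (contract b p (axis m 1) F)) (deg_part k (contract b p (axis n 1) G))))"
    unfolding pre_inner_Suc * Suc.IH ..
  also have "\<dots> = (\<Sum>m\<in>UNIV. \<Sum>n\<in>UNIV. of_real (?g $ m $ n) *
     (fact k * (\<Sum>j\<in>UNIV. \<Sum>l\<in>UNIV. coframe b p j (axis m 1) * cnj (coframe b p l (axis n 1)) * ?i j l)))"
    by (simp add: contract_def sum_frame deg_part_add deg_part_scale herm_add_left herm_add_right herm_scale_left herm_scale_right algebra_simps)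
  also have "\<dots> = (\<Sum>m\<in>UNIV. \<Sum>n\<in>UNIV. \<Sum>j\<in>UNIV. \<Sum>l\<in>UNIV. fact k * ?i j l * (of_real (?g $ m $ n) *
     coframe b p j (axis m 1) * cnj (coframe b p l (axis n 1))))"
    by (simp add: sum_distrib_left mult_ac)
  also have "\<dots> = (\<Sum>j\<in>UNIV. \<Sum>l\<in>UNIV. \<Sum>m\<in>UNIV. \<Sum>n\<in>UNIV. fact k * ?i j l * (of_real (?g $ m $ n) *
     coframe b p j (axis m 1) * cnj (coframe b p l (axis n 1))))"
    by (simp add: sum_frame sum.distrib)
  also have "\<dots> = (\<Sum>j\<in>UNIV. \<Sum>l\<in>UNIV. fact k * ?i j l * of_bool (j = l))"
    by (simp only: sum_distrib_left[symmetric] coframe_unitary[OF b])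
  also have "\<dots> = fact k * (\<Sum>j\<in>UNIV. ?i j j)"
    by (simp add: sum_frame distrib_left)
  also have "\<dots> = fact (Suc k) * herm (deg_part (Suc k) F) (deg_part (Suc k) G)"
    unfolding herm_number by simp
  finally show ?case .
qed

lemma inner_form_eq_herm:
  assumes b: "b \<noteq> 0"
  shows "inner_form (kt_J b p) (kt_omega b p) k (form b p F) (form b p G) = herm (deg_part k F) (deg_part k G)"
  using pre_inner_form[OF b, of p k F G] by (simp add: inner_form_def pre_inner_def)

section \<open>The volume form\<close>

lemma covec_coframe_form: "covec (coframe b p j) = form b p (exterior j unit_ext)"
proof -
  have "wedge (covec (coframe b p j)) (const_form 1) vs = covec (coframe b p j) vs" for vs
  proof (induction vs)
    case (Cons v vs)
    have *: "(\<lambda>us. const_form 1 (v # us)) = 0" by (auto simp: const_form_def)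
    have "wedge \<xi> 0 = 0" for \<xi> by (simp add: fun_eq_iff wedge_def)
    then show ?case unfolding wedge_covec_Cons * by (cases vs) (simp_all add: const_form_def covec_def)
  next
    case Nil
    show ?case unfolding wedge_covec_Nil by (simp add: covec_def)
  qed
  then have "covec (coframe b p j) = wedge (covec (coframe b p j)) (const_form 1)" by (intro ext) simp
  also have "\<dots> = form b p (exterior j unit_ext)" by (simp add: const_form_eq_form[of 1 b p] wedge_coframe_form)
  finally show ?thesis .
qed

lemma phi_form:
  "phi1 p = form b p (exterior P1 unit_ext)" "phi2 b p = form b p (exterior P2 unit_ext)"
  "cnj_form (phi1 p) = form b p (exterior Q1 unit_ext)" "cnj_form (phi2 b p) = form b p (exterior Q2 unit_ext)"
proof -
  show 1: "phi1 p = form b p (exterior P1 unit_ext)" "phi2 b p = form b p (exterior P2 unit_ext)"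
    by (simp_all add: phi1_def phi2_def coframe.simps flip: covec_coframe_form)
  have c: "conj_ext (exterior P1 unit_ext) = exterior Q1 unit_ext" "conj_ext (exterior P2 unit_ext) = exterior Q2 unit_ext"
    by (rule ext_eqI, simp add: conj_ext_def exterior.simps unit_ext_def bsign_def)+
  show "cnj_form (phi1 p) = form b p (exterior Q1 unit_ext)" "cnj_form (phi2 b p) = form b p (exterior Q2 unit_ext)"
    by (simp_all only: 1 cnj_form_eq_form c)
qed

definition kaehler :: ext where
  "kaehler = scale \<i> (exterior P1 (exterior Q1 unit_ext) + exterior P2 (exterior Q2 unit_ext))"

lemma kt_omega_form: "kt_omega b p = form b p kaehler"
proof -
  have "wedge_ext (exterior P1 unit_ext) (exterior Q1 unit_ext) = exterior P1 (exterior Q1 unit_ext)" "wedge_ext (exterior P2 unit_ext) (exterior Q2 unit_ext) = exterior P2 (exterior Q2 unit_ext)"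
    by (rule ext_eqI, simp add: wedge_ext_def sum_below_def exterior.simps unit_ext_def)+
  then show ?thesis
    unfolding kt_omega_def phi_form(3,4)[where b = b and p = p]
    unfolding phi_form(1,2)[where b = b and p = p] wedge_form
    by (simp add: kaehler_def form_scale form_add)
qed

text \<open>
  The generator of top degree in the order of the coframe; it represents the volume form with coefficient 1, because
  \<open>\<omega>\<^sup>2 / 2 = - \<phi>1 \<and> cnj \<phi>1 \<and> \<phi>2 \<and> cnj \<phi>2\<close>.
\<close>

definition top_ext :: ext where
  "top_ext = (\<lambda>a b c d. of_bool (a \<and> b \<and> c \<and> d))"

lemma vol_form_eq_form: "vol_form (kt_omega b p) = form b p top_ext"
proof -
  have "scale (1/2) (wedge_ext kaehler kaehler) = top_ext"
  proof (rule ext_eqI)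
    fix s t u v
    show "scale (1/2) (wedge_ext kaehler kaehler) s t u v = top_ext s t u v"
      by (cases s; cases t; cases u; cases v; simp add: kaehler_def wedge_ext_def sum_below_def exterior.simps unit_ext_def top_ext_def)
  qed
  then show ?thesis
    by (simp add: vol_form_def kt_omega_form wedge_form flip: form_scale)
qed

section \<open>The Hodge star\<close>

text \<open>
  The star maps a product of generators to plus or minus the product of the conjugates of the missing
  generators. The first six signs reorder the product to top degree; the last one comes from conjugation.
\<close>

definition star :: "ext \<Rightarrow> ext" where
  "star F = (\<lambda>a b c d. bsign (a \<and> \<not> b) * bsign (a \<and> \<not> c) * bsign (a \<and> \<not> d) * bsign (b \<and> \<not> c) * bsign (b \<and> \<not> d) * bsign (c \<and> \<not> d) *
     bsign (a \<noteq> b \<and> c \<noteq> d) * F (\<not> c) (\<not> d) (\<not> a) (\<not> b))"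

lemma star_add: "star (F + G) = star F + star G"
  by (rule ext_eqI) (simp add: star_def algebra_simps)

lemma star_scale: "star (scale k F) = scale k (star F)"
  by (rule ext_eqI) (simp add: star_def algebra_simps)

lemma star_zero [simp]: "star 0 = 0"
  by (rule ext_eqI) (simp add: star_def)

lemma star_deg_part: "k \<le> 4 \<Longrightarrow> star (deg_part k F) = deg_part (4 - k) (star F)"
  by (rule ext_eqI) (auto simp: star_def deg_part_def of_bool_def split: if_splits)

lemma wedge_ext_star:
  assumes "k \<le> 4"
  shows "wedge_ext (deg_part k G) (star (deg_part k F)) = scale (herm (deg_part k G) (deg_part k (conj_ext F))) top_ext"
proof (rule ext_eqI)
  fix s t u v
  consider "k = 0" | "k = 1" | "k = 2" | "k = 3" | "k = 4" using assms by linarith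
  then show "wedge_ext (deg_part k G) (star (deg_part k F)) s t u v = scale (herm (deg_part k G) (deg_part k (conj_ext F))) top_ext s t u v"
    by cases (cases s; cases t; cases u; cases v;
      simp add: wedge_ext_def sum_below_def deg_part_def star_def herm_def conj_ext_def top_ext_def UNIV_bool)+
qed

lemma wedge_ext_basis_top:
  "wedge_ext (basis_ext (\<not> a) (\<not> b) (\<not> c) (\<not> d)) H True True True True =
     bsign (a \<and> \<not> b) * bsign (a \<and> \<not> c) * bsign (a \<and> \<not> d) * bsign (b \<and> \<not> c) * bsign (b \<and> \<not> d) * bsign (c \<and> \<not> d) * H a b c d"
  by (cases a; cases b; cases c; cases d; simp add: wedge_ext_def sum_below_def basis_ext_apply)

text \<open>
  The pairing of complementary degrees into the top degree is perfect, which gives uniqueness of the star.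
\<close>

lemma wedge_ext_top_cancel:
  assumes k: "k \<le> 4"
    and eq: "\<And>G. wedge_ext (deg_part k G) (deg_part (4 - k) H) True True True True = wedge_ext (deg_part k G) (deg_part (4 - k) H') True True True True"
  shows "deg_part (4 - k) H = deg_part (4 - k) H'"
proof (rule ext_eqI)
  fix s t u v
  show "deg_part (4 - k) H s t u v = deg_part (4 - k) H' s t u v"
  proof (cases "of_bool s + of_bool t + of_bool u + of_bool v = 4 - k")
    case True
    then have "deg_part k (basis_ext (\<not> s) (\<not> t) (\<not> u) (\<not> v)) = basis_ext (\<not> s) (\<not> t) (\<not> u) (\<not> v)"
      using k by (intro ext_eqI) (auto simp: deg_part_def basis_ext_apply of_bool_def split: if_splits)
    then show ?thesis
      using eq[of "basis_ext (\<not> s) (\<not> t) (\<not> u) (\<not> v)"] by (simp add: wedge_ext_basis_top bsign_def split: if_splits)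
  qed (simp add: deg_part_def)
qed

lemma hodge_k_form:
  assumes b: "b \<noteq> 0" and k: "k \<le> 4"
  shows "hodge_k (kt_J b p) (kt_omega b p) k (form b p (deg_part k F)) = form b p (star (deg_part k F))"
  unfolding hodge_k_def
proof (rule the_equality, intro conjI allI impI)
  show "alternating_form (4 - k) (form b p (star (deg_part k F)))"
    unfolding star_deg_part[OF k] by (rule form_alternating)
next
  fix \<alpha> assume "alternating_form k \<alpha>"
  then obtain G where G: "\<alpha> = form b p (deg_part k G)" using alternating_is_form[OF b] by blast
  show "wedge \<alpha> (form b p (star (deg_part k F))) =
      smult_form (inner_form (kt_J b p) (kt_omega b p) k \<alpha> (cnj_form (form b p (deg_part k F)))) (vol_form (kt_omega b p))"
    unfolding G wedge_form cnj_form_eq_form inner_form_eq_herm[OF b] vol_form_eq_form form_scale[symmetric] conj_ext_deg_part deg_part_deg_part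
      wedge_ext_star[OF k] ..
next
  fix \<eta>
  assume \<eta>: "alternating_form (4 - k) \<eta> \<and> (\<forall>\<alpha>. alternating_form k \<alpha> \<longrightarrow> wedge \<alpha> \<eta> =
      smult_form (inner_form (kt_J b p) (kt_omega b p) k \<alpha> (cnj_form (form b p (deg_part k F)))) (vol_form (kt_omega b p)))"
  then obtain H where H: "\<eta> = form b p (deg_part (4 - k) H)" using alternating_is_form[OF b] by blast
  have "wedge_ext (deg_part k G) (deg_part (4 - k) H) = wedge_ext (deg_part k G) (star (deg_part k F))" for G
  proof -
    have "wedge (form b p (deg_part k G)) \<eta> = smult_form (inner_form (kt_J b p) (kt_omega b p) k
       (form b p (deg_part k G)) (cnj_form (form b p (deg_part k F)))) (vol_form (kt_omega b p))"
      using \<eta> form_alternating by blast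
    then have "form b p (wedge_ext (deg_part k G) (deg_part (4 - k) H)) = form b p (wedge_ext (deg_part k G) (star (deg_part k F)))"
      unfolding H wedge_form cnj_form_eq_form inner_form_eq_herm[OF b] vol_form_eq_form form_scale[symmetric] conj_ext_deg_part deg_part_deg_part
        wedge_ext_star[OF k] .
    then show ?thesis by (simp only: form_inject[OF b])
  qed
  then have "deg_part (4 - k) H = deg_part (4 - k) (star F)"
    unfolding star_deg_part[OF k] by (intro wedge_ext_top_cancel[OF k]) simp
  then show "\<eta> = form b p (star (deg_part k F))" by (simp add: H star_deg_part[OF k])
qed

lemma hodge_form:
  assumes b: "b \<noteq> 0"
  shows "hodge (kt_J b) (kt_omega b) (\<lambda>p. form b p (F p)) = (\<lambda>p. form b p (star (F p)))"
proof
  fix p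
  have "hodge (kt_J b) (kt_omega b) (\<lambda>p. form b p (F p)) p = (\<Sum>k\<le>4. form b p (star (deg_part k (F p))))"
    by (simp add: hodge_def degree_part_form hodge_k_form[OF b])
  also have "\<dots> = form b p (\<Sum>k\<le>4. star (deg_part k (F p)))" by (simp only: form_sum)
  also have "(\<Sum>k\<le>4. star (deg_part k (F p))) = star (F p)"
  proof (rule ext_eqI)
    fix s t u v
    show "(\<Sum>k\<le>4. star (deg_part k (F p))) s t u v = star (F p) s t u v"
      by (cases s; cases t; cases u; cases v; simp add: star_def deg_part_def numeral_eq_Suc)
  qed
  finally show "hodge (kt_J b) (kt_omega b) (\<lambda>p. form b p (F p)) p = form b p (star (F p))" .
qed

section \<open>Derivatives along the frame\<close>

abbreviation fd :: "(real^4 \<Rightarrow> complex) \<Rightarrow> real^4 \<Rightarrow> real^4 \<Rightarrow> complex" where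
  "fd f p \<equiv> frechet_derivative f (at p)"

text \<open>
  The derivative along a complex frame field.
\<close>

definition fderiv :: "real \<Rightarrow> frame \<Rightarrow> (real^4 \<Rightarrow> complex) \<Rightarrow> real^4 \<Rightarrow> complex" where
  "fderiv b j f = (\<lambda>p. frame_value b p (fd f p) j)"

type_synonym field = "real^4 \<Rightarrow> ext"

definition coeff :: "field \<Rightarrow> bool \<Rightarrow> bool \<Rightarrow> bool \<Rightarrow> bool \<Rightarrow> real^4 \<Rightarrow> complex" where
  "coeff F a b c d = (\<lambda>p. F p a b c d)"

definition dir_deriv_ext :: "field \<Rightarrow> real^4 \<Rightarrow> real^4 \<Rightarrow> ext" where
  "dir_deriv_ext F p w = (\<lambda>a b c d. fd (coeff F a b c d) p w)"

definition fderiv_ext :: "real \<Rightarrow> frame \<Rightarrow> field \<Rightarrow> field" where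
  "fderiv_ext b j F = (\<lambda>p a' b' c' d'. fderiv b j (coeff F a' b' c' d') p)"

definition diff_field :: "field \<Rightarrow> bool" where
  "diff_field F \<longleftrightarrow> (\<forall>a b c d p. coeff F a b c d differentiable (at p))"

lemma fd_works: "f differentiable (at p) \<Longrightarrow> (f has_derivative fd f p) (at p)"
  using frechet_derivative_works by blast

lemma linear_fd: "f differentiable (at p) \<Longrightarrow> linear (fd f p)"
  by (rule linear_frechet_derivative)

lemma dir_deriv_ext_expand:
  assumes "b \<noteq> 0" "diff_field F"
  shows "dir_deriv_ext F p w = (\<Sum>j\<in>UNIV. scale (coframe b p j w) (fderiv_ext b j F p))"
proof (rule ext_eqI)
  fix s t u v
  have "linear (fd (coeff F s t u v) p)" using assms by (auto simp: diff_field_def intro: linear_fd)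
  from frame_value_expand[OF this assms(1), of w p]
  show "dir_deriv_ext F p w s t u v = (\<Sum>j\<in>UNIV. scale (coframe b p j w) (fderiv_ext b j F p)) s t u v"
    by (simp add: dir_deriv_ext_def fderiv_ext_def fderiv_def sum_frame mult.commute del: frame_value.simps)
qed

lemma interior_has_derivative:
  assumes "\<And>a b c d. ((\<lambda>q. F q a b c d) has_derivative (\<lambda>w. F' w a b c d)) (at p)"
  shows "((\<lambda>q. interior j (F q) s t u v) has_derivative (\<lambda>w. interior j (F' w) s t u v)) (at p)"
  using assms
  by (cases j; cases s; cases t; cases u; cases v;
    auto simp: interior.simps intro!: has_derivative_minus)

text \<open>
  The derivative of the coframe in direction w, evaluated at v: only the term \<open>x dy\<close> in \<open>\<phi>2\<close> varies.
\<close>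

definition dcoframe :: "real \<Rightarrow> frame \<Rightarrow> real^4 \<Rightarrow> real^4 \<Rightarrow> complex" where
  "dcoframe b j w v = (case j of P1 \<Rightarrow> 0 | P2 \<Rightarrow> \<i> * of_real b * of_real (w $ 2) * of_real (v $ 3)
     | Q1 \<Rightarrow> 0 | Q2 \<Rightarrow> - \<i> * of_real b * of_real (w $ 2) * of_real (v $ 3))"

lemma coframe_has_derivative:
  "((\<lambda>q. coframe b q j v) has_derivative (\<lambda>w. dcoframe b j w v)) (at p)"
  by (cases j) (auto simp: coframe.simps dcoframe_def algebra_simps
      intro!: derivative_eq_intros bounded_linear_imp_has_derivative bounded_linear_vec_nth)

text \<open>
  The derivation of the exterior algebra with \<open>\<phi>2 \<mapsto> \<phi>2 + cnj \<phi>2\<close> and \<open>cnj \<phi>2 \<mapsto> - (\<phi>2 + cnj \<phi>2)\<close>. As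
  \<open>\<phi>2 + cnj \<phi>2 = 2 dy\<close>, moving the coframe in direction w acts by the multiple \<open>i b w\<^sub>2 / 2\<close> of it.
\<close>

definition shear :: "ext \<Rightarrow> ext" where
  "shear F = exterior P2 (interior P2 F) + exterior Q2 (interior P2 F) - exterior P2 (interior Q2 F) - exterior Q2 (interior Q2 F)"

definition shear_along :: "real \<Rightarrow> real^4 \<Rightarrow> ext \<Rightarrow> ext" where
  "shear_along b w F = scale (\<i> * of_real b * of_real (w $ 2) / 2) (shear F)"

lemma shear_add: "shear (F + G) = shear F + shear G"
  by (rule ext_eqI) (simp add: shear_def exterior_add interior_add)

lemma shear_scale: "shear (scale k F) = scale k (shear F)"
  by (rule ext_eqI) (simp add: shear_def exterior_scale interior_scale algebra_simps)

lemma interior_shear: "interior j (shear F) = shear (interior j F) +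
    (if j = P2 \<or> j = Q2 then interior P2 F - interior Q2 F else 0)"
proof (rule ext_eqI)
  fix s t u v
  show "interior j (shear F) s t u v = (shear (interior j F) + (if j = P2 \<or> j = Q2 then interior P2 F - interior Q2 F else 0)) s t u v"
    by (cases j; cases s; cases t; cases u; cases v; simp add: shear_def interior.simps exterior.simps)
qed

lemma contract_shear:
  "contract b p v (shear_along b w F) = shear_along b w (contract b p v F) +
     (\<Sum>j\<in>UNIV. scale (dcoframe b j w v) (interior j F))"
proof -
  have "coframe b p P2 v + coframe b p Q2 v = 2 * of_real (v $ 3)" by (simp add: coframe.simps)
  then have c: "coframe b p Q2 v = 2 * of_real (v $ 3) - coframe b p P2 v" by (simp add: algebra_simps)
  show ?thesis
    by (rule ext_eqI)
      (simp add: contract_def shear_along_def sum_frame shear_add shear_scale interior_scale interior_shear dcoframe_def c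
        algebra_simps diff_divide_distrib add_divide_distrib)
qed

text \<open>
  The product rule for coefficients and coframe, by induction on the argument list; the induction step is the
  commutator of the shear with contraction.
\<close>

lemma form_has_derivative:
  assumes b: "b \<noteq> 0"
  shows "(\<And>s t u v. ((\<lambda>q. F q s t u v) has_derivative (\<lambda>w. F' w s t u v)) (at p)) \<Longrightarrow>
    ((\<lambda>q. form b q (F q) vs) has_derivative (\<lambda>w. form b p (F' w + shear_along b w (F p)) vs)) (at p)"
proof (induction vs arbitrary: F F')
  case Nil
  then show ?case by (simp add: shear_along_def shear_def exterior.simps)
next
  case (Cons v vs)
  define G' where "G' = (\<lambda>w. contract b p v (F' w) + (\<Sum>j\<in>UNIV. scale (dcoframe b j w v) (interior j (F p))))"
  have "((\<lambda>q. contract b q v (F q) s t u r) has_derivative (\<lambda>w. G' w s t u r)) (at p)" for s t u r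
  proof -
    have "((\<lambda>q. coframe b q j v * interior j (F q) s t u r) has_derivative
        (\<lambda>w. coframe b p j v * interior j (F' w) s t u r + dcoframe b j w v * interior j (F p) s t u r)) (at p)" for j
      by (rule has_derivative_mult[OF coframe_has_derivative interior_has_derivative[OF Cons.prems]])
    from this[of P1] this[of P2] this[of Q1] this[of Q2]
    have "((\<lambda>q. coframe b q P1 v * interior P1 (F q) s t u r + coframe b q P2 v * interior P2 (F q) s t u r +
        coframe b q Q1 v * interior Q1 (F q) s t u r + coframe b q Q2 v * interior Q2 (F q) s t u r) has_derivative
        (\<lambda>w. coframe b p P1 v * interior P1 (F' w) s t u r + dcoframe b P1 w v * interior P1 (F p) s t u r +
          (coframe b p P2 v * interior P2 (F' w) s t u r + dcoframe b P2 w v * interior P2 (F p) s t u r) +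
          (coframe b p Q1 v * interior Q1 (F' w) s t u r + dcoframe b Q1 w v * interior Q1 (F p) s t u r) +
          (coframe b p Q2 v * interior Q2 (F' w) s t u r + dcoframe b Q2 w v * interior Q2 (F p) s t u r))) (at p)"
      by (intro has_derivative_add)
    then show ?thesis
      by (simp add: contract_def G'_def sum_frame add_ac)
  qed
  from Cons.IH[OF this]
  have "((\<lambda>q. form b q (contract b q v (F q)) vs) has_derivative
      (\<lambda>w. form b p (G' w + shear_along b w (contract b p v (F p))) vs)) (at p)" .
  moreover have "G' w + shear_along b w (contract b p v (F p)) = contract b p v (F' w + shear_along b w (F p))" for w
    by (simp add: G'_def contract_add contract_shear add_ac)
  ultimately show "((\<lambda>q. form b q (F q) (v # vs)) has_derivative
      (\<lambda>w. form b p (F' w + shear_along b w (F p)) (v # vs))) (at p)"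
    by (simp only: form.simps)
qed

section \<open>The exterior derivative and its components\<close>

text \<open>
  \<open>\<Sum>\<^sub>j e\<^sub>j \<and> V\<^sub>j F\<close> plus the action of \<open>d \<phi>2 = (b/4) (\<phi>1 - cnj \<phi>1) \<and> (\<phi>2 + cnj \<phi>2) = - d (cnj \<phi>2)\<close> on products of generators.
\<close>

definition ext_d_ext :: "real \<Rightarrow> field \<Rightarrow> field" where
  "ext_d_ext b F p = (\<Sum>j\<in>UNIV. exterior j (fderiv_ext b j F p)) +
     scale (of_real b / 4) (exterior P1 (shear (F p)) - exterior Q1 (shear (F p)))"

lemma form_fd:
  assumes b: "b \<noteq> 0" and F: "diff_field F"
  shows "frechet_derivative (\<lambda>q. form b q (F q) vs) (at p) w = form b p (dir_deriv_ext F p w + shear_along b w (F p)) vs"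
proof -
  have "((\<lambda>q. F q s t u v) has_derivative (\<lambda>w. dir_deriv_ext F p w s t u v)) (at p)" for s t u v
    using F fd_works[of "coeff F s t u v" p] by (simp add: diff_field_def dir_deriv_ext_def coeff_def)
  from form_has_derivative[where F = F, OF b this]
  have "((\<lambda>q. form b q (F q) vs) has_derivative (\<lambda>w. form b p (dir_deriv_ext F p w + shear_along b w (F p)) vs)) (at p)" .
  from frechet_derivative_at[OF this] show ?thesis by (rule fun_cong[OF sym])
qed

lemma ext_d_form:
  assumes b: "b \<noteq> 0" and F: "diff_field F"
  shows "ext_d (\<lambda>p. form b p (F p)) = (\<lambda>p. form b p (ext_d_ext b F p))"
proof (intro HOL.ext)
  fix p vs
  define X where "X j = fderiv_ext b j F p + scale (case j of P1 \<Rightarrow> of_real b / 4 | Q1 \<Rightarrow> - of_real b / 4 | P2 \<Rightarrow> 0 | Q2 \<Rightarrow> 0) (shear (F p))" for j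
  have X: "dir_deriv_ext F p w + shear_along b w (F p) = (\<Sum>j\<in>UNIV. scale (coframe b p j w) (X j))" for w
  proof -
    have c: "\<i> * of_real b * of_real (w $ 2) / 2 = (coframe b p P1 w - coframe b p Q1 w) * of_real b / 4"
      by (simp add: coframe.simps)
    show ?thesis
      unfolding dir_deriv_ext_expand[OF b F] shear_along_def c
      by (rule ext_eqI) (simp add: X_def sum_frame algebra_simps diff_divide_distrib add_divide_distrib)
  qed
  have "ext_d (\<lambda>p. form b p (F p)) p vs = (\<Sum>i<length vs. (-1) ^ i *
      form b p (\<Sum>j\<in>UNIV. scale (coframe b p j (vs ! i)) (X j)) (take i vs @ drop (Suc i) vs))"
    by (simp only: ext_d_def form_fd[OF b F] X)
  also have "\<dots> = (\<Sum>j\<in>UNIV. wedge (covec (coframe b p j)) (form b p (X j)) vs)"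
    by (simp add: wedge_covec_sum sum_frame form_add_apply form_scale_apply sum.distrib algebra_simps)
  also have "\<dots> = form b p (\<Sum>j\<in>UNIV. exterior j (X j)) vs"
    by (simp add: wedge_coframe_form sum_frame form_add_apply)
  also have "(\<Sum>j\<in>UNIV. exterior j (X j)) = ext_d_ext b F p"
    by (rule ext_eqI) (simp add: ext_d_ext_def X_def sum_frame exterior_add exterior_scale algebra_simps)
  finally show "ext_d (\<lambda>p. form b p (F p)) p vs = form b p (ext_d_ext b F p) vs" .
qed

text \<open>
  The parts of bidegree \<open>(1,0)\<close> and \<open>(0,1)\<close> of the zeroth-order term of d, without the factor \<open>b/4\<close>. The remaining
  two terms of the expansion have bidegrees \<open>(2,-1)\<close> and \<open>(-1,2)\<close>.
\<close>

definition torsion :: "ext \<Rightarrow> ext" where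
  "torsion F = exterior P1 (exterior P2 (interior P2 F)) - exterior P2 (exterior Q1 (interior Q2 F)) - exterior P1 (exterior Q2 (interior Q2 F))"

definition torsion_bar :: "ext \<Rightarrow> ext" where
  "torsion_bar F = exterior P1 (exterior Q2 (interior P2 F)) + exterior P2 (exterior Q1 (interior P2 F)) + exterior Q1 (exterior Q2 (interior Q2 F))"

text \<open>
  The operators \<open>\<partial>\<close> and \<open>\<partial>bar\<close> on coefficients.
\<close>

definition cdel :: "real \<Rightarrow> field \<Rightarrow> field" where
  "cdel b F = (\<lambda>p. exterior P1 (fderiv_ext b P1 F p) + exterior P2 (fderiv_ext b P2 F p) + scale (of_real b / 4) (torsion (F p)))"

definition cdelbar :: "real \<Rightarrow> field \<Rightarrow> field" where
  "cdelbar b F = (\<lambda>p. exterior Q1 (fderiv_ext b Q1 F p) + exterior Q2 (fderiv_ext b Q2 F p) + scale (of_real b / 4) (torsion_bar (F p)))"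

lemma fderiv_ext_bideg:
  assumes "diff_field F"
  shows "fderiv_ext b j (\<lambda>q. bideg r s (F q)) p = bideg r s (fderiv_ext b j F p)"
proof (rule ext_eqI)
  fix a b' c d
  have z: "fderiv b j (\<lambda>q. 0) p = 0" by (cases j) (simp_all add: fderiv_def)
  show "fderiv_ext b j (\<lambda>q. bideg r s (F q)) p a b' c d = bideg r s (fderiv_ext b j F p) a b' c d"
    by (cases "of_bool a + of_bool b' = r \<and> of_bool c + of_bool d = s") (auto simp: fderiv_ext_def coeff_def bideg_def z)
qed

lemma diff_field_bideg: "diff_field F \<Longrightarrow> diff_field (\<lambda>q. bideg r s (F q))"
  unfolding diff_field_def
proof (intro allI)
  fix a b' c d p
  assume "\<forall>a b c d p. coeff F a b c d differentiable at p"
  then show "coeff (\<lambda>q. bideg r s (F q)) a b' c d differentiable at p"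
    by (cases "of_bool a + of_bool b' = r \<and> of_bool c + of_bool d = s") (auto simp: coeff_def bideg_def)
qed

lemma bideg_exterior_mixed:
  "bideg (Suc r) s (exterior Q1 (bideg r s F)) = 0" "bideg (Suc r) s (exterior Q2 (bideg r s F)) = 0"
  "bideg r (Suc s) (exterior P1 (bideg r s F)) = 0" "bideg r (Suc s) (exterior P2 (bideg r s F)) = 0"
  by (rule ext_eqI, auto simp add: bideg_def exterior.simps)+

lemma bideg_torsion_10:
  "bideg (Suc r) s (exterior P1 (shear (bideg r s F)) - exterior Q1 (shear (bideg r s F))) = torsion (bideg r s F)"
proof (rule ext_eqI)
  fix t u v w
  show "bideg (Suc r) s (exterior P1 (shear (bideg r s F)) - exterior Q1 (shear (bideg r s F))) t u v w = torsion (bideg r s F) t u v w"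
    by (cases t; cases u; cases v; cases w; simp add: bideg_def exterior.simps interior.simps shear_def torsion_def)
qed

lemma bideg_torsion_01:
  "bideg r (Suc s) (exterior P1 (shear (bideg r s F)) - exterior Q1 (shear (bideg r s F))) = torsion_bar (bideg r s F)"
proof (rule ext_eqI)
  fix t u v w
  show "bideg r (Suc s) (exterior P1 (shear (bideg r s F)) - exterior Q1 (shear (bideg r s F))) t u v w = torsion_bar (bideg r s F) t u v w"
    by (cases t; cases u; cases v; cases w; simp add: bideg_def exterior.simps interior.simps shear_def torsion_bar_def)
qed

lemma bideg_minus: "bideg r s (F - G) = bideg r s F - bideg r s G"
  by (rule ext_eqI) (simp add: bideg_def)

lemma bideg_ext_d_10:
  assumes "diff_field F"
  shows "bideg (Suc r) s (ext_d_ext b (\<lambda>q. bideg r s (F q)) p) = cdel b (\<lambda>q. bideg r s (F q)) p"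
  by (simp add: ext_d_ext_def cdel_def fderiv_ext_bideg[OF assms] sum_frame bideg_add bideg_scale bideg_exterior bideg_exterior_mixed bideg_bideg bideg_torsion_10)

lemma bideg_ext_d_01:
  assumes "diff_field F"
  shows "bideg r (Suc s) (ext_d_ext b (\<lambda>q. bideg r s (F q)) p) = cdelbar b (\<lambda>q. bideg r s (F q)) p"
  by (simp add: ext_d_ext_def cdelbar_def fderiv_ext_bideg[OF assms] sum_frame bideg_add bideg_scale bideg_exterior bideg_exterior_mixed bideg_bideg bideg_torsion_01)

lemma bipart_form:
  "b \<noteq> 0 \<Longrightarrow> bipart (kt_J b) r s (\<lambda>p. form b p (F p)) = (\<lambda>p. form b p (bideg r s (F p)))"
  by (simp add: bipart_def bicomponent_form)

lemma torsion_add: "torsion (F + G) = torsion F + torsion G" "torsion_bar (F + G) = torsion_bar F + torsion_bar G"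
  by (rule ext_eqI, simp add: torsion_def torsion_bar_def exterior_add interior_add)+

lemma cdel_sum_bideg:
  assumes F: "diff_field F"
  shows "(\<Sum>r\<le>2. \<Sum>s\<le>2. cdel b (\<lambda>q. bideg r s (F q)) p) = cdel b F p"
    "(\<Sum>r\<le>2. \<Sum>s\<le>2. cdelbar b (\<lambda>q. bideg r s (F q)) p) = cdelbar b F p"
proof -
  have exterior: "(\<Sum>r\<le>2. \<Sum>s\<le>2. exterior j (bideg r s G)) = exterior j G" for j G
    using arg_cong[OF sum_bideg[of G], of "exterior j"] by (simp add: numeral_2_eq_2 exterior_add)
  have t: "(\<Sum>r\<le>2. \<Sum>s\<le>2. scale k (torsion (bideg r s G))) = scale k (torsion G)"
    "(\<Sum>r\<le>2. \<Sum>s\<le>2. scale k (torsion_bar (bideg r s G))) = scale k (torsion_bar G)" for k G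
    using arg_cong[OF sum_bideg[of G], of torsion] arg_cong[OF sum_bideg[of G], of torsion_bar]
    by (simp_all add: numeral_2_eq_2 torsion_add scale_add[symmetric])
  show "(\<Sum>r\<le>2. \<Sum>s\<le>2. cdel b (\<lambda>q. bideg r s (F q)) p) = cdel b F p"
    "(\<Sum>r\<le>2. \<Sum>s\<le>2. cdelbar b (\<lambda>q. bideg r s (F q)) p) = cdelbar b F p"
    by (simp_all add: cdel_def cdelbar_def fderiv_ext_bideg[OF F] sum.distrib exterior t)
qed

lemma sum_apply: "(\<Sum>x\<in>A. f x) p = (\<Sum>x\<in>A. f x p)"
  for f :: "'a \<Rightarrow> 'b \<Rightarrow> 'c::comm_monoid_add"
  by (induction A rule: infinite_finite_induct) auto

lemma del_form:
  assumes b: "b \<noteq> 0" and F: "diff_field F"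
  shows "del (kt_J b) (\<lambda>p. form b p (F p)) = (\<lambda>p. form b p (cdel b F p))"
proof
  fix p
  show "del (kt_J b) (\<lambda>p. form b p (F p)) p = form b p (cdel b F p)"
    unfolding del_def bipart_form[OF b] ext_d_form[OF b diff_field_bideg[OF F]] bideg_ext_d_10[OF F] sum_apply form_sum[symmetric]
      cdel_sum_bideg[OF F] ..
qed

lemma delbar_form:
  assumes b: "b \<noteq> 0" and F: "diff_field F"
  shows "delbar (kt_J b) (\<lambda>p. form b p (F p)) = (\<lambda>p. form b p (cdelbar b F p))"
proof
  fix p
  show "delbar (kt_J b) (\<lambda>p. form b p (F p)) p = form b p (cdelbar b F p)"
    unfolding delbar_def bipart_form[OF b] ext_d_form[OF b diff_field_bideg[OF F]] bideg_ext_d_01[OF F] sum_apply form_sum[symmetric]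
      cdel_sum_bideg[OF F] ..
qed

section \<open>Smooth functions\<close>

definition smooth :: "(real^4 \<Rightarrow> complex) \<Rightarrow> bool" where
  "smooth f \<longleftrightarrow> (\<forall>k. C_k k f)"

definition dir_deriv :: "real^4 \<Rightarrow> (real^4 \<Rightarrow> complex) \<Rightarrow> real^4 \<Rightarrow> complex" where
  "dir_deriv v f = (\<lambda>p. fd f p v)"

lemma C_k_Suc_dir_deriv: "C_k (Suc k) f \<longleftrightarrow> (\<forall>p. f differentiable (at p)) \<and> (\<forall>v. C_k k (dir_deriv v f))"
  by (simp add: dir_deriv_def)

lemma C_k_SucD: "C_k (Suc k) f \<Longrightarrow> C_k k f"
proof (induction k arbitrary: f)
  case 0
  then show ?case
    by (auto simp: continuous_on_eq_continuous_at intro: differentiable_imp_continuous_within)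
next
  case (Suc k)
  then show ?case unfolding C_k_Suc_dir_deriv[of k] C_k_Suc_dir_deriv[of "Suc k"] by blast
qed

lemma has_derivative_imp_dir_deriv: "(\<And>p. (f has_derivative f' p) (at p)) \<Longrightarrow> dir_deriv v f = (\<lambda>p. f' p v)"
  unfolding dir_deriv_def by (metis frechet_derivative_at)

lemma dir_deriv_const [simp]: "dir_deriv v (\<lambda>q. c) = (\<lambda>q. 0)"
  by (simp add: dir_deriv_def)

lemma dir_deriv_add:
  assumes "\<And>p. f differentiable (at p)" "\<And>p. g differentiable (at p)"
  shows "dir_deriv v (\<lambda>q. f q + g q) = (\<lambda>q. dir_deriv v f q + dir_deriv v g q)"
proof (rule has_derivative_imp_dir_deriv[THEN trans])
  show "((\<lambda>q. f q + g q) has_derivative (\<lambda>v. fd f p v + fd g p v)) (at p)" for p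
    by (intro has_derivative_add fd_works assms)
qed (simp add: dir_deriv_def)

lemma dir_deriv_mult:
  assumes "\<And>p. f differentiable (at p)" "\<And>p. g differentiable (at p)"
  shows "dir_deriv v (\<lambda>q. f q * g q) = (\<lambda>q. f q * dir_deriv v g q + dir_deriv v f q * g q)"
proof (rule has_derivative_imp_dir_deriv[THEN trans])
  show "((\<lambda>q. f q * g q) has_derivative (\<lambda>v. f p * fd g p v + fd f p v * g p)) (at p)" for p
    by (intro has_derivative_mult fd_works assms)
qed (simp add: dir_deriv_def)

lemma cnj_has_derivative: "f differentiable (at p) \<Longrightarrow> ((\<lambda>q. cnj (f q)) has_derivative (\<lambda>v. cnj (fd f p v))) (at p)"
  by (rule bounded_linear.has_derivative[OF bounded_linear_cnj fd_works])

lemma cnj_differentiable: "f differentiable (at p) \<Longrightarrow> (\<lambda>q. cnj (f q)) differentiable (at p)"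
  for f :: "real^4 \<Rightarrow> complex"
  using cnj_has_derivative differentiable_def by blast

lemma dir_deriv_cnj:
  assumes "\<And>p. f differentiable (at p)"
  shows "dir_deriv v (\<lambda>q. cnj (f q)) = (\<lambda>q. cnj (dir_deriv v f q))"
  by (rule has_derivative_imp_dir_deriv[THEN trans]) (auto simp: dir_deriv_def intro!: cnj_has_derivative assms)

lemma C_k_const: "C_k k (\<lambda>q. c)"
  by (induction k arbitrary: c) auto

lemma C_k_add: "C_k k f \<Longrightarrow> C_k k g \<Longrightarrow> C_k k (\<lambda>q. f q + g q)"
proof (induction k arbitrary: f g)
  case 0
  then show ?case by (auto intro: continuous_on_add)
next
  case (Suc k)
  then show ?case unfolding C_k_Suc_dir_deriv by (auto simp: dir_deriv_add)
qed

lemma C_k_mult: "C_k k f \<Longrightarrow> C_k k g \<Longrightarrow> C_k k (\<lambda>q. f q * g q)"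
proof (induction k arbitrary: f g)
  case 0
  then show ?case by (auto intro: continuous_on_mult)
next
  case (Suc k)
  then have "C_k k f" "C_k k g" by (auto dest: C_k_SucD simp del: C_k.simps)
  with Suc show ?case unfolding C_k_Suc_dir_deriv
    by (auto simp: dir_deriv_mult intro!: C_k_add)
qed

lemma C_k_cnj: "C_k k f \<Longrightarrow> C_k k (\<lambda>q. cnj (f q))"
proof (induction k arbitrary: f)
  case 0
  then show ?case by (auto intro: continuous_on_cnj)
next
  case (Suc k)
  then show ?case unfolding C_k_Suc_dir_deriv
    by (auto simp: dir_deriv_cnj intro: cnj_differentiable)
qed

lemma smooth_const: "smooth (\<lambda>q. c)"
  by (simp add: smooth_def C_k_const)

lemma smooth_add: "smooth f \<Longrightarrow> smooth g \<Longrightarrow> smooth (\<lambda>q. f q + g q)"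
  by (simp add: smooth_def C_k_add)

lemma smooth_mult: "smooth f \<Longrightarrow> smooth g \<Longrightarrow> smooth (\<lambda>q. f q * g q)"
  by (simp add: smooth_def C_k_mult)

lemma smooth_cnj: "smooth f \<Longrightarrow> smooth (\<lambda>q. cnj (f q))"
  by (simp add: smooth_def C_k_cnj)

lemma smooth_differentiable: "smooth f \<Longrightarrow> f differentiable (at p)"
  unfolding smooth_def by (metis C_k.simps(2))

lemma smooth_dir_deriv: "smooth f \<Longrightarrow> smooth (dir_deriv v f)"
  unfolding smooth_def by (metis C_k_Suc_dir_deriv)

lemma smooth_continuous: "smooth f \<Longrightarrow> continuous_on S f"
  unfolding smooth_def by (metis C_k.simps(1) continuous_on_subset subset_UNIV)

lemma smooth_coord: "smooth (\<lambda>q. of_real (q $ m))"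
proof -
  have d: "((\<lambda>q::real^4. complex_of_real (q $ m)) has_derivative (\<lambda>w. of_real (w $ m))) (at p)" for p
    by (intro has_derivative_of_real bounded_linear_imp_has_derivative bounded_linear_vec_nth)
  have "C_k k (\<lambda>q::real^4. complex_of_real (q $ m))" for k
  proof (cases k)
    case 0
    then show ?thesis by (auto intro!: continuous_intros)
  next
    case (Suc k')
    then show ?thesis unfolding C_k_Suc_dir_deriv Suc
      by (auto intro: differentiableI[OF d] simp: has_derivative_imp_dir_deriv[OF d] C_k_const)
  qed
  then show ?thesis by (simp add: smooth_def)
qed

section \<open>Integrals along segments\<close>

text \<open>
  Integrals along segments are again functions of the initial point, so that integrals in several directions can be
  iterated and interchanged without a choice of coordinates.
\<close>

definition line_int :: "real^4 \<Rightarrow> real \<Rightarrow> (real^4 \<Rightarrow> 'a::banach) \<Rightarrow> real^4 \<Rightarrow> 'a" where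
  "line_int v s f q = integral {0..s} (\<lambda>r. f (q + r *\<^sub>R v))"

lemma line_int_continuous:
  assumes "continuous_on UNIV f"
  shows "continuous_on UNIV (line_int v s f)"
proof -
  have "continuous_on (UNIV \<times> cbox 0 s) (\<lambda>(q, r). f (q + r *\<^sub>R v))"
    unfolding split_def by (intro continuous_on_compose2[OF assms] continuous_intros) auto
  from integral_continuous_on_param[OF this] show ?thesis
    by (simp add: line_int_def[abs_def])
qed

lemma line_continuous:
  "continuous_on UNIV f \<Longrightarrow> continuous_on S (\<lambda>r. f (q + r *\<^sub>R v))"
  for f :: "real^4 \<Rightarrow> 'a::topological_space"
  by (rule continuous_on_compose2[of UNIV f S "\<lambda>r. q + r *\<^sub>R v"]) (auto intro!: continuous_intros)

lemma line_integrable: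
  "continuous_on UNIV f \<Longrightarrow> (\<lambda>r. f (q + r *\<^sub>R v)) integrable_on {0..s}"
  for f :: "real^4 \<Rightarrow> 'a::banach"
  by (intro integrable_continuous_real line_continuous)

lemma line_int_swap:
  assumes "continuous_on UNIV f"
  shows "line_int v s (line_int w t f) = line_int w t (line_int v s f)"
proof
  fix q
  have "continuous_on (cbox (0, 0) (s, t)) (\<lambda>(x, y). f (q + x *\<^sub>R v + y *\<^sub>R w))"
    unfolding split_def by (intro continuous_on_compose2[OF assms] continuous_intros) auto
  from integral_swap_continuous[OF this]
  show "line_int v s (line_int w t f) q = line_int w t (line_int v s f) q"
    by (simp add: line_int_def add_ac)
qed

lemma line_int_dir_deriv:
  assumes f: "smooth f" and s: "s \<ge> 0"
  shows "line_int v s (dir_deriv v f) = (\<lambda>q. f (q + s *\<^sub>R v) - f q)"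
proof
  fix q
  have "((\<lambda>r. f (q + r *\<^sub>R v)) has_vector_derivative dir_deriv v f (q + r *\<^sub>R v)) (at r within {0..s})" for r
  proof -
    have g: "((\<lambda>r. q + r *\<^sub>R v) has_derivative (\<lambda>r. r *\<^sub>R v)) (at r within {0..s})"
      by (auto intro!: derivative_eq_intros)
    have d: "(f has_derivative fd f (q + r *\<^sub>R v)) (at (q + r *\<^sub>R v))"
      by (rule fd_works[OF smooth_differentiable[OF f]])
    have "((\<lambda>r. f (q + r *\<^sub>R v)) has_derivative (\<lambda>h. fd f (q + r *\<^sub>R v) (h *\<^sub>R v))) (at r within {0..s})"
      by (rule has_derivative_compose[OF g d])
    then show ?thesis
      by (simp add: has_vector_derivative_def dir_deriv_def linear_scale[OF linear_fd[OF smooth_differentiable[OF f]]])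
  qed
  from fundamental_theorem_of_calculus[OF s this]
  show "line_int v s (dir_deriv v f) q = f (q + s *\<^sub>R v) - f q" by (auto simp: line_int_def dest: integral_unique)
qed

lemma line_int_diff:
  "continuous_on UNIV f \<Longrightarrow> continuous_on UNIV g \<Longrightarrow> line_int v s (\<lambda>q. f q - g q) q = line_int v s f q - line_int v s g q"
  unfolding line_int_def by (intro integral_diff line_integrable)

lemma line_int_add:
  "continuous_on UNIV f \<Longrightarrow> continuous_on UNIV g \<Longrightarrow> line_int v s (\<lambda>q. f q + g q) = (\<lambda>q. line_int v s f q + line_int v s g q)"
  unfolding line_int_def by (intro ext integral_add line_integrable)

lemma line_int_cmult: "line_int v s (\<lambda>q. c * f q) = (\<lambda>q. c * line_int v s f q)"
  for f :: "real^4 \<Rightarrow> complex"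
  unfolding line_int_def by simp

lemma line_int_zero [simp]: "line_int v s (\<lambda>q. 0) = (\<lambda>q. 0)"
  unfolding line_int_def by simp

lemma line_int_shift: "line_int v s (\<lambda>q. f (q + u)) q = line_int v s f (q + u)"
  by (simp add: line_int_def add_ac)

lemma line_int_eq_0_imp:
  fixes g :: "real^4 \<Rightarrow> 'a::euclidean_space"
  assumes g: "continuous_on UNIV g" and z: "\<And>s. s \<ge> 0 \<Longrightarrow> line_int v s g q = 0"
  shows "g q = 0"
proof -
  have "((\<lambda>u. integral {0..u} (\<lambda>r. g (q + r *\<^sub>R v))) has_vector_derivative g (q + 0 *\<^sub>R v)) (at 0 within {0..1})"
    by (rule integral_has_vector_derivative) (auto intro: line_continuous[OF g])
  then have "((\<lambda>u. 0) has_vector_derivative g q) (at 0 within {0..1::real})"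
    by (intro has_vector_derivative_transform[of 0 "{0..1::real}" "\<lambda>u. 0"
          "\<lambda>u. integral {0..u} (\<lambda>r. g (q + r *\<^sub>R v))"]) (simp_all add: z[unfolded line_int_def])
  moreover have "((\<lambda>u. 0) has_vector_derivative 0) (at 0 within {0..1::real})"
    by (rule has_vector_derivative_const)
  ultimately show ?thesis
    by (rule vector_derivative_unique_within[rotated]) (simp add: at_within_Icc_at_right)
qed

text \<open>
  Integrated over any parallelogram, both mixed derivatives give the alternating sum of f over the corners. So the
  integral of their difference vanishes over all parallelograms, and the difference vanishes by continuity.
\<close>

lemma dir_deriv_commute:
  assumes f: "smooth f"
  shows "dir_deriv v (dir_deriv w f) = dir_deriv w (dir_deriv v f)"
proof
  fix q
  define D where "D = (\<lambda>q. dir_deriv v (dir_deriv w f) q - dir_deriv w (dir_deriv v f) q)"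
  note c = smooth_continuous[where S = UNIV]
  have cD: "continuous_on UNIV D"
    unfolding D_def by (intro continuous_on_diff c smooth_dir_deriv f)
  have sh: "continuous_on UNIV (\<lambda>q. g (q + u))" if "smooth g" for g u
    by (rule continuous_on_compose2[OF c[OF that]]) (auto intro: continuous_intros)
  have "line_int v s (line_int w t D) q = 0" if st: "s \<ge> 0" "t \<ge> 0" for s t q
  proof -
    have "line_int w t D = (\<lambda>q. line_int w t (dir_deriv v (dir_deriv w f)) q - line_int w t (dir_deriv w (dir_deriv v f)) q)"
      unfolding D_def by (intro ext line_int_diff c smooth_dir_deriv f)
    then have "line_int v s (line_int w t D) q = line_int v s (line_int w t (dir_deriv v (dir_deriv w f))) q - line_int v s (line_int w t (dir_deriv w (dir_deriv v f))) q"
      by (simp only: line_int_diff[OF line_int_continuous line_int_continuous] c smooth_dir_deriv f)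
    also have "line_int v s (line_int w t (dir_deriv v (dir_deriv w f))) q = line_int w t (\<lambda>q. dir_deriv w f (q + s *\<^sub>R v) - dir_deriv w f q) q"
      by (subst line_int_swap) (simp_all add: c smooth_dir_deriv f line_int_dir_deriv st cong: )
    also have "\<dots> = f (q + s *\<^sub>R v + t *\<^sub>R w) - f (q + s *\<^sub>R v) - (f (q + t *\<^sub>R w) - f q)"
      by (subst line_int_diff) (simp_all add: c sh smooth_dir_deriv f line_int_shift line_int_dir_deriv st)
    also have "line_int v s (line_int w t (dir_deriv w (dir_deriv v f))) q = line_int v s (\<lambda>q. dir_deriv v f (q + t *\<^sub>R w) - dir_deriv v f q) q"
      by (simp add: c smooth_dir_deriv f line_int_dir_deriv st)
    also have "\<dots> = f (q + t *\<^sub>R w + s *\<^sub>R v) - f (q + t *\<^sub>R w) - (f (q + s *\<^sub>R v) - f q)"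
      by (subst line_int_diff) (simp_all add: c sh smooth_dir_deriv f line_int_shift line_int_dir_deriv st)
    finally show ?thesis by (simp add: add_ac)
  qed
  then have "line_int w t D q = 0" if "t \<ge> 0" for t q
    using that by (intro line_int_eq_0_imp[OF line_int_continuous[OF cD]]) auto
  then have "D q = 0"
    by (intro line_int_eq_0_imp[OF cD]) auto
  then show "dir_deriv v (dir_deriv w f) q = dir_deriv w (dir_deriv v f) q" by (simp add: D_def)
qed

section \<open>The integral over a unit cube\<close>

text \<open>
  The integral over the unit cube with lowest corner at the argument, a fundamental domain of the quotient.
\<close>

definition mean :: "(real^4 \<Rightarrow> 'a::banach) \<Rightarrow> real^4 \<Rightarrow> 'a" where
  "mean f = line_int (axis 1 1) 1 (line_int (axis 2 1) 1 (line_int (axis 3 1) 1 (line_int (axis 4 1) 1 f)))"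

lemma mean_add:
  "continuous_on UNIV f \<Longrightarrow> continuous_on UNIV g \<Longrightarrow> mean (\<lambda>q. f q + g q) = (\<lambda>q. mean f q + mean g q)"
  by (simp add: mean_def line_int_add line_int_continuous)

lemma mean_cmult: "mean (\<lambda>q. c * f q) = (\<lambda>q. c * mean f q)" for f :: "real^4 \<Rightarrow> complex"
  by (simp add: mean_def line_int_cmult)

lemma line_int_of_real:
  fixes h :: "real^4 \<Rightarrow> real"
  assumes "continuous_on UNIV h"
  shows "line_int v s (\<lambda>q. complex_of_real (h q)) = (\<lambda>q. of_real (line_int v s h q))"
proof
  fix q
  have "((\<lambda>r. h (q + r *\<^sub>R v)) has_integral line_int v s h q) {0..s}"
    unfolding line_int_def by (rule integrable_integral[OF line_integrable[OF assms]])
  from has_integral_of_real[OF this] show "line_int v s (\<lambda>q. complex_of_real (h q)) q = of_real (line_int v s h q)"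
    unfolding line_int_def by (rule integral_unique)
qed

lemma line_int_nonneg:
  fixes h :: "real^4 \<Rightarrow> real"
  assumes "continuous_on UNIV h" "\<And>q. h q \<ge> 0"
  shows "line_int v s h q \<ge> 0"
  unfolding line_int_def by (intro integral_nonneg line_integrable assms)

lemma line_int_nonneg_eq_0:
  fixes h :: "real^4 \<Rightarrow> real"
  assumes h: "continuous_on UNIV h" "\<And>q. h q \<ge> 0" and z: "line_int v 1 h q = 0"
  shows "h q = 0"
proof -
  have "\<forall>x\<in>{0..1::real}. h (q + x *\<^sub>R v) = 0"
    using z unfolding line_int_def
    by (subst (asm) integral_eq_0_iff) (auto intro: line_continuous h)
  then have "h (q + 0 *\<^sub>R v) = 0" by (rule bspec) simp
  then show ?thesis by simp
qed

text \<open>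
  The corner of the cube is an arbitrary point, so a vanishing integral of a nonnegative function gives its
  vanishing everywhere.
\<close>

lemma mean_nonneg_eq_0:
  fixes h :: "real^4 \<Rightarrow> real"
  assumes h: "continuous_on UNIV h" "\<And>q. h q \<ge> 0" and z: "mean (\<lambda>q. complex_of_real (h q)) q = 0"
  shows "h q = 0"
proof -
  have "mean h q = 0"
    using z h(1) by (simp add: mean_def line_int_of_real line_int_continuous)
  then have "line_int (axis 2 1) 1 (line_int (axis 3 1) 1 (line_int (axis 4 1) 1 h)) q = 0"
    unfolding mean_def by (intro line_int_nonneg_eq_0 line_int_continuous line_int_nonneg h)
  then have "line_int (axis 3 1) 1 (line_int (axis 4 1) 1 h) q = 0"
    by (intro line_int_nonneg_eq_0 line_int_continuous line_int_nonneg h)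
  then have "line_int (axis 4 1) 1 h q = 0"
    by (intro line_int_nonneg_eq_0 line_int_continuous line_int_nonneg h)
  then show "h q = 0"
    by (intro line_int_nonneg_eq_0 line_int_continuous line_int_nonneg h)
qed

section \<open>Functions on the quotient\<close>

definition invariant :: "(real^4 \<Rightarrow> 'a) \<Rightarrow> bool" where
  "invariant f \<longleftrightarrow> (\<forall>t0 x0 y0 z0 q. f (kt_deck t0 x0 y0 z0 q) = f q)"

lemma kt_deck_differentiable: "kt_deck t0 x0 y0 z0 differentiable (at p)"
proof -
  have "linear (\<lambda>v::real^4. vector [v $ 1, v $ 2, v $ 3, v $ 4 + of_int x0 * v $ 3] :: real^4)"
    by (rule linearI) (simp_all add: vec_eq_iff forall_4 vector_4_nth algebra_simps)
  then have "((\<lambda>v::real^4. vector [v $ 1, v $ 2, v $ 3, v $ 4 + of_int x0 * v $ 3] +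
      vector [of_int t0, of_int x0, of_int y0, of_int z0] :: real^4) has_derivative
      (\<lambda>v. vector [v $ 1, v $ 2, v $ 3, v $ 4 + of_int x0 * v $ 3])) (at p)"
    by (auto intro!: derivative_eq_intros linear_imp_has_derivative)
  moreover have "(\<lambda>v::real^4. vector [v $ 1, v $ 2, v $ 3, v $ 4 + of_int x0 * v $ 3] +
      vector [of_int t0, of_int x0, of_int y0, of_int z0] :: real^4) = kt_deck t0 x0 y0 z0"
    by (simp add: fun_eq_iff kt_deck_def vec_eq_iff forall_4 vector_4_nth)
  ultimately show ?thesis by (auto intro: differentiableI)
qed

lemma axis4: "(axis 1 1 :: real^4) = vector [1, 0, 0, 0]" "(axis 2 1 :: real^4) = vector [0, 1, 0, 0]"
  "(axis 3 1 :: real^4) = vector [0, 0, 1, 0]" "(axis 4 1 :: real^4) = vector [0, 0, 0, 1]"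
  by (simp_all add: vec_eq_iff forall_4 vector_4_nth axis_def)

lemma invariant_fd:
  assumes f: "smooth f" and i: "invariant f"
  shows "fd f p v = fd f (kt_deck t0 x0 y0 z0 p) (vector [v $ 1, v $ 2, v $ 3, v $ 4 + of_int x0 * v $ 3])"
proof -
  have "f \<circ> kt_deck t0 x0 y0 z0 = f"
    using i by (simp add: invariant_def fun_eq_iff)
  then have "fd f p = fd (f \<circ> kt_deck t0 x0 y0 z0) p" by simp
  also have "\<dots> = fd f (kt_deck t0 x0 y0 z0 p) \<circ> frechet_derivative (kt_deck t0 x0 y0 z0) (at p)"
    by (intro frechet_derivative_compose kt_deck_differentiable smooth_differentiable f)
  finally show ?thesis by (simp add: kt_deck_derivative)
qed

text \<open>
  The deck transformation by \<open>x0\<close> sends \<open>\<partial>y\<close> to \<open>\<partial>y + x0 \<partial>z\<close> and x to \<open>x + x0\<close>; the combination \<open>\<partial>y + x \<partial>z\<close> is preserved.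
\<close>

lemma fderiv_invariant:
  assumes f: "smooth f" and i: "invariant f"
  shows "invariant (fderiv b j f)"
  unfolding invariant_def
proof (intro allI)
  fix t0 x0 y0 z0 p
  let ?d = "kt_deck t0 x0 y0 z0"
  note h = invariant_fd[OF f i, of p _ t0 x0 y0 z0]
  have d2: "?d p $ 2 = p $ 2 + of_int x0" by (simp add: kt_deck_def vector_4_nth)
  have 1: "fd f p (axis 1 1) = fd f (?d p) (axis 1 1)" "fd f p (axis 2 1) = fd f (?d p) (axis 2 1)"
    "fd f p (axis 4 1) = fd f (?d p) (axis 4 1)"
    unfolding h[of "axis 1 1"] h[of "axis 2 1"] h[of "axis 4 1"] by (simp_all add: axis4 vector_4_nth)
  let ?e = "axis 3 1 :: real^4"
  have "vector [?e $ 1, ?e $ 2, ?e $ 3, ?e $ 4 + of_int x0 * ?e $ 3] = (?e + of_int x0 *\<^sub>R axis 4 1 :: real^4)"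
    by (simp add: vec_eq_iff forall_4 vector_4_nth axis_def)
  then have "fd f p (axis 3 1) = fd f (?d p) (axis 3 1 + of_int x0 *\<^sub>R axis 4 1)"
    using h[of "axis 3 1"] by simp
  then have 3: "fd f p (axis 3 1) = fd f (?d p) (axis 3 1) + of_int x0 * fd f (?d p) (axis 4 1)"
    by (simp add: linear_add[OF linear_fd[OF smooth_differentiable[OF f]]]
        linear_scale[OF linear_fd[OF smooth_differentiable[OF f]]] scaleR_complex)
  show "fderiv b j f (?d p) = fderiv b j f p"
    by (cases j) (simp_all add: fderiv_def 1 3 d2 algebra_simps)
qed

text \<open>
  The smooth functions on the quotient.
\<close>

definition inv_smooth :: "(real^4 \<Rightarrow> complex) \<Rightarrow> bool" where
  "inv_smooth f \<longleftrightarrow> smooth f \<and> invariant f"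

lemma fderiv_dir_deriv:
  "fderiv b P1 f = (\<lambda>p. 1/2 * (dir_deriv (axis 1 1) f p + - \<i> * dir_deriv (axis 2 1) f p))"
  "fderiv b P2 f = (\<lambda>p. 1/2 * ((dir_deriv (axis 3 1) f p + of_real (p $ 2) * dir_deriv (axis 4 1) f p) + \<i> / of_real b * dir_deriv (axis 4 1) f p))"
  "fderiv b Q1 f = (\<lambda>p. 1/2 * (dir_deriv (axis 1 1) f p + \<i> * dir_deriv (axis 2 1) f p))"
  "fderiv b Q2 f = (\<lambda>p. 1/2 * ((dir_deriv (axis 3 1) f p + of_real (p $ 2) * dir_deriv (axis 4 1) f p) + - \<i> / of_real b * dir_deriv (axis 4 1) f p))"
  by (simp_all add: fun_eq_iff fderiv_def dir_deriv_def)

lemma smooth_fderiv: "smooth f \<Longrightarrow> smooth (fderiv b j f)"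
  by (cases j) (simp_all only: fderiv_dir_deriv, (intro smooth_mult smooth_add smooth_const smooth_dir_deriv smooth_coord; assumption)+)

lemma inv_smooth_fderiv: "inv_smooth f \<Longrightarrow> inv_smooth (fderiv b j f)"
  by (simp add: inv_smooth_def smooth_fderiv fderiv_invariant)

lemma inv_smooth_const: "inv_smooth (\<lambda>q. c)"
  by (simp add: inv_smooth_def smooth_const invariant_def)

lemma inv_smooth_add: "inv_smooth f \<Longrightarrow> inv_smooth g \<Longrightarrow> inv_smooth (\<lambda>q. f q + g q)"
  by (simp add: inv_smooth_def smooth_add invariant_def)

lemma inv_smooth_mult: "inv_smooth f \<Longrightarrow> inv_smooth g \<Longrightarrow> inv_smooth (\<lambda>q. f q * g q)"
  by (simp add: inv_smooth_def smooth_mult invariant_def)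

lemma inv_smooth_cnj: "inv_smooth f \<Longrightarrow> inv_smooth (\<lambda>q. cnj (f q))"
  by (simp add: inv_smooth_def smooth_cnj invariant_def)

lemma inv_smooth_smooth: "inv_smooth f \<Longrightarrow> smooth f"
  by (simp add: inv_smooth_def)

lemma inv_smooth_continuous: "inv_smooth f \<Longrightarrow> continuous_on S f"
  by (simp add: inv_smooth_def smooth_continuous)

section \<open>Calculus of the frame fields\<close>

lemma frame_value_add: "frame_value b p (\<lambda>v. f v + g v) j = frame_value b p f j + frame_value b p g j"
  by (cases j) (simp_all add: algebra_simps add_divide_distrib diff_divide_distrib)

lemma frame_value_cmult: "frame_value b p (\<lambda>v. c * f v) j = c * frame_value b p f j"
  by (cases j) (simp_all add: algebra_simps)

primrec bar :: "frame \<Rightarrow> frame" where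
  "bar P1 = Q1" | "bar P2 = Q2" | "bar Q1 = P1" | "bar Q2 = P2"

lemma bar_bar [simp]: "bar (bar j) = j"
  by (cases j) simp_all

lemma fderiv_const [simp]: "fderiv b j (\<lambda>q. c) = (\<lambda>q. 0)"
  by (cases j) (simp_all add: fderiv_def)

lemma fderiv_add:
  "smooth f \<Longrightarrow> smooth g \<Longrightarrow> fderiv b j (\<lambda>q. f q + g q) = (\<lambda>q. fderiv b j f q + fderiv b j g q)"
proof
  fix q assume s: "smooth f" "smooth g"
  have "fd (\<lambda>q. f q + g q) q = (\<lambda>v. fd f q v + fd g q v)"
    using fun_cong[OF dir_deriv_add[OF smooth_differentiable[OF s(1)] smooth_differentiable[OF s(2)]], of _ q]
    by (simp add: dir_deriv_def fun_eq_iff)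
  then show "fderiv b j (\<lambda>q. f q + g q) q = fderiv b j f q + fderiv b j g q"
    by (simp only: fderiv_def frame_value_add)
qed

lemma fderiv_mult:
  "smooth f \<Longrightarrow> smooth g \<Longrightarrow> fderiv b j (\<lambda>q. f q * g q) = (\<lambda>q. f q * fderiv b j g q + g q * fderiv b j f q)"
proof
  fix q assume s: "smooth f" "smooth g"
  have "fd (\<lambda>q. f q * g q) q = (\<lambda>v. f q * fd g q v + g q * fd f q v)"
    using fun_cong[OF dir_deriv_mult[OF smooth_differentiable[OF s(1)] smooth_differentiable[OF s(2)]], of _ q]
    by (simp add: dir_deriv_def fun_eq_iff mult.commute)
  then show "fderiv b j (\<lambda>q. f q * g q) q = f q * fderiv b j g q + g q * fderiv b j f q"
    by (simp only: fderiv_def frame_value_add frame_value_cmult)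
qed

lemma fderiv_cmult: "smooth f \<Longrightarrow> fderiv b j (\<lambda>q. c * f q) = (\<lambda>q. c * fderiv b j f q)"
  using fderiv_mult[OF smooth_const[of c], of f b j] by simp

lemma fderiv_cnj: "smooth f \<Longrightarrow> fderiv b j (\<lambda>q. cnj (f q)) = (\<lambda>q. cnj (fderiv b (bar j) f q))"
  by (cases j) (simp_all add: fderiv_dir_deriv dir_deriv_cnj smooth_differentiable)

lemma dir_deriv_coord: "dir_deriv v (\<lambda>q. complex_of_real (q $ m)) = (\<lambda>q. of_real (v $ m))"
  by (rule has_derivative_imp_dir_deriv)
    (intro has_derivative_of_real bounded_linear_imp_has_derivative bounded_linear_vec_nth)

lemma dir_deriv_add_smooth: "smooth f \<Longrightarrow> smooth g \<Longrightarrow> dir_deriv v (\<lambda>q. f q + g q) = (\<lambda>q. dir_deriv v f q + dir_deriv v g q)"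
  by (intro dir_deriv_add smooth_differentiable)

lemma dir_deriv_mult_smooth: "smooth f \<Longrightarrow> smooth g \<Longrightarrow> dir_deriv v (\<lambda>q. f q * g q) = (\<lambda>q. f q * dir_deriv v g q + dir_deriv v f q * g q)"
  by (intro dir_deriv_mult smooth_differentiable)

text \<open>
  The only nontrivial bracket is \<open>[\<partial>x, \<partial>y + x \<partial>z] = \<partial>z\<close>, and \<open>\<partial>z = - i b (V2 - cnj V2)\<close>.
\<close>

lemma fderiv_commute:
  assumes f: "smooth f" and b: "b \<noteq> 0"
  shows "fderiv b P1 (fderiv b Q1 f) = fderiv b Q1 (fderiv b P1 f)"
    "fderiv b P2 (fderiv b Q2 f) = fderiv b Q2 (fderiv b P2 f)"
    "fderiv b P1 (fderiv b P2 f) = (\<lambda>q. fderiv b P2 (fderiv b P1 f) q - of_real b / 4 * (fderiv b P2 f q - fderiv b Q2 f q))"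
    "fderiv b P1 (fderiv b Q2 f) = (\<lambda>q. fderiv b Q2 (fderiv b P1 f) q - of_real b / 4 * (fderiv b P2 f q - fderiv b Q2 f q))"
    "fderiv b Q1 (fderiv b P2 f) = (\<lambda>q. fderiv b P2 (fderiv b Q1 f) q + of_real b / 4 * (fderiv b P2 f q - fderiv b Q2 f q))"
    "fderiv b Q1 (fderiv b Q2 f) = (\<lambda>q. fderiv b Q2 (fderiv b Q1 f) q + of_real b / 4 * (fderiv b P2 f q - fderiv b Q2 f q))"
proof -
  have ax: "(axis 1 1 :: real^4) $ 2 = 0" "(axis 2 1 :: real^4) $ 2 = 1" "(axis 3 1 :: real^4) $ 2 = 0"
    "(axis 4 1 :: real^4) $ 2 = 0"
    by (simp_all add: axis_def)
  note sm = smooth_mult smooth_add smooth_const smooth_dir_deriv smooth_coord f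
  have cm: "dir_deriv v (\<lambda>q. c * g q) = (\<lambda>q. c * dir_deriv v g q)" if "smooth g" for v c g
    using dir_deriv_mult_smooth[OF smooth_const[of c] that, of v] by simp
  note com = dir_deriv_commute[OF f, of "axis 2 1" "axis 1 1"] dir_deriv_commute[OF f, of "axis 3 1" "axis 1 1"]
    dir_deriv_commute[OF f, of "axis 4 1" "axis 1 1"] dir_deriv_commute[OF f, of "axis 3 1" "axis 2 1"]
    dir_deriv_commute[OF f, of "axis 4 1" "axis 2 1"] dir_deriv_commute[OF f, of "axis 4 1" "axis 3 1"]
  show "fderiv b P1 (fderiv b Q1 f) = fderiv b Q1 (fderiv b P1 f)"
    "fderiv b P2 (fderiv b Q2 f) = fderiv b Q2 (fderiv b P2 f)"
    "fderiv b P1 (fderiv b P2 f) = (\<lambda>q. fderiv b P2 (fderiv b P1 f) q - of_real b / 4 * (fderiv b P2 f q - fderiv b Q2 f q))"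
    "fderiv b P1 (fderiv b Q2 f) = (\<lambda>q. fderiv b Q2 (fderiv b P1 f) q - of_real b / 4 * (fderiv b P2 f q - fderiv b Q2 f q))"
    "fderiv b Q1 (fderiv b P2 f) = (\<lambda>q. fderiv b P2 (fderiv b Q1 f) q + of_real b / 4 * (fderiv b P2 f q - fderiv b Q2 f q))"
    "fderiv b Q1 (fderiv b Q2 f) = (\<lambda>q. fderiv b Q2 (fderiv b Q1 f) q + of_real b / 4 * (fderiv b P2 f q - fderiv b Q2 f q))"
    by (simp_all only: fderiv_dir_deriv cm dir_deriv_add_smooth dir_deriv_mult_smooth sm dir_deriv_coord ax com)
      (simp_all add: fun_eq_iff b field_simps)
qed

section \<open>Integration by parts\<close>

text \<open>
  The shift by one in direction x is the deck transformation up to a shift in direction z that depends on y.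
\<close>

lemma invariant_periodic:
  assumes "invariant f"
  shows "f (q + axis 1 1) = f q" "f (q + axis 3 1) = f q" "f (q + axis 4 1) = f q"
    "f (q + axis 2 1) = f (q + (- q $ 3) *\<^sub>R axis 4 1)"
proof -
  have i: "f (kt_deck t0 x0 y0 z0 q) = f q" for t0 x0 y0 z0 q
    using assms by (simp add: invariant_def)
  have "kt_deck 1 0 0 0 q = q + axis 1 1" "kt_deck 0 0 1 0 q = q + axis 3 1" "kt_deck 0 0 0 1 q = q + axis 4 1"
    "kt_deck 0 1 0 0 (q + (- q $ 3) *\<^sub>R axis 4 1) = q + axis 2 1"
    by (simp_all add: kt_deck_def vec_eq_iff forall_4 vector_4_nth axis_def)
  with i show "f (q + axis 1 1) = f q" "f (q + axis 3 1) = f q" "f (q + axis 4 1) = f q"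
    "f (q + axis 2 1) = f (q + (- q $ 3) *\<^sub>R axis 4 1)" by metis+
qed

lemma mean_dir_deriv_periodic:
  assumes f: "smooth f" and per: "\<And>q. f (q + axis k 1) = f q" and k: "k = 1 \<or> k = 3 \<or> k = 4"
  shows "mean (dir_deriv (axis k 1) f) = (\<lambda>q. 0)"
proof -
  have z: "line_int (axis k 1) 1 (dir_deriv (axis k 1) f) = (\<lambda>q. 0)"
    by (simp add: line_int_dir_deriv[OF f] per)
  have c: "continuous_on UNIV (dir_deriv (axis k 1) f)" by (intro smooth_continuous smooth_dir_deriv f)
  let ?A = "\<lambda>k::4. line_int (axis k 1) 1 :: (real^4 \<Rightarrow> complex) \<Rightarrow> _"
  consider "k = 1" | "k = 3" | "k = 4" using k by blast
  then show ?thesis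
  proof cases
    case 1
    have "mean (dir_deriv (axis k 1) f) = ?A 2 (?A 3 (?A 4 (?A 1 (dir_deriv (axis k 1) f))))"
      by (simp add: mean_def line_int_swap[of _ "axis 1 1"] line_int_continuous c)
    then show ?thesis using z 1 by simp
  next
    case 2
    have "mean (dir_deriv (axis k 1) f) = ?A 1 (?A 2 (?A 4 (?A 3 (dir_deriv (axis k 1) f))))"
      by (simp add: mean_def line_int_swap[of _ "axis 3 1"] line_int_continuous c)
    then show ?thesis using z 2 by simp
  next
    case 3
    then show ?thesis using z by (simp add: mean_def)
  qed
qed

text \<open>
  The integral of a periodic function over a period does not depend on the initial point: the difference is the
  integral of the derivative, and integrating the derivative over the period first gives zero.
\<close>

lemma line_int_periodic:
  assumes f: "smooth f" and per: "\<And>q. f (q + v) = f q"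
  shows "line_int v 1 f (q + c *\<^sub>R v) = line_int v 1 f q"
proof -
  have *: "line_int v 1 f (q + c *\<^sub>R v) = line_int v 1 f q" if c: "c \<ge> 0" for c q
  proof -
    have sh: "continuous_on UNIV (\<lambda>q. f (q + u))" for u
      by (rule continuous_on_compose2[OF smooth_continuous[OF f, of UNIV]]) (auto intro: continuous_intros)
    have "line_int v 1 f (q + c *\<^sub>R v) - line_int v 1 f q = line_int v 1 (\<lambda>q. f (q + c *\<^sub>R v) - f q) q"
      by (subst line_int_diff) (simp_all add: sh smooth_continuous f line_int_shift)
    also have "\<dots> = line_int v c (line_int v 1 (dir_deriv v f)) q"
      unfolding line_int_dir_deriv[OF f c, symmetric]
      by (simp only: line_int_swap[OF smooth_continuous[OF smooth_dir_deriv[OF f]], of v 1])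
    also have "\<dots> = 0" by (simp add: line_int_dir_deriv[OF f] per)
    finally show ?thesis by simp
  qed
  show ?thesis
  proof (cases "c \<ge> 0")
    case False
    then show ?thesis using *[of "- c" "q + c *\<^sub>R v"] by simp
  qed (rule *)
qed

text \<open>
  The faces of the cube orthogonal to x are identified by a shift in direction z, which the integral over z
  does not see.
\<close>

lemma mean_dir_deriv_2:
  assumes f: "smooth f" and i: "invariant f"
  shows "mean (dir_deriv (axis 2 1) f) = (\<lambda>q. 0)"
proof -
  let ?A = "\<lambda>k::4. line_int (axis k 1) 1 :: (real^4 \<Rightarrow> complex) \<Rightarrow> _"
  have c: "continuous_on UNIV (dir_deriv (axis 2 1) f)" by (intro smooth_continuous smooth_dir_deriv f)
  have sh: "continuous_on UNIV (\<lambda>q. f (q + u))" for u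
    by (rule continuous_on_compose2[OF smooth_continuous[OF f, of UNIV]]) (auto intro: continuous_intros)
  have "?A 4 (?A 2 (dir_deriv (axis 2 1) f)) q = 0" for q
  proof -
    have "?A 4 (?A 2 (dir_deriv (axis 2 1) f)) q = ?A 4 (\<lambda>q. f (q + axis 2 1)) q - ?A 4 f q"
      by (simp add: line_int_dir_deriv[OF f] line_int_diff sh smooth_continuous f)
    also have "?A 4 (\<lambda>q. f (q + axis 2 1)) q = ?A 4 f (q + (- q $ 3) *\<^sub>R axis 4 1)"
    proof -
      have "(axis 4 1 :: real^4) $ 3 = 0" by (simp add: axis_def)
      then have "(\<lambda>r. f (q + r *\<^sub>R axis 4 1 + axis 2 1)) = (\<lambda>r. f (q + (- q $ 3) *\<^sub>R axis 4 1 + r *\<^sub>R axis 4 1))"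
        unfolding invariant_periodic(4)[OF i] by (simp add: algebra_simps)
      then show ?thesis by (simp only: line_int_def)
    qed
    also have "\<dots> = ?A 4 f q"
      by (rule line_int_periodic[OF f invariant_periodic(3)[OF i]])
    finally show ?thesis by simp
  qed
  then have "?A 4 (?A 2 (dir_deriv (axis 2 1) f)) = (\<lambda>q. 0)" by (rule ext)
  moreover have "mean (dir_deriv (axis 2 1) f) = ?A 1 (?A 3 (?A 4 (?A 2 (dir_deriv (axis 2 1) f))))"
    by (simp add: mean_def line_int_swap[of _ "axis 2 1"] line_int_continuous c)
  ultimately show ?thesis by simp
qed

lemma mean_x_dir_deriv_4:
  assumes f: "smooth f" and i: "invariant f"
  shows "mean (\<lambda>q. of_real (q $ 2) * dir_deriv (axis 4 1) f q) = (\<lambda>q. 0)"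
proof -
  have "line_int (axis 4 1) 1 (\<lambda>q. of_real (q $ 2) * dir_deriv (axis 4 1) f q) = (\<lambda>q. of_real (q $ 2) * line_int (axis 4 1) 1 (dir_deriv (axis 4 1) f) q)"
    by (simp add: line_int_def axis_def fun_eq_iff)
  also have "\<dots> = (\<lambda>q. 0)" by (simp add: line_int_dir_deriv[OF f] invariant_periodic(3)[OF i])
  finally show ?thesis by (simp add: mean_def)
qed

text \<open>
  Stokes' theorem on the quotient for the frame fields, which are divergence-free.
\<close>

lemma mean_fderiv:
  assumes "inv_smooth f"
  shows "mean (fderiv b j f) = (\<lambda>q. 0)"
proof -
  have f: "smooth f" and i: "invariant f" using assms by (simp_all add: inv_smooth_def)
  have m1: "mean (dir_deriv (axis 1 1) f) = (\<lambda>q. 0)" and m3: "mean (dir_deriv (axis 3 1) f) = (\<lambda>q. 0)"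
    and m4: "mean (dir_deriv (axis 4 1) f) = (\<lambda>q. 0)"
    by (rule mean_dir_deriv_periodic[OF f]; simp add: invariant_periodic(1-3)[OF i])+
  note m = m1 mean_dir_deriv_2[OF f i] m3 m4 mean_x_dir_deriv_4[OF f i]
  have c: "continuous_on UNIV (dir_deriv v f)" "continuous_on UNIV (\<lambda>q. c * dir_deriv v f q)"
    "continuous_on UNIV (\<lambda>q. of_real (q $ 2) * dir_deriv v f q)"
    "continuous_on UNIV (\<lambda>q. dir_deriv v f q + of_real (q $ 2) * dir_deriv w f q)" for v w c
    by (intro smooth_continuous smooth_dir_deriv smooth_mult smooth_add smooth_const smooth_coord f)+
  have 12: "mean (\<lambda>q. k * (dir_deriv (axis 1 1) f q + c * dir_deriv (axis 2 1) f q)) = (\<lambda>q. 0)" for k c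
    unfolding mean_cmult mean_add[OF c(1,2)] by (simp add: m)
  have 34: "mean (\<lambda>q. k * (dir_deriv (axis 3 1) f q + of_real (q $ 2) * dir_deriv (axis 4 1) f q + c * dir_deriv (axis 4 1) f q)) = (\<lambda>q. 0)" for k c
    unfolding mean_cmult mean_add[OF c(4,2)] mean_add[OF c(1,3)] by (simp add: m)
  show ?thesis
    by (cases j) (simp_all only: fderiv_dir_deriv 12 34)
qed

lemma mean_by_parts:
  assumes f: "inv_smooth f" and g: "inv_smooth g"
  shows "mean (\<lambda>q. fderiv b j f q * cnj (g q)) q = - mean (\<lambda>q. f q * cnj (fderiv b (bar j) g q)) q"
proof -
  note G = inv_smooth_mult inv_smooth_fderiv inv_smooth_cnj f g
  have "(\<lambda>q. 0) = mean (fderiv b j (\<lambda>q. f q * cnj (g q)))"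
    by (simp add: mean_fderiv inv_smooth_mult inv_smooth_cnj f g)
  also have "fderiv b j (\<lambda>q. f q * cnj (g q)) = (\<lambda>q. f q * cnj (fderiv b (bar j) g q) + fderiv b j f q * cnj (g q))"
    by (simp add: fderiv_mult fderiv_cnj inv_smooth_smooth G mult.commute)
  also have "mean \<dots> = (\<lambda>q. mean (\<lambda>q. f q * cnj (fderiv b (bar j) g q)) q + mean (\<lambda>q. fderiv b j f q * cnj (g q)) q)"
    by (intro mean_add inv_smooth_continuous G)
  finally have "0 = mean (\<lambda>q. f q * cnj (fderiv b (bar j) g q)) q + mean (\<lambda>q. fderiv b j f q * cnj (g q)) q"
    by (rule fun_cong)
  then show ?thesis by (simp add: eq_neg_iff_add_eq_0 add.commute)
qed

section \<open>Coefficients of forms on the quotient\<close>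

definition inv_field :: "field \<Rightarrow> bool" where
  "inv_field F \<longleftrightarrow> (\<forall>a b c d. inv_smooth (coeff F a b c d))"

lemma inv_fieldI: "(\<And>a b c d. inv_smooth (\<lambda>p. F p a b c d)) \<Longrightarrow> inv_field F"
  by (simp add: inv_field_def coeff_def)

lemma inv_fieldD: "inv_field F \<Longrightarrow> inv_smooth (\<lambda>p. F p a b c d)"
  by (simp add: inv_field_def coeff_def)

lemma inv_field_diff_field: "inv_field F \<Longrightarrow> diff_field F"
  by (simp add: inv_field_def diff_field_def inv_smooth_smooth smooth_differentiable)

lemma inv_field_add: "inv_field F \<Longrightarrow> inv_field G \<Longrightarrow> inv_field (\<lambda>p. F p + G p)"
  by (auto intro!: inv_fieldI inv_smooth_add dest: inv_fieldD)

lemma inv_smooth_cmult: "inv_smooth f \<Longrightarrow> inv_smooth (\<lambda>p. c * f p)"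
  by (intro inv_smooth_mult inv_smooth_const)

lemma inv_field_scale: "inv_field F \<Longrightarrow> inv_field (\<lambda>p. scale k (F p))"
  by (auto intro!: inv_fieldI inv_smooth_cmult dest: inv_fieldD)

lemma inv_field_minus: "inv_field F \<Longrightarrow> inv_field (\<lambda>p. - F p)"
  using inv_field_scale[of F "-1"] by (simp add: scale_minus_one)

lemma inv_field_diff: "inv_field F \<Longrightarrow> inv_field G \<Longrightarrow> inv_field (\<lambda>p. F p - G p)"
  using inv_field_add[OF _ inv_field_minus, of F G] by simp

lemma inv_field_fderiv_ext: "inv_field F \<Longrightarrow> inv_field (fderiv_ext b j F)"
  by (simp add: inv_field_def fderiv_ext_def coeff_def inv_smooth_fderiv)

lemma inv_field_exterior: "inv_field F \<Longrightarrow> inv_field (\<lambda>p. exterior j (F p))"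
proof (rule inv_fieldI)
  fix s t u v assume "inv_field F"
  note h = inv_fieldD[OF this]
  show "inv_smooth (\<lambda>p. exterior j (F p) s t u v)"
    by (cases j; cases s; cases t; cases u; cases v) (simp_all add: exterior.simps h inv_smooth_const inv_smooth_cmult[OF h, of "-1", simplified])
qed

lemma inv_field_interior: "inv_field F \<Longrightarrow> inv_field (\<lambda>p. interior j (F p))"
proof (rule inv_fieldI)
  fix s t u v assume "inv_field F"
  note h = inv_fieldD[OF this]
  show "inv_smooth (\<lambda>p. interior j (F p) s t u v)"
    by (cases j; cases s; cases t; cases u; cases v) (simp_all add: interior.simps h inv_smooth_const inv_smooth_cmult[OF h, of "-1", simplified])
qed

lemma inv_field_star: "inv_field F \<Longrightarrow> inv_field (\<lambda>p. star (F p))"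
  by (rule inv_fieldI) (simp add: star_def inv_smooth_cmult inv_fieldD)

lemma inv_field_torsion: "inv_field F \<Longrightarrow> inv_field (\<lambda>p. torsion (F p))"
    "inv_field F \<Longrightarrow> inv_field (\<lambda>p. torsion_bar (F p))"
  unfolding torsion_def torsion_bar_def by (intro inv_field_add inv_field_diff inv_field_exterior inv_field_interior; assumption)+

lemma inv_field_cdel: "inv_field F \<Longrightarrow> inv_field (cdel b F)"
    "inv_field F \<Longrightarrow> inv_field (cdelbar b F)"
  unfolding cdel_def cdelbar_def by (intro inv_field_add inv_field_scale inv_field_torsion inv_field_exterior inv_field_fderiv_ext; assumption)+

lemma fderiv_ext_interior:
  assumes "inv_field F"
  shows "fderiv_ext b j (\<lambda>p. interior k (F p)) = (\<lambda>p. interior k (fderiv_ext b j F p))"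
proof (intro HOL.ext)
  fix p s t u v
  note h = fderiv_cmult[OF inv_smooth_smooth[OF inv_fieldD[OF assms]], of b j "-1"]
  show "fderiv_ext b j (\<lambda>p. interior k (F p)) p s t u v = interior k (fderiv_ext b j F p) s t u v"
    by (cases k; cases s; cases t; cases u; cases v; simp add: fderiv_ext_def coeff_def interior.simps h[simplified])
qed

lemma fderiv_ext_star:
  assumes "inv_field F"
  shows "fderiv_ext b j (\<lambda>p. star (F p)) = (\<lambda>p. star (fderiv_ext b j F p))"
  by (intro HOL.ext) (simp add: fderiv_ext_def coeff_def star_def fderiv_cmult inv_smooth_smooth inv_fieldD[OF assms])

section \<open>Formal adjoints\<close>

definition torsion_adj :: "ext \<Rightarrow> ext" where
  "torsion_adj F = exterior P2 (interior P2 (interior P1 F)) - exterior Q2 (interior Q1 (interior P2 F)) - exterior Q2 (interior Q2 (interior P1 F))"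

definition torsion_bar_adj :: "ext \<Rightarrow> ext" where
  "torsion_bar_adj F = exterior P2 (interior Q2 (interior P1 F)) + exterior P2 (interior Q1 (interior P2 F)) + exterior Q2 (interior Q2 (interior Q1 F))"

text \<open>
  The formal adjoints of \<open>\<partial>\<close> and \<open>\<partial>bar\<close>: exterior multiplication becomes contraction, and a frame field
  becomes minus its conjugate.
\<close>

definition cdel_adj :: "real \<Rightarrow> field \<Rightarrow> field" where
  "cdel_adj b F = (\<lambda>p. - interior P1 (fderiv_ext b Q1 F p) - interior P2 (fderiv_ext b Q2 F p) + scale (of_real b / 4) (torsion_adj (F p)))"

definition cdelbar_adj :: "real \<Rightarrow> field \<Rightarrow> field" where
  "cdelbar_adj b F = (\<lambda>p. - interior Q1 (fderiv_ext b P1 F p) - interior Q2 (fderiv_ext b P2 F p) + scale (of_real b / 4) (torsion_bar_adj (F p)))"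

lemma star_exterior_star: "star (exterior (bar j) (star F)) = interior j F"
proof (rule ext_eqI)
  fix s t u v
  show "star (exterior (bar j) (star F)) s t u v = interior j F s t u v"
    by (cases j; cases s; cases t; cases u; cases v; simp add: star_def exterior.simps interior.simps)
qed

lemma star_torsion_star: "star (torsion (star F)) = - torsion_bar_adj F"
    "star (torsion_bar (star F)) = - torsion_adj F"
proof -
  show "star (torsion (star F)) = - torsion_bar_adj F"
  proof (rule ext_eqI)
    fix s t u v
    show "star (torsion (star F)) s t u v = (- torsion_bar_adj F) s t u v"
      by (cases s; cases t; cases u; cases v; simp add: star_def torsion_def torsion_bar_adj_def exterior.simps interior.simps)
  qed
  show "star (torsion_bar (star F)) = - torsion_adj F"
  proof (rule ext_eqI)
    fix s t u v
    show "star (torsion_bar (star F)) s t u v = (- torsion_adj F) s t u v"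
      by (cases s; cases t; cases u; cases v; simp add: star_def torsion_bar_def torsion_adj_def exterior.simps interior.simps)
  qed
qed

text \<open>
  Thus \<open>- * \<partial>bar *\<close> and \<open>- * \<partial> *\<close> are the adjoints. On coefficients this is a finite computation, since the star
  turns exterior multiplication by a conjugate generator into contraction.
\<close>

lemma star_conjugates:
  assumes F: "inv_field F"
  shows "- star (cdelbar b (\<lambda>p. star (F p)) p) = cdel_adj b F p"
    "- star (cdel b (\<lambda>p. star (F p)) p) = cdelbar_adj b F p"
  using star_exterior_star[of P1] star_exterior_star[of P2] star_exterior_star[of Q1] star_exterior_star[of Q2]
  by (simp_all add: cdel_def cdelbar_def cdel_adj_def cdelbar_adj_def fderiv_ext_star[OF F] star_add star_scale star_torsion_star)
    (rule ext_eqI, simp)+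

lemma inv_field_cdel_adj: "inv_field F \<Longrightarrow> inv_field (cdel_adj b F)"
    "inv_field F \<Longrightarrow> inv_field (cdelbar_adj b F)"
  unfolding cdel_adj_def cdelbar_adj_def torsion_adj_def torsion_bar_adj_def
  by (intro inv_field_add inv_field_scale inv_field_diff inv_field_minus inv_field_exterior inv_field_interior inv_field_fderiv_ext; assumption)+

lemma form_minus_field: "(\<lambda>p. form b p (- F p)) = - (\<lambda>p. form b p (F p))"
  by (simp add: fun_eq_iff form_scale_apply flip: scale_minus_one)

lemma del_adj_form:
  assumes b: "b \<noteq> 0" and F: "inv_field F"
  shows "del_adj (kt_J b) (kt_omega b) (\<lambda>p. form b p (F p)) = (\<lambda>p. form b p (cdel_adj b F p))"
    "delbar_adj (kt_J b) (kt_omega b) (\<lambda>p. form b p (F p)) = (\<lambda>p. form b p (cdelbar_adj b F p))"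
  by (simp_all only: del_adj_def delbar_adj_def hodge_form[OF b] del_form[OF b] delbar_form[OF b]
    inv_field_diff_field inv_field_star F star_conjugates[OF F, symmetric] form_minus_field)

lemma laplacian_delbar_form:
  assumes b: "b \<noteq> 0" and F: "inv_field F"
  shows "laplacian_delbar (kt_J b) (kt_omega b) (\<lambda>p. form b p (F p)) =
    (\<lambda>p. form b p (cdelbar b (cdelbar_adj b F) p + cdelbar_adj b (cdelbar b F) p))"
  by (simp only: laplacian_delbar_def del_adj_form[OF b] del_form[OF b] delbar_form[OF b] inv_field_diff_field inv_field_cdel inv_field_cdel_adj F)
    (simp add: fun_eq_iff form_add_apply)

lemma laplacian_BC_form:
  assumes b: "b \<noteq> 0" and F: "inv_field F"
  shows "laplacian_BC (kt_J b) (kt_omega b) (\<lambda>p. form b p (F p)) =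
    (\<lambda>p. form b p (cdel b (cdelbar b (cdelbar_adj b (cdel_adj b F))) p + cdelbar_adj b (cdel_adj b (cdel b (cdelbar b F))) p +
      cdel_adj b (cdelbar b (cdelbar_adj b (cdel b F))) p + cdelbar_adj b (cdel b (cdel_adj b (cdelbar b F))) p +
      cdel_adj b (cdel b F) p + cdelbar_adj b (cdelbar b F) p))"
  by (simp only: laplacian_BC_def del_adj_form[OF b] del_form[OF b] delbar_form[OF b] inv_field_diff_field inv_field_cdel inv_field_cdel_adj F)
    (simp add: fun_eq_iff form_add_apply)

section \<open>The global inner product\<close>

lemma herm_exterior: "herm (exterior j F) G = herm F (interior j G)"
  by (cases j) (simp_all add: herm_def UNIV_bool exterior.simps interior.simps)

lemma herm_interior: "herm (interior j F) G = herm F (exterior j G)"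
  by (cases j) (simp_all add: herm_def UNIV_bool exterior.simps interior.simps)

lemma herm_minus_left: "herm (- F) G = - herm F G"
  using herm_scale_left[of "-1" F G] by (simp add: scale_minus_one)

lemma herm_minus_right: "herm F (- G) = - herm F G"
  using herm_scale_right[of F "-1" G] by (simp add: scale_minus_one)

lemma herm_diff_left: "herm (F - F') G = herm F G - herm F' G"
  using herm_add_left[of F "- F'" G] by (simp add: herm_minus_left)

lemma herm_diff_right: "herm F (G - G') = herm F G - herm F G'"
  using herm_add_right[of F G "- G'"] by (simp add: herm_minus_right)

lemma herm_torsion: "herm (torsion F) G = herm F (torsion_adj G)"
    "herm (torsion_bar F) G = herm F (torsion_bar_adj G)"
  "herm (torsion_adj F) G = herm F (torsion G)" "herm (torsion_bar_adj F) G = herm F (torsion_bar G)"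
  by (simp_all add: torsion_def torsion_bar_def torsion_adj_def torsion_bar_adj_def herm_add_left herm_add_right herm_diff_left herm_diff_right herm_exterior herm_interior)

text \<open>
  The argument is the corner of the cube of integration. It is kept, since vanishing at every corner is what yields
  pointwise conclusions.
\<close>

definition l2_prod :: "field \<Rightarrow> field \<Rightarrow> real^4 \<Rightarrow> complex" where
  "l2_prod F G = mean (\<lambda>p. herm (F p) (G p))"

lemma inv_smooth_sum: "(\<And>x. x \<in> A \<Longrightarrow> inv_smooth (f x)) \<Longrightarrow> inv_smooth (\<lambda>p. \<Sum>x\<in>A. f x p)"
  by (induction A rule: infinite_finite_induct) (auto intro: inv_smooth_add inv_smooth_const)

lemma inv_smooth_herm: "inv_field F \<Longrightarrow> inv_field G \<Longrightarrow> inv_smooth (\<lambda>p. herm (F p) (G p))"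
  unfolding herm_def by (intro inv_smooth_sum inv_smooth_mult inv_smooth_cnj inv_fieldD)

lemma mean_zero [simp]: "mean (\<lambda>q. 0) = (\<lambda>q. 0)"
  by (simp add: mean_def)

lemma mean_sum: "(\<And>x. x \<in> A \<Longrightarrow> inv_smooth (f x)) \<Longrightarrow> mean (\<lambda>p. \<Sum>x\<in>A. f x p) q = (\<Sum>x\<in>A. mean (f x) q)"
proof (induction A rule: infinite_finite_induct)
  case (insert x A)
  then have "mean (\<lambda>p. f x p + (\<Sum>x\<in>A. f x p)) q = mean (f x) q + mean (\<lambda>p. \<Sum>x\<in>A. f x p) q"
    by (subst mean_add) (auto intro!: inv_smooth_continuous inv_smooth_sum)
  with insert show ?case by simp
qed auto

lemma l2_prod_add:
  assumes "inv_field F" "inv_field G" "inv_field H"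
  shows "l2_prod (\<lambda>p. F p + G p) H q = l2_prod F H q + l2_prod G H q"
    "l2_prod H (\<lambda>p. F p + G p) q = l2_prod H F q + l2_prod H G q"
  by (simp_all add: l2_prod_def herm_add_left herm_add_right mean_add inv_smooth_continuous inv_smooth_herm assms)

lemma l2_prod_scale: "l2_prod (\<lambda>p. scale k (F p)) H q = k * l2_prod F H q"
    "l2_prod H (\<lambda>p. scale k (F p)) q = cnj k * l2_prod H F q"
  by (simp_all add: l2_prod_def herm_scale_left herm_scale_right mean_cmult)

lemma l2_prod_fderiv_ext:
  assumes F: "inv_field F" and G: "inv_field G"
  shows "l2_prod (fderiv_ext b j F) G q = - l2_prod F (fderiv_ext b (bar j) G) q"
proof -
  have "mean (\<lambda>p. \<Sum>s\<in>UNIV. \<Sum>t\<in>UNIV. \<Sum>u\<in>UNIV. \<Sum>v\<in>UNIV. fderiv b j (coeff F s t u v) p * cnj (G p s t u v)) q =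
    (\<Sum>s\<in>UNIV. \<Sum>t\<in>UNIV. \<Sum>u\<in>UNIV. \<Sum>v\<in>UNIV. mean (\<lambda>p. fderiv b j (coeff F s t u v) p * cnj (coeff G s t u v p)) q)"
    using F G unfolding coeff_def
    by (simp add: mean_sum inv_smooth_sum inv_smooth_mult inv_smooth_cnj inv_smooth_fderiv inv_fieldD)
  also have "\<dots> = - (\<Sum>s\<in>UNIV. \<Sum>t\<in>UNIV. \<Sum>u\<in>UNIV. \<Sum>v\<in>UNIV. mean (\<lambda>p. coeff F s t u v p * cnj (fderiv b (bar j) (coeff G s t u v) p)) q)"
    using F G by (simp add: inv_field_def mean_by_parts sum_negf)
  also have "(\<Sum>s\<in>UNIV. \<Sum>t\<in>UNIV. \<Sum>u\<in>UNIV. \<Sum>v\<in>UNIV. mean (\<lambda>p. coeff F s t u v p * cnj (fderiv b (bar j) (coeff G s t u v) p)) q) =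
    mean (\<lambda>p. \<Sum>s\<in>UNIV. \<Sum>t\<in>UNIV. \<Sum>u\<in>UNIV. \<Sum>v\<in>UNIV. F p s t u v * cnj (fderiv b (bar j) (coeff G s t u v) p)) q"
    using F G unfolding coeff_def
    by (simp add: mean_sum inv_smooth_sum inv_smooth_mult inv_smooth_cnj inv_smooth_fderiv inv_fieldD)
  finally show ?thesis by (simp add: l2_prod_def herm_def fderiv_ext_def)
qed

lemma l2_prod_exterior: "l2_prod (\<lambda>p. exterior j (F p)) G q = l2_prod F (\<lambda>p. interior j (G p)) q"
  by (simp add: l2_prod_def herm_exterior)

lemma l2_prod_torsion: "l2_prod (\<lambda>p. torsion (F p)) G q = l2_prod F (\<lambda>p. torsion_adj (G p)) q"
    "l2_prod (\<lambda>p. torsion_bar (F p)) G q = l2_prod F (\<lambda>p. torsion_bar_adj (G p)) q"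
  by (simp_all add: l2_prod_def herm_torsion)

lemma l2_prod_minus: "l2_prod F (\<lambda>p. - G p) q = - l2_prod F G q"
  using l2_prod_scale(2)[of F "-1" G q] by (simp add: scale_minus_one)

lemma inv_field_torsion_adj: "inv_field F \<Longrightarrow> inv_field (\<lambda>p. torsion_adj (F p))"
    "inv_field F \<Longrightarrow> inv_field (\<lambda>p. torsion_bar_adj (F p))"
  unfolding torsion_adj_def torsion_bar_adj_def by (intro inv_field_add inv_field_diff inv_field_exterior inv_field_interior; assumption)+

lemma l2_prod_cdel:
  assumes F: "inv_field F" and G: "inv_field G"
  shows "l2_prod (cdel b F) G q = l2_prod F (cdel_adj b G) q"
    "l2_prod (cdelbar b F) G q = l2_prod F (cdelbar_adj b G) q"
proof -
  note g = inv_field_add inv_field_scale inv_field_minus inv_field_torsion inv_field_torsion_adj inv_field_exterior inv_field_interior inv_field_fderiv_ext F G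
  have exterior: "l2_prod (\<lambda>p. exterior k (fderiv_ext b k F p)) G q = l2_prod F (\<lambda>p. - interior k (fderiv_ext b (bar k) G p)) q" for k
    by (simp add: l2_prod_exterior l2_prod_fderiv_ext fderiv_ext_interior l2_prod_minus g)
  have r: "cdel_adj b G = (\<lambda>p. (- interior P1 (fderiv_ext b Q1 G p) + - interior P2 (fderiv_ext b Q2 G p)) + scale (of_real b / 4) (torsion_adj (G p)))"
    "cdelbar_adj b G = (\<lambda>p. (- interior Q1 (fderiv_ext b P1 G p) + - interior Q2 (fderiv_ext b P2 G p)) + scale (of_real b / 4) (torsion_bar_adj (G p)))"
    by (simp_all add: cdel_adj_def cdelbar_adj_def)
  show "l2_prod (cdel b F) G q = l2_prod F (cdel_adj b G) q"
    "l2_prod (cdelbar b F) G q = l2_prod F (cdelbar_adj b G) q"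
    unfolding r cdel_def cdelbar_def by (simp_all only: l2_prod_add l2_prod_scale exterior l2_prod_torsion g bar.simps) simp_all
qed

lemma herm_cnj: "herm G F = cnj (herm F G)"
  by (simp add: herm_def cnj_sum mult.commute)

lemma line_int_cnj: "line_int v s (\<lambda>q. cnj (f q)) = (\<lambda>q. cnj (line_int v s f q))" if "continuous_on UNIV f"
proof
  fix q
  have "((\<lambda>r. f (q + r *\<^sub>R v)) has_integral line_int v s f q) {0..s}"
    unfolding line_int_def by (rule integrable_integral[OF line_integrable[OF that]])
  from has_integral_linear[OF this bounded_linear_cnj] show "line_int v s (\<lambda>q. cnj (f q)) q = cnj (line_int v s f q)"
    unfolding line_int_def by (simp add: o_def integral_unique)
qed

lemma l2_prod_cnj:
  assumes "inv_field F" "inv_field G"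
  shows "l2_prod G F q = cnj (l2_prod F G q)"
  unfolding l2_prod_def mean_def herm_cnj[of "G _" "F _"]
  by (simp add: line_int_cnj line_int_continuous inv_smooth_continuous inv_smooth_herm assms)

lemma l2_prod_cdel_adj:
  assumes F: "inv_field F" and G: "inv_field G"
  shows "l2_prod (cdel_adj b F) G q = l2_prod F (cdel b G) q"
    "l2_prod (cdelbar_adj b F) G q = l2_prod F (cdelbar b G) q"
  using l2_prod_cdel[OF G F, of b q]
  by (metis l2_prod_cnj inv_field_cdel inv_field_cdel_adj F G complex_cnj_cnj)+

definition norm_sq :: "ext \<Rightarrow> real" where
  "norm_sq F = (\<Sum>a\<in>UNIV. \<Sum>b\<in>UNIV. \<Sum>c\<in>UNIV. \<Sum>d\<in>UNIV. (cmod (F a b c d))\<^sup>2)"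

lemma herm_self: "herm F F = of_real (norm_sq F)"
  by (simp add: herm_def norm_sq_def complex_norm_square del: of_real_power)

lemma norm_sq_nonneg: "norm_sq F \<ge> 0"
  by (simp add: norm_sq_def sum_nonneg)

lemma norm_sq_eq_0: "norm_sq F = 0 \<Longrightarrow> F = 0"
  by (rule ext_eqI) (simp add: norm_sq_def sum_nonneg_eq_0_iff sum_nonneg)

lemma norm_sq_continuous: "inv_field F \<Longrightarrow> continuous_on UNIV (\<lambda>p. norm_sq (F p))"
  unfolding norm_sq_def by (intro continuous_intros inv_smooth_continuous inv_fieldD)

lemma l2_prod_self: "l2_prod F F q = mean (\<lambda>p. of_real (norm_sq (F p))) q"
  by (simp add: l2_prod_def herm_self)

lemma sum_l2_prod_eq_0:
  assumes G: "\<And>F. F \<in> set Fs \<Longrightarrow> inv_field F" and z: "\<And>q. (\<Sum>F\<leftarrow>Fs. l2_prod F F q) = 0" and F: "F \<in> set Fs"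
  shows "F q = 0"
proof -
  have "continuous_on UNIV (\<lambda>p. \<Sum>F\<leftarrow>Fs. norm_sq (F p)) \<and>
     mean (\<lambda>p. complex_of_real (\<Sum>F\<leftarrow>Fs. norm_sq (F p))) q = (\<Sum>F\<leftarrow>Fs. l2_prod F F q)" for q
    using G
  proof (induction Fs)
    case (Cons F Fs)
    then have c: "continuous_on UNIV (\<lambda>p. norm_sq (F p))" "continuous_on UNIV (\<lambda>p. \<Sum>F\<leftarrow>Fs. norm_sq (F p))"
      by (auto intro: norm_sq_continuous)
    have "mean (\<lambda>p. complex_of_real (norm_sq (F p)) + of_real (\<Sum>F\<leftarrow>Fs. norm_sq (F p))) q =
       mean (\<lambda>p. complex_of_real (norm_sq (F p))) q + mean (\<lambda>p. of_real (\<Sum>F\<leftarrow>Fs. norm_sq (F p))) q"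
      by (subst mean_add) (auto intro!: continuous_intros c)
    with Cons c show ?case by (auto simp: l2_prod_self intro!: continuous_intros)
  qed simp
  then have "(\<Sum>F\<leftarrow>Fs. norm_sq (F q)) = 0"
    using z by (intro mean_nonneg_eq_0) (auto intro!: sum_list_nonneg norm_sq_nonneg)
  then have "norm_sq (F q) = 0"
    using F norm_sq_nonneg by (subst (asm) sum_list_nonneg_eq_0_iff) auto
  then show ?thesis by (rule norm_sq_eq_0)
qed

section \<open>Kernels of the Laplacians\<close>

lemma fderiv_ext_zero: "(\<And>p. F p = 0) \<Longrightarrow> fderiv_ext b j F p = 0"
  by (rule ext_eqI) (simp add: fderiv_ext_def coeff_def)

lemma operator_zero:
  assumes "\<And>p. F p = 0"
  shows "cdel b F p = 0" "cdelbar b F p = 0" "cdel_adj b F p = 0" "cdelbar_adj b F p = 0"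
  by (rule ext_eqI; simp add: cdel_def cdelbar_def cdel_adj_def cdelbar_adj_def fderiv_ext_zero[of F, OF assms] assms
    torsion_def torsion_bar_def torsion_adj_def torsion_bar_adj_def)+

text \<open>
  The first-order systems that describe the kernels of the two Laplacians.
\<close>

definition harm_delbar :: "real \<Rightarrow> field \<Rightarrow> bool" where
  "harm_delbar b F \<longleftrightarrow> (\<forall>p. cdelbar b F p = 0) \<and> (\<forall>p. cdelbar_adj b F p = 0)"

definition harm_BC :: "real \<Rightarrow> field \<Rightarrow> bool" where
  "harm_BC b F \<longleftrightarrow> (\<forall>p. cdel b F p = 0) \<and> (\<forall>p. cdelbar b F p = 0) \<and> (\<forall>p. cdelbar_adj b (cdel_adj b F) p = 0)"

lemma l2_prod_zero: "l2_prod (\<lambda>p. 0) G q = 0"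
  by (simp add: l2_prod_def)

text \<open>
  The pairing of the Laplacian with the form is the sum of the squared norms of \<open>\<partial>bar\<^sup>* F\<close> and \<open>\<partial>bar F\<close>.
\<close>

lemma laplacian_delbar_eq_0_iff:
  assumes F: "inv_field F"
  shows "(\<forall>p. cdelbar b (cdelbar_adj b F) p + cdelbar_adj b (cdelbar b F) p = 0) \<longleftrightarrow> harm_delbar b F"
proof
  assume h: "\<forall>p. cdelbar b (cdelbar_adj b F) p + cdelbar_adj b (cdelbar b F) p = 0"
  note g = inv_field_cdel inv_field_cdel_adj F
  have "(\<Sum>G\<leftarrow>[cdelbar_adj b F, cdelbar b F]. l2_prod G G q) = l2_prod (\<lambda>p. cdelbar b (cdelbar_adj b F) p + cdelbar_adj b (cdelbar b F) p) F q" for q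
    by (simp add: l2_prod_add l2_prod_cdel(2) l2_prod_cdel_adj(2) g)
  also have "\<dots> q = 0" for q using h by (simp add: l2_prod_zero)
  finally have z: "(\<Sum>G\<leftarrow>[cdelbar_adj b F, cdelbar b F]. l2_prod G G q) = 0" for q .
  have "G q = 0" if "G \<in> set [cdelbar_adj b F, cdelbar b F]" for G q
    by (rule sum_l2_prod_eq_0[OF _ z that]) (auto intro: g)
  from this[of "cdelbar_adj b F"] this[of "cdelbar b F"] have "cdelbar_adj b F q = 0" "cdelbar b F q = 0" for q
    by (simp_all only: list.set insert_iff simp_thms)
  then show "harm_delbar b F" by (simp only: harm_delbar_def simp_thms)
next
  assume h: "harm_delbar b F"
  then show "\<forall>p. cdelbar b (cdelbar_adj b F) p + cdelbar_adj b (cdelbar b F) p = 0"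
    by (simp add: harm_delbar_def operator_zero)
qed

text \<open>
  Here the pairing is a sum of six squared norms, one for each term of the Bott-Chern Laplacian. The first, fifth and
  sixth of them are the conditions of \<open>harm_BC\<close>, and these make all six terms vanish.
\<close>

lemma laplacian_BC_eq_0_iff:
  assumes F: "inv_field F"
  shows "(\<forall>p. cdel b (cdelbar b (cdelbar_adj b (cdel_adj b F))) p + cdelbar_adj b (cdel_adj b (cdel b (cdelbar b F))) p +
      cdel_adj b (cdelbar b (cdelbar_adj b (cdel b F))) p + cdelbar_adj b (cdel b (cdel_adj b (cdelbar b F))) p +
      cdel_adj b (cdel b F) p + cdelbar_adj b (cdelbar b F) p = 0) \<longleftrightarrow> harm_BC b F" (is "(\<forall>p. ?L p = 0) \<longleftrightarrow> _")
proof
  assume h: "\<forall>p. ?L p = 0"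
  note g = inv_field_cdel inv_field_cdel_adj inv_field_add F
  let ?Gs = "[cdelbar_adj b (cdel_adj b F), cdel b (cdelbar b F), cdelbar_adj b (cdel b F), cdel_adj b (cdelbar b F), cdel b F, cdelbar b F]"
  have 1: "l2_prod (cdel b (cdelbar b (cdelbar_adj b (cdel_adj b F)))) F q = l2_prod (cdelbar_adj b (cdel_adj b F)) (cdelbar_adj b (cdel_adj b F)) q" for q
    by (simp add: l2_prod_cdel g)
  have 2: "l2_prod (cdelbar_adj b (cdel_adj b (cdel b (cdelbar b F)))) F q = l2_prod (cdel b (cdelbar b F)) (cdel b (cdelbar b F)) q" for q
    by (simp only: l2_prod_cdel_adj g)
  have 3: "l2_prod (cdel_adj b (cdelbar b (cdelbar_adj b (cdel b F)))) F q = l2_prod (cdelbar_adj b (cdel b F)) (cdelbar_adj b (cdel b F)) q" for q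
    using l2_prod_cdel_adj(1)[OF _ F, of "cdelbar b (cdelbar_adj b (cdel b F))"] l2_prod_cdel(2)[of "cdelbar_adj b (cdel b F)" "cdel b F"] by (simp add: g)
  have 4: "l2_prod (cdelbar_adj b (cdel b (cdel_adj b (cdelbar b F)))) F q = l2_prod (cdel_adj b (cdelbar b F)) (cdel_adj b (cdelbar b F)) q" for q
    using l2_prod_cdel_adj(2)[OF _ F, of "cdel b (cdel_adj b (cdelbar b F))"] l2_prod_cdel(1)[of "cdel_adj b (cdelbar b F)" "cdelbar b F"] by (simp add: g)
  have 5: "l2_prod (cdel_adj b (cdel b F)) F q = l2_prod (cdel b F) (cdel b F) q" "l2_prod (cdelbar_adj b (cdelbar b F)) F q = l2_prod (cdelbar b F) (cdelbar b F) q" for q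
    by (simp_all only: l2_prod_cdel_adj g)
  have "(\<Sum>G\<leftarrow>?Gs. l2_prod G G q) = l2_prod ?L F q" for q
    by (simp only: l2_prod_add g 1 2 3 4 5) simp
  also have "\<dots> q = 0" for q using h by (simp add: l2_prod_zero)
  finally have z: "(\<Sum>G\<leftarrow>?Gs. l2_prod G G q) = 0" for q .
  have "G q = 0" if "G \<in> set ?Gs" for G q
    by (rule sum_l2_prod_eq_0[OF _ z that]) (auto intro: g)
  from this[of "cdel b F"] this[of "cdelbar b F"] this[of "cdelbar_adj b (cdel_adj b F)"]
  have "cdel b F q = 0" "cdelbar b F q = 0" "cdelbar_adj b (cdel_adj b F) q = 0" for q
    by (simp_all only: list.set insert_iff simp_thms)
  then show "harm_BC b F" by (simp only: harm_BC_def simp_thms)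
next
  assume "harm_BC b F"
  then show "\<forall>p. ?L p = 0"
    by (simp add: harm_BC_def operator_zero)
qed

section \<open>The harmonic spaces on coefficients\<close>

text \<open>
  A coefficient is an iterated contraction with frame vectors, so a combination of values at constant vectors
  with factors that are polynomials in x.
\<close>

lemma smooth_coefficients:
  assumes b: "b \<noteq> 0" and s: "\<And>vs. smooth (\<lambda>p. form b p (F p) vs)"
  shows "smooth (\<lambda>p. F p s t u v)"
proof -
  have interior: "smooth (\<lambda>p. form b p (interior j (G p)) vs)" if "\<And>vs. smooth (\<lambda>p. form b p (G p) vs)" for j G vs
  proof -
    note h = that[of "axis k 1 # vs" for k]
    have c: "smooth (\<lambda>p. 1/2 * (form b p (G p) (axis k 1 # vs) + c * form b p (G p) (axis l 1 # vs)))"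
      "smooth (\<lambda>p. 1/2 * (form b p (G p) (axis k 1 # vs) + of_real (p $ 2) * form b p (G p) (axis l 1 # vs) + c * form b p (G p) (axis l 1 # vs)))" for c k l
      by (intro smooth_mult smooth_add smooth_const smooth_coord h)+
    show ?thesis
      using c(1)[of 1 "- \<i>" 2] c(1)[of 1 "\<i>" 2] c(2)[of 3 4 "\<i> / of_real b"] c(2)[of 3 4 "- \<i> / of_real b"]
      by (cases j) (simp_all add: form_interior[OF b] del: form.simps)
  qed
  have opt: "smooth (\<lambda>p. form b p (opt_interior r j (G p)) vs)" if "\<And>vs. smooth (\<lambda>p. form b p (G p) vs)" for r j G vs
    using that interior[of G j, OF that] by (cases r) (simp_all add: opt_interior_def)
  have "smooth (\<lambda>p. form b p (opt_interior v Q2 (opt_interior u Q1 (opt_interior t P2 (opt_interior s P1 (F p))))) [])"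
    by (intro opt s)
  then show ?thesis by (simp only: form.simps coeff_eq_opt_interior[of "F _" s t u v, symmetric])
qed

lemma smooth_coframe: "smooth (\<lambda>p. coframe b p j v)"
proof -
  have "smooth (\<lambda>p::real^4. of_real (v $ 3) + c * (of_real (v $ 4) + (- of_real (v $ 3)) * of_real (p $ 2)))" for c
    by (intro smooth_mult smooth_add smooth_const smooth_coord)
  from this[of "- (\<i> * of_real b)"] this[of "\<i> * of_real b"]
  show ?thesis by (cases j) (simp_all add: coframe.simps smooth_const mult.commute)
qed

lemma smooth_form_of_coeffs: "(\<And>s t u v. smooth (\<lambda>p. F p s t u v)) \<Longrightarrow> smooth (\<lambda>p. form b p (F p) vs)"
proof (induction vs arbitrary: F)
  case (Cons v vs)
  have interior: "smooth (\<lambda>p. interior j (F p) s t u w)" for j s t u w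
    using Cons.prems smooth_mult[OF smooth_const[of "-1"] Cons.prems]
    by (cases j; cases s; cases t; cases u; cases w; simp add: interior.simps smooth_const)
  have "smooth (\<lambda>p. contract b p v (F p) s t u w)" for s t u w
    unfolding contract_def sum_frame plus_fun_apply scale_apply
    by (intro smooth_add smooth_mult smooth_coframe interior)
  from Cons.IH[OF this] show ?case by simp
qed simp

lemma form_deck:
  "form b (kt_deck t0 x0 y0 z0 p) G (map (\<lambda>v. vector [v $ 1, v $ 2, v $ 3, v $ 4 + of_int x0 * v $ 3]) vs) = form b p G vs"
proof (induction vs arbitrary: G)
  case (Cons v vs)
  have "coframe b (kt_deck t0 x0 y0 z0 p) j (vector [v $ 1, v $ 2, v $ 3, v $ 4 + of_int x0 * v $ 3]) = coframe b p j v" for j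
    by (cases j) (simp_all add: coframe.simps vector_4_nth kt_deck_def algebra_simps)
  then show ?case by (simp add: Cons.IH contract_def)
qed simp

text \<open>
  The coframe is invariant, so a form descends iff its coefficients do.
\<close>

lemma kt_invariant_form:
  assumes b: "b \<noteq> 0"
  shows "kt_invariant (\<lambda>p. form b p (F p)) \<longleftrightarrow> invariant F"
proof -
  let ?L = "\<lambda>x0 v::real^4. vector [v $ 1, v $ 2, v $ 3, v $ 4 + real_of_int x0 * v $ 3] :: real^4"
  have "pullback (kt_deck t0 x0 y0 z0) (\<lambda>p. form b p (F p)) = (\<lambda>p. form b p (F (kt_deck t0 x0 y0 z0 p)))" for t0 x0 y0 z0
    by (intro HOL.ext) (simp add: pullback_def kt_deck_derivative form_deck)
  then have "kt_invariant (\<lambda>p. form b p (F p)) \<longleftrightarrow>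
     (\<forall>t0 x0 y0 z0 p. form b p (F (kt_deck t0 x0 y0 z0 p)) = form b p (F p))"
    by (simp add: kt_invariant_def fun_eq_iff)
  then show ?thesis by (simp add: form_inject[OF b] invariant_def)
qed

lemma invariant_entries: "invariant F \<longleftrightarrow> (\<forall>s t u v. invariant (\<lambda>p. F p s t u v))" for F :: field
  by (auto simp: invariant_def fun_eq_iff)

text \<open>
  The coefficients of the forms of bidegree \<open>(r,s)\<close> on the quotient.
\<close>

definition pure_field :: "nat \<Rightarrow> nat \<Rightarrow> field \<Rightarrow> bool" where
  "pure_field r s F \<longleftrightarrow> inv_field F \<and> (\<forall>p. bideg r s (F p) = F p)"

lemma kt_forms_eq:
  assumes b: "b \<noteq> 0"
  shows "kt_forms (kt_J b) r s = {\<lambda>p. form b p (F p) | F. pure_field r s F}"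
proof (intro equalityI subsetI)
  fix \<alpha> assume "\<alpha> \<in> kt_forms (kt_J b) r s"
  then have \<alpha>: "\<And>vs. smooth (\<lambda>p. \<alpha> p vs)" "kt_invariant \<alpha>" "\<And>x. bitype (kt_J b x) r s (\<alpha> x)"
    by (auto simp: kt_forms_def smooth_form_def smooth_def)
  from \<alpha>(3) have "\<forall>p. \<exists>G. \<alpha> p = form b p (bideg r s G)" using bitype_imp_form[OF b] by blast
  then obtain G where G: "\<And>p. \<alpha> p = form b p (bideg r s (G p))" by metis
  define F where "F p = bideg r s (G p)" for p
  have a: "\<alpha> = (\<lambda>p. form b p (F p))" by (rule ext) (simp add: G F_def)
  have "invariant F" using \<alpha>(2) by (simp only: a kt_invariant_form[OF b])
  moreover have "smooth (\<lambda>p. F p s t u v)" for s t u v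
    by (rule smooth_coefficients[OF b]) (use \<alpha>(1) a in simp)
  ultimately have "pure_field r s F"
    by (auto simp: pure_field_def inv_smooth_def invariant_entries F_def bideg_bideg intro!: inv_fieldI)
  with a show "\<alpha> \<in> {\<lambda>p. form b p (F p) | F. pure_field r s F}" by blast
next
  fix \<alpha> assume "\<alpha> \<in> {\<lambda>p. form b p (F p) | F. pure_field r s F}"
  then obtain F where a: "\<alpha> = (\<lambda>p. form b p (F p))" and F: "inv_field F" "\<And>p. bideg r s (F p) = F p"
    by (auto simp: pure_field_def)
  have "invariant F"
    using inv_fieldD[OF F(1)] by (simp add: invariant_entries inv_smooth_def)
  moreover have "smooth (\<lambda>p. form b p (F p) vs)" for vs
    by (intro smooth_form_of_coeffs inv_smooth_smooth inv_fieldD F)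
  moreover have "bitype (kt_J b p) r s (form b p (F p))" for p
    using F(2) by (simp add: bitype_iff_form[OF b])
  ultimately show "\<alpha> \<in> kt_forms (kt_J b) r s"
    by (simp add: a kt_forms_def smooth_form_def smooth_def kt_invariant_form[OF b])
qed

lemma form_field_eq_0:
  assumes "b \<noteq> 0"
  shows "(\<lambda>p. form b p (F p)) = 0 \<longleftrightarrow> (\<forall>p. F p = 0)"
  using form_inject[OF assms, of _ "F _" 0] by (auto simp: fun_eq_iff[of _ "0::dform"])

lemma harmonic_delbar_eq:
  assumes b: "b \<noteq> 0"
  shows "harmonic_delbar (kt_J b) (kt_omega b) r s = {\<lambda>p. form b p (F p) | F. pure_field r s F \<and> harm_delbar b F}"
proof -
  have "laplacian_delbar (kt_J b) (kt_omega b) (\<lambda>p. form b p (F p)) = 0 \<longleftrightarrow> harm_delbar b F" if "pure_field r s F" for F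
    using that by (simp only: laplacian_delbar_form[OF b] form_field_eq_0[OF b] laplacian_delbar_eq_0_iff pure_field_def)
  then show ?thesis unfolding harmonic_delbar_def kt_forms_eq[OF b] by blast
qed

lemma harmonic_BC_eq:
  assumes b: "b \<noteq> 0"
  shows "harmonic_BC (kt_J b) (kt_omega b) r s = {\<lambda>p. form b p (F p) | F. pure_field r s F \<and> harm_BC b F}"
proof -
  have "laplacian_BC (kt_J b) (kt_omega b) (\<lambda>p. form b p (F p)) = 0 \<longleftrightarrow> harm_BC b F" if "pure_field r s F" for F
    using that by (simp only: laplacian_BC_form[OF b] form_field_eq_0[OF b] laplacian_BC_eq_0_iff pure_field_def)
  then show ?thesis unfolding harmonic_BC_def kt_forms_eq[OF b] by blast
qed

lemma harmonic_eqI: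
  assumes "b \<noteq> 0"
    "\<And>F. pure_field r s F \<Longrightarrow> harm_BC b F \<longleftrightarrow> harm_delbar b F"
  shows "harmonic_BC (kt_J b) (kt_omega b) r s = harmonic_delbar (kt_J b) (kt_omega b) r s"
  unfolding harmonic_BC_eq[OF assms(1)] harmonic_delbar_eq[OF assms(1)] using assms(2) by blast

lemma harmonic_neqI:
  assumes b: "b \<noteq> 0" and F: "pure_field r s F" and n: "harm_BC b F \<longleftrightarrow> \<not> harm_delbar b F"
  shows "harmonic_BC (kt_J b) (kt_omega b) r s \<noteq> harmonic_delbar (kt_J b) (kt_omega b) r s"
proof -
  have inj: "(\<lambda>p. form b p (F p)) = (\<lambda>p. form b p (G p)) \<longleftrightarrow> F = G" for G
    using form_inject[OF b] by (metis ext)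
  have "(\<lambda>p. form b p (F p)) \<in> harmonic_BC (kt_J b) (kt_omega b) r s \<longleftrightarrow> harm_BC b F"
    "(\<lambda>p. form b p (F p)) \<in> harmonic_delbar (kt_J b) (kt_omega b) r s \<longleftrightarrow> harm_delbar b F"
    unfolding harmonic_BC_eq[OF b] harmonic_delbar_eq[OF b] using F by (auto simp: inj)
  then show ?thesis using n by auto
qed

section \<open>Scalar equations on the quotient\<close>

lemma mean_norm_fderiv:
  assumes f: "inv_smooth f"
  shows "mean (\<lambda>q. complex_of_real ((cmod (fderiv b (bar j) f q))\<^sup>2)) q = - mean (\<lambda>q. f q * cnj (fderiv b j (fderiv b (bar j) f) q)) q"
  using mean_by_parts[OF f inv_smooth_fderiv[OF f, of b "bar j"], of b "bar j" q]
  by (simp add: complex_norm_square del: of_real_power)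

text \<open>
  The pairing of \<open>V V' f + W W' f\<close> with f is minus the integral of the sum of the squares of \<open>V' f\<close> and \<open>W' f\<close>, where a prime
  denotes the conjugate field. Taking both fields equal gives the statement for a single one.
\<close>

lemma fderiv_fderiv_sum_eq_0:
  assumes f: "inv_smooth f" and z: "\<And>q. fderiv b j (fderiv b (bar j) f) q + fderiv b k (fderiv b (bar k) f) q = 0"
  shows "fderiv b (bar j) f q = 0" "fderiv b (bar k) f q = 0"
proof -
  let ?h = "\<lambda>q. (cmod (fderiv b (bar j) f q))\<^sup>2 + (cmod (fderiv b (bar k) f q))\<^sup>2"
  have c: "continuous_on UNIV (fderiv b i f)" for i by (intro inv_smooth_continuous inv_smooth_fderiv f)
  have "mean (\<lambda>q. complex_of_real (?h q)) q = mean (\<lambda>q. complex_of_real ((cmod (fderiv b (bar j) f q))\<^sup>2)) q +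
      mean (\<lambda>q. complex_of_real ((cmod (fderiv b (bar k) f q))\<^sup>2)) q"
    unfolding of_real_add by (subst mean_add) (auto intro!: continuous_intros c)
  also have "\<dots> = - (mean (\<lambda>q. f q * cnj (fderiv b j (fderiv b (bar j) f) q)) q + mean (\<lambda>q. f q * cnj (fderiv b k (fderiv b (bar k) f) q)) q)"
    by (simp add: mean_norm_fderiv[OF f] del: of_real_power)
  also have "mean (\<lambda>q. f q * cnj (fderiv b j (fderiv b (bar j) f) q)) q + mean (\<lambda>q. f q * cnj (fderiv b k (fderiv b (bar k) f) q)) q =
     mean (\<lambda>q. f q * cnj (fderiv b j (fderiv b (bar j) f) q) + f q * cnj (fderiv b k (fderiv b (bar k) f) q)) q"
    by (simp add: mean_add inv_smooth_continuous inv_smooth_mult inv_smooth_cnj inv_smooth_fderiv f)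
  also have "\<dots> = mean (\<lambda>q. f q * cnj (fderiv b j (fderiv b (bar j) f) q + fderiv b k (fderiv b (bar k) f) q)) q"
    by (simp add: algebra_simps)
  also have "\<dots> = 0" by (simp only: z) simp
  finally have "mean (\<lambda>q. complex_of_real (?h q)) q = 0" by simp
  then have "?h q = 0"
    by (intro mean_nonneg_eq_0) (auto intro!: continuous_intros c)
  then show "fderiv b (bar j) f q = 0" "fderiv b (bar k) f q = 0"
    by (simp_all add: add_nonneg_eq_0_iff)
qed

text \<open>
  Each frame field commutes with its conjugate, so \<open>V f = 0\<close> implies \<open>V V' f = 0\<close>.
\<close>

lemma fderiv_eq_0_bar:
  assumes f: "inv_smooth f" and b: "b \<noteq> 0" and z: "\<And>q. fderiv b j f q = 0"
  shows "fderiv b (bar j) f q = 0"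
proof -
  have "fderiv b j f = (\<lambda>q. 0)" using z by (rule ext)
  then have "fderiv b (bar j) (fderiv b j f) = (\<lambda>q. 0)" by simp
  then have "fderiv b j (fderiv b (bar j) f) q = 0" for q
    using fderiv_commute(1,2)[OF inv_smooth_smooth[OF f] b] by (cases j) simp_all
  then show ?thesis by (intro fderiv_fderiv_sum_eq_0(1)[OF f, of b j j]) simp
qed

section \<open>Vanishing for reasons of bidegree\<close>

lemma pure_inv_field: "pure_field r s F \<Longrightarrow> inv_field F"
  by (simp add: pure_field_def)

lemma pure_coeff_inv_smooth: "pure_field r s F \<Longrightarrow> inv_smooth (coeff F a b c d)"
  by (simp add: pure_field_def inv_field_def)

lemma pure_coeff_zero:
  assumes "pure_field r s F" "\<not> (of_bool a + of_bool b = r \<and> of_bool c + of_bool d = s)"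
  shows "coeff F a b c d = (\<lambda>p. 0)"
proof
  fix p
  have "F p a b c d = bideg r s (F p) a b c d" using assms(1) by (simp add: pure_field_def)
  then show "coeff F a b c d p = 0" using assms(2) by (auto simp: bideg_def coeff_def)
qed

lemma pure_fderiv_ext: "pure_field r s F \<Longrightarrow> bideg r s (fderiv_ext b j F p) = fderiv_ext b j F p"
  using fderiv_ext_bideg[of F b j r s p] by (simp add: pure_field_def inv_field_diff_field)

lemma bideg_vanish:
  "interior P1 (bideg 0 s F) = 0"
    "interior P2 (bideg 0 s F) = 0"
    "interior Q1 (bideg r 0 F) = 0"
    "interior Q2 (bideg r 0 F) = 0"
  "exterior P1 (bideg 2 s F) = 0"
    "exterior P2 (bideg 2 s F) = 0"
    "exterior Q1 (bideg r 2 F) = 0"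
    "exterior Q2 (bideg r 2 F) = 0"
  "torsion_adj (bideg 0 s F) = 0"
    "torsion_bar_adj (bideg r 0 F) = 0"
    "torsion (bideg 2 s F) = 0"
    "torsion_bar (bideg r 2 F) = 0"
  by (rule ext_eqI, auto simp: bideg_def interior.simps exterior.simps torsion_def torsion_bar_def torsion_adj_def torsion_bar_adj_def)+

lemma pure_vanish:
  "pure_field 0 s F \<Longrightarrow> cdel_adj b F p = 0" "pure_field r 0 F \<Longrightarrow> cdelbar_adj b F p = 0"
  "pure_field 2 s F \<Longrightarrow> cdel b F p = 0" "pure_field r 2 F \<Longrightarrow> cdelbar b F p = 0"
proof -
  show "cdel_adj b F p = 0" if F: "pure_field 0 s F"
    using bideg_vanish(1)[of s "fderiv_ext b Q1 F p"] bideg_vanish(2)[of s "fderiv_ext b Q2 F p"] bideg_vanish(9)[of s "F p"] F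
    by (simp add: cdel_adj_def pure_fderiv_ext[OF F] pure_field_def)
  show "cdelbar_adj b F p = 0" if F: "pure_field r 0 F"
    using bideg_vanish(3)[of r "fderiv_ext b P1 F p"] bideg_vanish(4)[of r "fderiv_ext b P2 F p"] bideg_vanish(10)[of r "F p"] F
    by (simp add: cdelbar_adj_def pure_fderiv_ext[OF F] pure_field_def)
  show "cdel b F p = 0" if F: "pure_field 2 s F"
    using bideg_vanish(5)[of s "fderiv_ext b P1 F p"] bideg_vanish(6)[of s "fderiv_ext b P2 F p"] bideg_vanish(11)[of s "F p"] F
    by (simp add: cdel_def pure_fderiv_ext[OF F] pure_field_def)
  show "cdelbar b F p = 0" if F: "pure_field r 2 F"
    using bideg_vanish(7)[of r "fderiv_ext b Q1 F p"] bideg_vanish(8)[of r "fderiv_ext b Q2 F p"] bideg_vanish(12)[of r "F p"] F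
    by (simp add: cdelbar_def pure_fderiv_ext[OF F] pure_field_def)
qed

lemma bideg_interior:
  "bideg r s (interior P1 F) = interior P1 (bideg (Suc r) s F)"
    "bideg r s (interior P2 F) = interior P2 (bideg (Suc r) s F)"
  "bideg r s (torsion_adj F) = torsion_adj (bideg (Suc r) s F)"
  by (rule ext_eqI, auto simp: bideg_def interior.simps exterior.simps torsion_adj_def)+

lemma pure_cdel_adj:
  assumes F: "pure_field (Suc r) s F"
  shows "pure_field r s (cdel_adj b F)"
proof -
  have m: "bideg r s (- G) = - bideg r s G" for G
    using bideg_scale[of r s "-1" G] by (simp add: scale_minus_one)
  have "bideg (Suc r) s (F p) = F p" for p using F by (simp add: pure_field_def)
  then have "bideg r s (cdel_adj b F p) = cdel_adj b F p" for p
    by (simp add: cdel_adj_def bideg_add bideg_minus m bideg_scale bideg_interior pure_fderiv_ext[OF F])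
  then show ?thesis using F by (simp add: pure_field_def inv_field_cdel_adj)
qed

lemma ext_eq_0_iff: "(F :: ext) = 0 \<longleftrightarrow> (\<forall>a b c d. F a b c d = 0)"
  by (auto intro: ext_eqI)

lemma coeff_apply: "F p a b c d = coeff F a b c d p"
  by (simp add: coeff_def)

lemmas operator_entries = cdel_def cdelbar_def cdel_adj_def cdelbar_adj_def torsion_def torsion_bar_def torsion_adj_def torsion_bar_adj_def
  exterior.simps interior.simps fderiv_ext_def

section \<open>Bidegrees with equal harmonic spaces\<close>

text \<open>
  Both systems say that the function is constant.
\<close>

lemma harm_iff_00:
  assumes b: "b \<noteq> 0" and F: "pure_field 0 0 F"
  shows "harm_BC b F \<longleftrightarrow> harm_delbar b F"
proof -
  note z = pure_coeff_zero[OF F]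
  have "cdel b F p = 0" if h: "\<And>p. cdelbar b F p = 0" for p
  proof -
    let ?f = "coeff F False False False False"
    have "cdelbar b F q False False True False = 0" "cdelbar b F q False False False True = 0" for q
      by (simp_all add: h)
    then have "fderiv b Q1 ?f q = 0" "fderiv b Q2 ?f q = 0" for q
      by (simp_all add: operator_entries coeff_apply[of F] z)
    then have "fderiv b P1 ?f q = 0" "fderiv b P2 ?f q = 0" for q
      using fderiv_eq_0_bar[OF pure_coeff_inv_smooth[OF F] b, of Q1] fderiv_eq_0_bar[OF pure_coeff_inv_smooth[OF F] b, of Q2]
      by auto
    then show ?thesis
      by (simp add: ext_eq_0_iff all_bool_eq operator_entries coeff_apply[of F] z)
  qed
  then show ?thesis
    using pure_vanish(1,2)[OF F] by (auto simp: harm_BC_def harm_delbar_def operator_zero)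
qed

text \<open>
  Let \<open>\<alpha> = f \<phi>1 + g \<phi>2\<close> with \<open>\<partial>bar \<alpha> = 0\<close>. Then \<open>V2' f = (b/4) g\<close> and \<open>V2 g = 0\<close>, so \<open>V2 V2' f = 0\<close>, whence \<open>V2' f = 0\<close> and, as
  \<open>b \<noteq> 0\<close>, also \<open>g = 0\<close>. Then f is constant, and \<open>\<partial> \<alpha> = 0\<close>.
\<close>

lemma harm_iff_10:
  assumes b: "b \<noteq> 0" and F: "pure_field 1 0 F"
  shows "harm_BC b F \<longleftrightarrow> harm_delbar b F"
proof -
  note z = pure_coeff_zero[OF F]
  have "cdel b F p = 0" if h: "\<And>p. cdelbar b F p = 0" for p
  proof -
    let ?f = "coeff F True False False False" and ?g = "coeff F False True False False"
    have fg: "inv_smooth ?f" "inv_smooth ?g" by (rule pure_coeff_inv_smooth[OF F])+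
    have "cdelbar b F q True False True False = 0" "cdelbar b F q True False False True = 0"
      "cdelbar b F q False True True False = 0" "cdelbar b F q False True False True = 0" for q
      by (simp_all add: h)
    then have e: "fderiv b Q1 ?f q = 0" "fderiv b Q2 ?f q = of_real b / 4 * ?g q"
       "fderiv b Q1 ?g q = of_real b / 4 * ?g q" "fderiv b Q2 ?g q = 0" for q
      by (simp_all add: operator_entries coeff_apply[of F] z algebra_simps)
    have g2: "fderiv b P2 ?g q = 0" for q
      using fderiv_eq_0_bar[OF fg(2) b, of Q2] e(4) by simp
    have "fderiv b Q2 ?f = (\<lambda>q. of_real b / 4 * ?g q)" using e(2) by (rule ext)
    then have "fderiv b P2 (fderiv b Q2 ?f) q = 0" for q
      by (simp only: fderiv_cmult[OF inv_smooth_smooth[OF fg(2)], of b P2 "of_real b / 4"] g2) simp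
    then have f2: "fderiv b Q2 ?f q = 0" for q
      using fderiv_fderiv_sum_eq_0(1)[OF fg(1), of b P2 P2 q] by simp
    then have g: "?g q = 0" for q using e(2)[of q] b by simp
    then have g0: "?g = (\<lambda>q. 0)" by (rule ext)
    have "fderiv b P1 ?f q = 0" "fderiv b P2 ?f q = 0" for q
      using fderiv_eq_0_bar[OF fg(1) b, of Q1] fderiv_eq_0_bar[OF fg(1) b, of Q2] e(1) f2 by auto
    then show ?thesis
      by (simp add: ext_eq_0_iff all_bool_eq operator_entries coeff_apply[of F] z g0)
  qed
  moreover have "pure_field 0 0 (cdel_adj b F)" using pure_cdel_adj[of 0 0 F b] F by simp
  ultimately show ?thesis
    using pure_vanish(2)[OF F] pure_vanish(2)[of 0 "cdel_adj b F"] by (auto simp: harm_BC_def harm_delbar_def)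
qed

text \<open>
  Both systems reduce to \<open>\<partial>bar \<alpha> = 0\<close>.
\<close>

lemma harm_iff_20:
  assumes F: "pure_field 2 0 F"
  shows "harm_BC b F \<longleftrightarrow> harm_delbar b F"
proof -
  have "pure_field 1 0 (cdel_adj b F)" using pure_cdel_adj[of 1 0 F b] F by (simp add: numeral_2_eq_2)
  then show ?thesis
    using pure_vanish(2,3)[OF F] pure_vanish(2)[of 1 "cdel_adj b F"] by (auto simp: harm_BC_def harm_delbar_def)
qed

text \<open>
  The star is a multiple of the identity in this bidegree, so \<open>\<partial>bar\<^sup>* = - * \<partial> *\<close> and \<open>\<partial>\<close> have the same kernel.
\<close>

lemma harm_iff_02:
  assumes F: "pure_field 0 2 F"
  shows "harm_BC b F \<longleftrightarrow> harm_delbar b F"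
proof -
  note z = pure_coeff_zero[OF F]
  have "cdel b F p = 0 \<longleftrightarrow> cdelbar_adj b F p = 0" for p
    by (auto simp add: ext_eq_0_iff all_bool_eq operator_entries coeff_apply[of F] z)
  then show ?thesis
    using pure_vanish(1,4)[OF F] by (auto simp: harm_BC_def harm_delbar_def operator_zero)
qed

text \<open>
  For \<open>f \<phi>1 \<and> \<phi>2 \<and> cnj \<phi>1 \<and> cnj \<phi>2\<close> the coefficients of \<open>\<partial>bar\<^sup>* \<partial>\<^sup>* \<alpha>\<close> include \<open>V1 V1' f\<close> and \<open>V2 V2' f\<close> up to sign, so both systems say that
  f is constant.
\<close>

lemma harm_iff_22:
  assumes b: "b \<noteq> 0" and F: "pure_field 2 2 F"
  shows "harm_BC b F \<longleftrightarrow> harm_delbar b F"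
proof -
  note z = pure_coeff_zero[OF F]
  let ?f = "coeff F True True True True"
  have fg: "inv_smooth ?f" by (rule pure_coeff_inv_smooth[OF F])
  have d: "cdel_adj b F p = 0" "cdelbar_adj b F p = 0" if "\<And>q. fderiv b P1 ?f q = 0" "\<And>q. fderiv b P2 ?f q = 0" for p
    using that fderiv_eq_0_bar[OF fg b, of P1] fderiv_eq_0_bar[OF fg b, of P2]
    by (simp_all add: ext_eq_0_iff all_bool_eq operator_entries coeff_apply[of F] z)
  have 1: "cdel_adj b F p = 0" if h: "\<And>p. cdelbar_adj b F p = 0" for p
  proof (rule d(1))
    have "cdelbar_adj b F q True True False True = 0" "cdelbar_adj b F q True True True False = 0" for q
      by (simp_all add: h)
    then show "fderiv b P1 ?f q = 0" "fderiv b P2 ?f q = 0" for q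
      by (simp_all add: operator_entries coeff_apply[of F] z)
  qed
  have 2: "cdelbar_adj b F p = 0" if h: "\<And>p. cdelbar_adj b (cdel_adj b F) p = 0" for p
  proof -
    have "pure_field 1 2 (cdel_adj b F)" using pure_cdel_adj[of 1 2 F b] F by (simp only: Suc_1)
    note z' = pure_coeff_zero[OF this]
    have e: "coeff (cdel_adj b F) False True True True = (\<lambda>q. - 1 * fderiv b Q1 ?f q)"
      "coeff (cdel_adj b F) True False True True = fderiv b Q2 ?f"
      by (simp_all add: fun_eq_iff coeff_def[of "cdel_adj b F"]) (simp_all add: operator_entries coeff_apply[of F] z)
    have "cdelbar_adj b (cdel_adj b F) q False True False True = 0" "cdelbar_adj b (cdel_adj b F) q True False True False = 0" for q
      by (simp_all add: h)
    then have "fderiv b P1 (fderiv b Q1 ?f) q = 0" "fderiv b P2 (fderiv b Q2 ?f) q = 0" for q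
      unfolding cdelbar_adj_def[of b "cdel_adj b F"]
      by (simp_all add: torsion_bar_adj_def exterior.simps interior.simps fderiv_ext_def coeff_apply[of "cdel_adj b F"] e z'
        fderiv_cmult[OF inv_smooth_smooth[OF inv_smooth_fderiv[OF fg]], where c = "-1", simplified])
    then have "fderiv b Q1 ?f q = 0" "fderiv b Q2 ?f q = 0" for q
      using fderiv_fderiv_sum_eq_0(1)[OF fg, of b P1 P1 q] fderiv_fderiv_sum_eq_0(1)[OF fg, of b P2 P2 q] by auto
    then have "fderiv b P1 ?f q = 0" "fderiv b P2 ?f q = 0" for q
      using fderiv_eq_0_bar[OF fg b, of Q1] fderiv_eq_0_bar[OF fg b, of Q2] by auto
    then show ?thesis by (rule d(2))
  qed
  show ?thesis
    using 1 2 pure_vanish(3,4)[OF F] by (auto simp: harm_BC_def harm_delbar_def operator_zero)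
qed

text \<open>
  The form \<open>f (\<phi>1 \<and> cnj \<phi>1 + \<phi>2 \<and> cnj \<phi>2)\<close>, a multiple of \<open>f \<omega>\<close>.
\<close>

definition trace_field :: "(real^4 \<Rightarrow> complex) \<Rightarrow> field" where
  "trace_field f = (\<lambda>p a b c d. if (a \<noteq> b) \<and> a = c \<and> b = d then f p else 0)"

lemma trace_field_coeff: "coeff (trace_field f) a b c d = (if (a \<noteq> b) \<and> a = c \<and> b = d then f else (\<lambda>p. 0))"
  by (auto simp: coeff_def trace_field_def)

text \<open>
  No zeroth-order terms appear, because \<open>\<omega>\<close> is closed.
\<close>

lemma cdel_trace_field:
  "coeff (cdel b (trace_field f)) a' b' c' d' =
     (\<lambda>p. if a' \<and> b' \<and> c' \<noteq> d' then (if c' then - 1 * fderiv b P2 f p else fderiv b P1 f p) else 0)"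
  "coeff (cdelbar b (trace_field f)) a' b' c' d' =
     (\<lambda>p. if a' \<noteq> b' \<and> c' \<and> d' then (if a' then fderiv b Q2 f p else - 1 * fderiv b Q1 f p) else 0)"
proof -
  show "coeff (cdel b (trace_field f)) a' b' c' d' =
     (\<lambda>p. if a' \<and> b' \<and> c' \<noteq> d' then (if c' then - 1 * fderiv b P2 f p else fderiv b P1 f p) else 0)"
    unfolding coeff_def[of "cdel b _"]
    by (cases a'; cases b'; cases c'; cases d'; simp add: operator_entries coeff_apply[of "trace_field f"] trace_field_coeff)
  show "coeff (cdelbar b (trace_field f)) a' b' c' d' =
     (\<lambda>p. if a' \<noteq> b' \<and> c' \<and> d' then (if a' then fderiv b Q2 f p else - 1 * fderiv b Q1 f p) else 0)"
    unfolding coeff_def[of "cdelbar b _"]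
    by (cases a'; cases b'; cases c'; cases d'; simp add: operator_entries coeff_apply[of "trace_field f"] trace_field_coeff)
qed

lemma cdelbar_cdel_trace_field:
  assumes f: "smooth f"
  shows "cdelbar b (cdel b (trace_field f)) p True True True True = fderiv b Q1 (fderiv b P1 f) p + fderiv b Q2 (fderiv b P2 f) p"
    "cdel b (cdelbar b (trace_field f)) p True True True True = - (fderiv b P1 (fderiv b Q1 f) p + fderiv b P2 (fderiv b Q2 f) p)"
  unfolding cdelbar_def[of b "cdel b _"] cdel_def[of b "cdelbar b _"]
  using fderiv_cmult[OF smooth_fderiv[OF f], where c = "-1"]
  by (simp_all add: torsion_def torsion_bar_def exterior.simps interior.simps fderiv_ext_def coeff_apply[of "cdel b _"] coeff_apply[of "cdelbar b _"] cdel_trace_field)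

lemma trace_field_constant:
  assumes f: "inv_smooth f" and b: "b \<noteq> 0"
    and z: "(\<forall>p. cdelbar b (cdel b (trace_field f)) p True True True True = 0) \<or>
      (\<forall>p. cdel b (cdelbar b (trace_field f)) p True True True True = 0)"
  shows "cdel b (trace_field f) p = 0" "cdelbar b (trace_field f) p = 0"
proof -
  have "(\<forall>q. fderiv b P1 f q = 0 \<and> fderiv b P2 f q = 0) \<or> (\<forall>q. fderiv b Q1 f q = 0 \<and> fderiv b Q2 f q = 0)"
    using z fderiv_fderiv_sum_eq_0[OF f, of b Q1 Q2] fderiv_fderiv_sum_eq_0[OF f, of b P1 P2]
    by (simp add: cdelbar_cdel_trace_field[OF inv_smooth_smooth[OF f]] neg_eq_iff_add_eq_0) (metis neg_0_equal_iff_equal minus_add_distrib)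
  then have "\<forall>j q. fderiv b j f q = 0"
    using fderiv_eq_0_bar[OF f b, of P1] fderiv_eq_0_bar[OF f b, of P2] fderiv_eq_0_bar[OF f b, of Q1] fderiv_eq_0_bar[OF f b, of Q2]
    by (metis bar.simps frame.exhaust)
  then show "cdel b (trace_field f) p = 0" "cdelbar b (trace_field f) p = 0"
    by (simp_all add: ext_eq_0_iff coeff_apply[of "cdel b _"] coeff_apply[of "cdelbar b _"] cdel_trace_field)
qed

text \<open>
  The part of \<open>d\<^sup>2 = 0\<close> of bidegree \<open>(1,1)\<close> on \<open>(1,1)\<close>-forms, where the components of d of bidegrees \<open>(2,-1)\<close> and \<open>(-1,2)\<close>
  do not contribute.
\<close>

lemma cdel_cdelbar_anticommute_11:
  assumes b: "b \<noteq> 0" and F: "pure_field 1 1 F"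
  shows "cdelbar b (cdel b F) p True True True True = - cdel b (cdelbar b F) p True True True True"
proof -
  note z = pure_coeff_zero[OF F]
  let ?f1 = "coeff F True False True False" and ?g = "coeff F True False False True"
    and ?h = "coeff F False True True False" and ?f2 = "coeff F False True False True"
  have sm: "smooth ?f1" "smooth ?g" "smooth ?h" "smooth ?f2"
    by (intro inv_smooth_smooth pure_coeff_inv_smooth[OF F])+
  have e1: "coeff (cdel b F) True True True False =
      (\<lambda>p. (fderiv b P1 ?h p + - 1 * fderiv b P2 ?f1 p) + of_real b / 4 * (?h p + ?g p))"
    "coeff (cdel b F) True True False True = (\<lambda>p. fderiv b P1 ?f2 p + - 1 * fderiv b P2 ?g p)"
    "coeff (cdel b F) True False True True = (\<lambda>p. 0)"
    "coeff (cdel b F) False True True True = (\<lambda>p. 0)"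
    "coeff (cdel b F) True True True True = (\<lambda>p. 0)"
    unfolding coeff_def[of "cdel b _"]
    by (simp_all add: operator_entries coeff_apply[of F] z algebra_simps)
  have e2: "coeff (cdelbar b F) True False True True =
      (\<lambda>p. (fderiv b Q2 ?f1 p + - 1 * fderiv b Q1 ?g p) + - of_real b / 4 * (?h p + ?g p))"
    "coeff (cdelbar b F) False True True True = (\<lambda>p. fderiv b Q2 ?h p + - 1 * fderiv b Q1 ?f2 p)"
    "coeff (cdelbar b F) True True True False = (\<lambda>p. 0)"
    "coeff (cdelbar b F) True True False True = (\<lambda>p. 0)"
    "coeff (cdelbar b F) True True True True = (\<lambda>p. 0)"
    unfolding coeff_def[of "cdelbar b _"]
    by (simp_all add: operator_entries coeff_apply[of F] z algebra_simps)
  note s = sm smooth_add smooth_mult smooth_const smooth_fderiv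
  have 1: "cdelbar b (cdel b F) p True True True True =
      fderiv b Q1 (coeff (cdel b F) True True False True) p - fderiv b Q2 (coeff (cdel b F) True True True False) p"
    unfolding cdelbar_def[of b "cdel b F"]
    by (simp add: torsion_bar_def exterior.simps interior.simps fderiv_ext_def coeff_apply[of "cdel b F"] e1(3-))
  have 2: "cdel b (cdelbar b F) p True True True True =
      fderiv b P1 (coeff (cdelbar b F) False True True True) p - fderiv b P2 (coeff (cdelbar b F) True False True True) p"
    unfolding cdel_def[of b "cdelbar b F"]
    by (simp add: torsion_def exterior.simps interior.simps fderiv_ext_def coeff_apply[of "cdelbar b F"] e2(3-))
  have 3: "cdelbar b (cdel b F) p True True True True =
      (fderiv b Q1 (fderiv b P1 ?f2) p + - 1 * fderiv b Q1 (fderiv b P2 ?g) p) -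
      ((fderiv b Q2 (fderiv b P1 ?h) p + - 1 * fderiv b Q2 (fderiv b P2 ?f1) p) + of_real b / 4 * (fderiv b Q2 ?h p + fderiv b Q2 ?g p))"
    unfolding 1 e1 by (simp only: fderiv_add fderiv_cmult s)
  have 4: "cdel b (cdelbar b F) p True True True True =
      (fderiv b P1 (fderiv b Q2 ?h) p + - 1 * fderiv b P1 (fderiv b Q1 ?f2) p) -
      ((fderiv b P2 (fderiv b Q2 ?f1) p + - 1 * fderiv b P2 (fderiv b Q1 ?g) p) + - of_real b / 4 * (fderiv b P2 ?h p + fderiv b P2 ?g p))"
    unfolding 2 e2 by (simp only: fderiv_add fderiv_cmult s)
  show ?thesis
    unfolding 3 4 fderiv_commute(4)[OF sm(3) b] fderiv_commute(5)[OF sm(2) b] fderiv_commute(1)[OF sm(4) b] fderiv_commute(2)[OF sm(1) b]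
    by (simp add: algebra_simps)
qed

lemma cdel_add:
  assumes F: "inv_field F" and G: "inv_field G"
  shows "cdel b (\<lambda>p. F p + G p) p = cdel b F p + cdel b G p"
    "cdelbar b (\<lambda>p. F p + G p) p = cdelbar b F p + cdelbar b G p"
proof -
  have "fderiv_ext b j (\<lambda>p. F p + G p) = (\<lambda>p. fderiv_ext b j F p + fderiv_ext b j G p)" for j
    by (intro HOL.ext) (simp add: fderiv_ext_def coeff_def fderiv_add inv_smooth_smooth inv_fieldD F G)
  then show "cdel b (\<lambda>p. F p + G p) p = cdel b F p + cdel b G p" "cdelbar b (\<lambda>p. F p + G p) p = cdelbar b F p + cdelbar b G p"
    by (simp_all add: cdel_def cdelbar_def exterior_add torsion_add scale_add add_ac)
qed

lemma star_eq_0_iff: "star F = 0 \<longleftrightarrow> F = 0"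
proof
  assume h: "star F = 0"
  have "F (\<not> c) (\<not> d) (\<not> a) (\<not> b) = 0" for a b c d
    using h[unfolded ext_eq_0_iff, rule_format, of a b c d] by (auto simp: star_def bsign_def split: if_splits)
  from this[of "\<not> _" "\<not> _" "\<not> _" "\<not> _"] show "F = 0" by (simp add: ext_eq_0_iff)
qed simp

text \<open>
  Here \<open>\<alpha> + *\<alpha>\<close> is the trace form of a function f. A Dolbeault-harmonic \<open>\<alpha>\<close> has \<open>\<partial> *\<alpha> = 0\<close>, so \<open>\<partial> (\<alpha> + *\<alpha>) = \<partial> \<alpha>\<close> is annihilated
  by \<open>\<partial>bar\<close>; a Bott-Chern-harmonic one has \<open>\<partial> \<partial>bar *\<alpha> = 0\<close>. In both cases f is constant and the trace form is closed, so that the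
  derivatives of \<open>\<alpha>\<close> and \<open>*\<alpha>\<close> agree up to sign.
\<close>

lemma harm_iff_11:
  assumes b: "b \<noteq> 0" and F: "pure_field 1 1 F"
  shows "harm_BC b F \<longleftrightarrow> harm_delbar b F"
proof -
  note z = pure_coeff_zero[OF F]
  note g = pure_inv_field[OF F]
  let ?S = "\<lambda>p. star (F p)"
  define f where "f = (\<lambda>p. coeff F True False True False p + coeff F False True False True p)"
  have f: "inv_smooth f" unfolding f_def by (intro inv_smooth_add pure_coeff_inv_smooth[OF F])
  have B: "trace_field f = (\<lambda>p. F p + ?S p)"
  proof (intro HOL.ext)
    fix p s t u v
    show "trace_field f p s t u v = (F p + ?S p) s t u v"
      by (cases s; cases t; cases u; cases v; simp add: trace_field_def star_def f_def coeff_apply[of F] z)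
  qed
  have dB: "cdel b (trace_field f) p = cdel b F p + cdel b ?S p" "cdelbar b (trace_field f) p = cdelbar b F p + cdelbar b ?S p" for p
    unfolding B by (intro cdel_add g inv_field_star)+
  have cdelbar_adj: "cdelbar_adj b F p = 0 \<longleftrightarrow> cdel b ?S p = 0" and cdel_adj: "cdel_adj b F p = 0 \<longleftrightarrow> cdelbar b ?S p = 0" for p
    using star_conjugates[OF g, of b p] star_eq_0_iff[of "cdel b ?S p"] star_eq_0_iff[of "cdelbar b ?S p"] by auto
  show ?thesis
  proof
    assume "harm_delbar b F"
    then have h: "cdelbar b F p = 0" "cdel b ?S p = 0" for p by (auto simp: harm_delbar_def cdelbar_adj)
    have "cdel b (trace_field f) = cdel b F" by (rule ext) (simp add: dB h)
    then have "cdelbar b (cdel b (trace_field f)) p True True True True = 0" for p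
      using cdel_cdelbar_anticommute_11[OF b F, of p] operator_zero(1)[of "cdelbar b F" b p, OF h(1)] by simp
    then have "cdel b (trace_field f) p = 0" "cdelbar b (trace_field f) p = 0" for p
      using trace_field_constant[OF f b] by blast+
    then have "cdel b F p = 0" "cdelbar b ?S p = 0" for p by (simp_all add: dB h)
    then show "harm_BC b F"
      using h(1) by (simp add: harm_BC_def operator_zero(4) cdel_adj)
  next
    assume "harm_BC b F"
    then have h: "cdel b F p = 0" "cdelbar b F p = 0" "cdelbar_adj b (cdel_adj b F) p = 0" for p by (auto simp: harm_BC_def)
    have dlbS: "cdelbar b ?S p = cdelbar b (trace_field f) p" for p by (simp add: dB h)
    \<comment> \<open>The star squares to \<open>- 1\<close> in degree 3.\<close>
    have star: "star (cdel_adj b F p) = cdelbar b (trace_field f) p" for p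
    proof (rule ext_eqI)
      fix s t u v
      show "star (cdel_adj b F p) s t u v = cdelbar b (trace_field f) p s t u v"
        unfolding star_conjugates(1)[OF g, symmetric] dlbS
        by (cases s; cases t; cases u; cases v; simp add: star_def coeff_apply[of "cdelbar b _"] cdel_trace_field)
    qed
    have "cdel b (cdelbar b (trace_field f)) p = 0" for p
      using star_conjugates(2)[OF inv_field_cdel_adj(1)[OF g], of b b p] h(3)[of p]
        star_eq_0_iff[of "cdel b (cdelbar b (trace_field f)) p"] by (simp add: star)
    then have "cdel b (trace_field f) p = 0" for p
      using trace_field_constant(1)[OF f b] by simp
    then have "cdel b ?S p = 0" for p by (simp add: dB h)
    then show "harm_delbar b F" using h(2) by (simp add: harm_delbar_def cdelbar_adj)
  qed
qed

section \<open>A plane wave that separates the harmonic spaces\<close>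

text \<open>
  For \<open>b = 4 \<pi>\<close>, multiplication by \<open>b/4 = \<pi>\<close> is minus the derivative of this function along \<open>(\<partial>t + i \<partial>x) / 2\<close>.
\<close>

definition wave :: "real^4 \<Rightarrow> complex" where
  "wave p = exp (2 * of_real pi * \<i> * of_real (p $ 2))"

lemma wave_has_derivative:
  "(wave has_derivative (\<lambda>v. 2 * of_real pi * \<i> * of_real (v $ 2) * wave p)) (at p)"
proof -
  have "((\<lambda>q::real^4. 2 * of_real pi * \<i> * complex_of_real (q $ 2)) has_derivative
      (\<lambda>v. 2 * of_real pi * \<i> * of_real (v $ 2))) (at p)"
    by (intro has_derivative_mult_right has_derivative_of_real bounded_linear_imp_has_derivative bounded_linear_vec_nth)
  from has_derivative_compose[OF this DERIV_exp[unfolded has_field_derivative_def]]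
  show ?thesis unfolding wave_def[abs_def] by (simp add: mult_ac)
qed

lemma dir_deriv_wave: "dir_deriv v wave = (\<lambda>p. 2 * of_real pi * \<i> * of_real (v $ 2) * wave p)"
  by (rule has_derivative_imp_dir_deriv) (rule wave_has_derivative)

lemma wave_differentiable: "wave differentiable (at p)"
  using wave_has_derivative by (rule differentiableI)

lemma inv_smooth_wave: "inv_smooth wave"
proof -
  have "C_k k wave" for k
  proof (induction k)
    case 0
    then show ?case
      by (simp add: continuous_on_eq_continuous_at differentiable_imp_continuous_within wave_differentiable)
  next
    case (Suc k)
    then show ?case unfolding C_k_Suc_dir_deriv dir_deriv_wave
      by (intro conjI allI C_k_mult C_k_const wave_differentiable)
  qed
  moreover have "invariant wave"
  proof -
    have "exp (2 * of_real pi * \<i> * of_int n) = (1 :: complex)" for n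
      using exp_integer_2pi[of "of_int n"] by (simp add: mult_ac)
    then show ?thesis
      by (simp add: invariant_def wave_def kt_deck_def vector_4_nth distrib_left exp_add)
  qed
  ultimately show ?thesis by (simp add: inv_smooth_def smooth_def)
qed

lemma fderiv_wave:
  "fderiv b P1 wave = (\<lambda>p. of_real pi * wave p)" "fderiv b Q1 wave = (\<lambda>p. - of_real pi * wave p)"
  "fderiv b P2 wave = (\<lambda>p. 0)" "fderiv b Q2 wave = (\<lambda>p. 0)"
  by (simp_all add: fderiv_dir_deriv dir_deriv_wave axis_def fun_eq_iff algebra_simps)

lemma wave_nonzero: "wave p \<noteq> 0"
  by (simp add: wave_def)

definition monomial :: "bool \<Rightarrow> bool \<Rightarrow> bool \<Rightarrow> bool \<Rightarrow> (real^4 \<Rightarrow> complex) \<Rightarrow> field" where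
  "monomial a b c d f = (\<lambda>p a' b' c' d'. if a' = a \<and> b' = b \<and> c' = c \<and> d' = d then f p else 0)"

lemma monomial_coeff:
  "coeff (monomial a b c d f) a' b' c' d' = (if a' = a \<and> b' = b \<and> c' = c \<and> d' = d then f else (\<lambda>p. 0))"
  by (auto simp: coeff_def monomial_def)

lemma monomial_pure:
  assumes "inv_smooth f"
  shows "pure_field (of_bool a + of_bool b) (of_bool c + of_bool d) (monomial a b c d f)"
proof -
  have "bideg (of_bool a + of_bool b) (of_bool c + of_bool d) (monomial a b c d f p) s t u v = monomial a b c d f p s t u v" for p s t u v
    by (cases "s = a \<and> t = b \<and> u = c \<and> v = d") (auto simp: bideg_def monomial_def)
  moreover have "inv_field (monomial a b c d f)"
    using assms by (simp add: inv_field_def monomial_coeff inv_smooth_const)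
  ultimately show ?thesis by (simp add: pure_field_def fun_eq_iff)
qed

text \<open>
  For \<open>w cnj \<phi>2\<close> the derivative of w cancels \<open>d (cnj \<phi>2)\<close> in \<open>\<partial>bar\<close>, while \<open>\<partial>\<close> has the component \<open>- \<pi> w\<close> along \<open>\<phi>2 \<and> cnj \<phi>1\<close>.
\<close>

lemma wave_01:
  "harm_delbar (4 * pi) (monomial False False False True wave)"
    "\<not> harm_BC (4 * pi) (monomial False False False True wave)"
proof -
  let ?F = "monomial False False False True wave"
  show "harm_delbar (4 * pi) ?F"
    by (simp add: harm_delbar_def ext_eq_0_iff all_bool_eq operator_entries coeff_apply[of ?F] monomial_coeff fderiv_wave)
  have "cdel (4 * pi) ?F p False True True False \<noteq> 0" for p
    by (simp add: operator_entries coeff_apply[of ?F] monomial_coeff fderiv_wave wave_nonzero)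
  then show "\<not> harm_BC (4 * pi) ?F" by (auto simp: harm_BC_def)
qed

text \<open>
  The star of \<open>w cnj \<phi>2\<close>, up to sign: its \<open>\<partial>\<close> and \<open>\<partial>\<^sup>*\<close> vanish because \<open>\<partial>bar\<^sup>*\<close> and \<open>\<partial>bar\<close> of \<open>w cnj \<phi>2\<close> do, and its \<open>\<partial>bar\<^sup>*\<close> is nonzero
  because \<open>\<partial> (w cnj \<phi>2)\<close> is.
\<close>

lemma wave_12:
  "harm_BC (4 * pi) (monomial True False True True wave)"
    "\<not> harm_delbar (4 * pi) (monomial True False True True wave)"
proof -
  let ?F = "monomial True False True True wave"
  have a: "cdel_adj (4 * pi) ?F p = 0" for p
    by (simp add: ext_eq_0_iff all_bool_eq operator_entries coeff_apply[of ?F] monomial_coeff fderiv_wave)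
  have "cdel (4 * pi) ?F p = 0" "cdelbar (4 * pi) ?F p = 0" for p
    by (simp_all add: ext_eq_0_iff all_bool_eq operator_entries coeff_apply[of ?F] monomial_coeff fderiv_wave)
  then show "harm_BC (4 * pi) ?F" by (simp add: harm_BC_def operator_zero a)
  have "\<exists>p. cdelbar_adj (4 * pi) ?F p \<noteq> 0"
    by (simp add: ext_eq_0_iff all_bool_eq operator_entries coeff_apply[of ?F] monomial_coeff fderiv_wave wave_nonzero)
  then show "\<not> harm_delbar (4 * pi) ?F" by (auto simp: harm_delbar_def)
qed

text \<open>
  The star of \<open>cnj w \<phi>2\<close>, up to sign. Here \<open>\<partial>bar\<^sup>* \<partial>\<^sup>*\<close> corresponds to \<open>\<partial> \<partial>bar (cnj w \<phi>2)\<close>. This does not vanish although \<open>\<partial> (cnj w \<phi>2) = 0\<close>, since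
  \<open>\<partial>\<close> and \<open>\<partial>bar\<close> do not anticommute on \<open>(1,0)\<close>-forms of a non-integrable structure.
\<close>

lemma wave_21:
  "harm_delbar (4 * pi) (monomial True True True False (\<lambda>p. cnj (wave p)))"
  "\<not> harm_BC (4 * pi) (monomial True True True False (\<lambda>p. cnj (wave p)))"
proof -
  let ?w = "\<lambda>p. cnj (wave p)"
  let ?F = "monomial True True True False ?w"
  note d = fderiv_cnj[OF inv_smooth_smooth[OF inv_smooth_wave]] fderiv_wave
  show "harm_delbar (4 * pi) ?F"
    by (simp add: harm_delbar_def ext_eq_0_iff all_bool_eq operator_entries coeff_apply[of ?F] monomial_coeff d)
  have e: "coeff (cdel_adj (4 * pi) ?F) s t u v = (\<lambda>p. if s \<and> \<not> t \<and> \<not> u \<and> v then of_real pi * ?w p else 0)" for s t u v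
    unfolding coeff_def[of "cdel_adj (4 * pi) ?F"]
    by (cases s; cases t; cases u; cases v; simp add: operator_entries coeff_apply[of ?F] monomial_coeff d)
  have "cdelbar_adj (4 * pi) (cdel_adj (4 * pi) ?F) p False True False False = of_real pi * (of_real pi * ?w p)" for p
    unfolding cdelbar_adj_def[of "4 * pi" "cdel_adj (4 * pi) ?F"]
    by (simp add: torsion_bar_adj_def exterior.simps interior.simps fderiv_ext_def coeff_apply[of "cdel_adj (4 * pi) ?F"] e)
  then have "cdelbar_adj (4 * pi) (cdel_adj (4 * pi) ?F) p False True False False \<noteq> 0" for p
    by (simp add: wave_nonzero)
  then show "\<not> harm_BC (4 * pi) ?F" by (auto simp: harm_BC_def)
qed

theorem proposition5p2:
  shows "(\<forall>b::real. b \<noteq> 0 \<longrightarrow>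
           (\<forall>(p, q) \<in> {(0,0), (1,0), (1,1), (2,0), (0,2), (2,2)}.
              harmonic_BC (kt_J b) (kt_omega b) p q = harmonic_delbar (kt_J b) (kt_omega b) p q)) \<and>
         (\<forall>(p, q) \<in> {(0,1), (2,1), (1,2)}. \<exists>b::real. b \<noteq> 0 \<and>
              harmonic_BC (kt_J b) (kt_omega b) p q \<noteq> harmonic_delbar (kt_J b) (kt_omega b) p q)"
proof (intro conjI allI impI)
  fix b :: real assume b: "b \<noteq> 0"
  show "\<forall>(p, q) \<in> {(0,0), (1,0), (1,1), (2,0), (0,2), (2,2)}.
      harmonic_BC (kt_J b) (kt_omega b) p q = harmonic_delbar (kt_J b) (kt_omega b) p q"
    using harmonic_eqI[OF b harm_iff_00[OF b]] harmonic_eqI[OF b harm_iff_10[OF b]] harmonic_eqI[OF b harm_iff_11[OF b]]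
      harmonic_eqI[OF b harm_iff_20] harmonic_eqI[OF b harm_iff_02] harmonic_eqI[OF b harm_iff_22[OF b]]
    by simp
next
  \<comment> \<open>With this b the wave satisfies \<open>(\<partial>t + i \<partial>x) w / 2 = - (b/4) w\<close>.\<close>
  have b: "4 * pi \<noteq> 0" by simp
  have 01: "pure_field 0 1 (monomial False False False True wave)"
    using monomial_pure[OF inv_smooth_wave, of False False False True] by simp
  have 12: "pure_field 1 2 (monomial True False True True wave)"
    using monomial_pure[OF inv_smooth_wave, of True False True True] by (simp add: numeral_2_eq_2)
  have 21: "pure_field 2 1 (monomial True True True False (\<lambda>p. cnj (wave p)))"
    using monomial_pure[OF inv_smooth_cnj[OF inv_smooth_wave], of True True True False] by (simp add: numeral_2_eq_2)
  show "\<forall>(p, q) \<in> {(0,1), (2,1), (1,2)}. \<exists>b::real. b \<noteq> 0 \<and>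
      harmonic_BC (kt_J b) (kt_omega b) p q \<noteq> harmonic_delbar (kt_J b) (kt_omega b) p q"
    using harmonic_neqI[OF b 01] harmonic_neqI[OF b 12] harmonic_neqI[OF b 21] wave_01 wave_12 wave_21 b
    by blast
qed

end
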